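(* Let $Q$ be the infinitesimal generator of an ergodic regular-jump Markov chain $\{(X(t),J(t));t\ge 0\}$ on $\mathbb F$ with stationary distribution $\pi$, and assume that for each $n\in\mathbb N$ the LC-block-augmented truncation ${}_{(n)}Q$ has a unique closed communicating class in $\mathbb F_n$; let ${}_{(n)}\pi$ be its stationary distribution. Suppose: (i) there exist $b>0$, $c>0$, $K\in\mathbb Z_+$ and a column vector $v\ge 0$ on $\mathbb F$ with $cv\ge e$ and $Qv\le -c\,v+b\,1_{\mathbb F_K}$, and the subvector $(v(k,i))_{(k,i)\in\overline{\mathbb F}_0}$ is positive and level-wise nondecreasing; (ii) there exist $b^\sharp>0$, $K^\sharp\in\mathbb Z_+$ and column vectors $v^\sharp\ge0$, $f^\sharp\ge e$ on $\mathbb F$ such that the subvector $(v^\sharp(k,i))_{(k,i)\in\overline{\mathbb F}_0}$ is level-wise nondecreasing and $Qv^\sharp\le -f^\sharp+b^\sharp 1_{\mathbb F_{K^\sharp}}$; (iii) there exist a column vector $a=(a(i))_{i\in\mathbb S_1}>0$ and two nondecreasing log-subadditive functions $V,T:[0,\infty)\to[1,\infty)$ such that $v(k)=V(k)a$ for all $k\in\mathbb N$, $\lim_{x\to\infty}T(x)=\infty$, $$\sup_{(k,i)\in\mathbb F}\frac{T(k)V(k)}{f^\sharp(k,i)}<\infty,\qquad \sup_{k,\ell\in\mathbb Z_+}T(\ell)\left\|\sum_{m=\ell+1}^\infty Q(k;k+m)V(m)a\right\|_\infty<\infty.$$ Let $\beta>0$ and fix any $N\in\{K,K+1,\dots\}$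 such that $O<[\Phi^{(\beta)}_{\mathbb F_N}]_{\mathbb F_K}\le[\Phi^{(\beta)}]_{\mathbb F_K}$. For $n\in\mathbb N$ let $$\widetilde E_N(n)=2\sum_{k=0}^n{}_{(n)}\pi(k)\sum_{m=n+1}^\infty Q(k;m)\left\{v(m)+v(n)+2b\left(\frac1c+\frac{2}{\beta\,\overline\phi^{(\beta)}_{K,N}}\right)e\right\},$$ $$\widetilde E_N^+(n)=4\sum_{k=0}^n{}_{(n)}\pi(k)\sum_{m=n+1}^\infty Q(k;m)\left\{v(m)+b\left(\frac1c+\frac{2}{\beta\,\overline\phi^{(\beta)}_{K,N}}\right)e\right\}.$$ Then for all $n\in\mathbb N$: $|\pi-{}_{(n)}\pi|\,g\le\frac{\pi g+1}{2}\widetilde E_N(n)$ for all $0\le g\le cv$; $\ \sup_{e\le g\le cv}\frac{|\pi-{}_{(n)}\pi|\,g}{\pi g}\le\widetilde E_N(n)$; and $$\widetilde E_N(n)\le\widetilde E_N^+(n)\le\frac{4r_0^\sharp r_1^\sharp b^\sharp}{T(n)}\left[1+\frac{\underline a^{-1}b}{V(n+1)}\left(\frac1c+\frac{2}{\beta\,\overline\phi^{(\beta)}_{K,N}}\right)\right],$$ where $\underline a=\min_{i\in\mathbb S_1}a(i)$ and $r_0^\sharp,r_1^\sharp$ are any positive numbers with $$r_0^\sharp\ge\sup_{(k,i)\in\mathbb F}\frac{T(k)V(k)}{f^\sharp(k,i)},\qquad r_1^\sharp\ge\sup_{k,\ell\in\mathbb Z_+}T(\ell)\left\|\sum_{m=\ell+1}^\infty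 Q(k;k+m)V(m)a\right\|_\infty.$$
   Context: Notation: $\mathbb Z_+=\{0,1,2,\dots\}$, $\mathbb N=\{1,2,\dots\}$. For $k\in\mathbb Z_+$, $\mathbb S_k=\{0,1,\dots,S_k\}$ with $S_k\in\mathbb Z_+$, and $S_k=S_1$ for all $k\in\mathbb N$. Levels: $\mathbb L_k=\{k\}\times\mathbb S_k$; $\mathbb F=\bigcup_{k\ge0}\mathbb L_k$, $\mathbb F_n=\bigcup_{k=0}^n\mathbb L_k$, $\overline{\mathbb F}_n=\mathbb F\setminus\mathbb F_n$. For a vector $x=(x(k,i))_{(k,i)\in\mathbb F}$, $x(k)=(x(k,i))_{i\in\mathbb S_k}$ is its subvector for level $k$. The subvector of $x$ on $\overline{\mathbb F}_0$ is level-wise nondecreasing if $x(k)\le x(k+1)$ for all $k\in\mathbb N$. $e$ is a column vector of ones of appropriate size, $1_{\mathbb C}$ is the column indicator vector of $\mathbb C\subseteq\mathbb F$, $O$ the zero matrix; inequalities and absolute values $|\cdot|$ of vectors and matrices are entrywise; $\|\cdot\|_\infty$ is the uniform norm. A function $F:[0,\infty)\to[1,\infty)$ is log-subadditive if $F(x+y)\le F(x)F(y)$ for all $x,y\ge0$. $\{(X(t),J(t))\}$ is a continuous-time regular-jump (non-explosive) Markov chain with state space $\mathbb F$, transition matrix function $P^{(t)}=(p^{(t)}(k,i;\ell,j))$ and stable, conservative infinitesimal generator $Q=(q(k,i;\ell,j))$ with blocks $Q(k;\ell)=(q(k,i;\ell,j))_{i\in\mathbb S_k,\,j\in\mathbb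 S_\ell}$. Ergodic means irreducible and positive recurrent; $\pi$ is the unique stationary distribution (row vector, $\pi Q=0$, $\pi e=1$). For $n\in\mathbb N$, the last-column-block-augmented (LC-block-augmented) truncation ${}_{(n)}Q$ of $Q$ is the conservative $q$-matrix on $\mathbb F$ with blocks $${}_{(n)}Q(k;\ell)=\begin{cases}Q(k;\ell),&k\in\mathbb Z_+,\ 0\le\ell\le n-1,\\ Q(k;n)+\sum_{m>n,\,m\ne k}Q(k;m),&k\in\mathbb Z_+,\ \ell=n,\\ Q(k;k),&k=\ell\ge n+1,\\ O,&\text{otherwise.}\end{cases}$$ ${}_{(n)}\pi=({}_{(n)}\pi(k,i))_{(k,i)\in\mathbb F}$ is its unique stationary distribution (row vector); ${}_{(n)}\pi(k)=0$ for $k\ge n+1$. For $\beta>0$: $\Phi^{(\beta)}=\int_0^\infty\beta e^{-\beta t}P^{(t)}\,dt$. For $N\ge K$, $Q_{\mathbb F_N}=(q(k,i;\ell,j))_{(k,i),(\ell,j)\in\mathbb F_N}$ is the northwest-corner truncation of $Q$, and $\Phi^{(\beta)}_{\mathbb F_N}=(\phi^{(\beta)}_{\mathbb F_N}(k,i;\ell,j))=\int_0^\infty\beta e^{-\beta t}\exp\{Q_{\mathbb F_N}t\}\,dt=(I-Q_{\mathbb F_N}/\beta)^{-1}$. $[\,\cdot\,]_{\mathbb F_K}$ denotes the $|\mathbb F_K|\times|\mathbb F_K|$ northwest corner of a matrix (rows and columns in $\mathbb F_K$). Finally $\overline\phi^{(\beta)}_{K,N}=\sup_{(\ell,j)\in\mathbb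 F_N}\min_{(k,i)\in\mathbb F_K}\phi^{(\beta)}_{\mathbb F_N}(k,i;\ell,j)$. *)

theory Defs
  imports "HOL-Probability.Probability"
begin

section \<open>Level-structured state space\<close>

text \<open>A state is a pair (level, phase); \<open>S k\<close> is the largest phase in level \<open>k\<close>.\<close>

type_synonym state = "nat \<times> nat"

definition states :: "(nat \<Rightarrow> nat) \<Rightarrow> state set" where
  "states S = {(k, i). i \<le> S k}"

definition states_upto :: "(nat \<Rightarrow> nat) \<Rightarrow> nat \<Rightarrow> state set" where
  "states_upto S n = {(k, i). k \<le> n \<and> i \<le> S k}"

definition levelwise_nondecreasing :: "(nat \<Rightarrow> nat) \<Rightarrow> (state \<Rightarrow> real) \<Rightarrow> bool" where
  "levelwise_nondecreasing S v \<longleftrightarrow> (\<forall>k\<ge>1. \<forall>i\<le>S k. v (k, i) \<le> v (Suc k, i))"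

definition log_subadditive :: "(real \<Rightarrow> real) \<Rightarrow> bool" where
  "log_subadditive F \<longleftrightarrow> (\<forall>x\<ge>0. \<forall>y\<ge>0. F (x + y) \<le> F x * F y)"


section \<open>Regular-jump Markov chains\<close>

text \<open>Discontinuities of a path on the half-line with respect to the discrete topology.\<close>

definition jump_times :: "(real \<Rightarrow> 'a) \<Rightarrow> real set" where
  "jump_times p = {t. 0 \<le> t \<and> \<not> (\<exists>e>0. \<forall>u\<ge>0. \<bar>u - t\<bar> < e \<longrightarrow> p u = p t)}"

definition regular_jump_path :: "(real \<Rightarrow> 'a) \<Rightarrow> bool" where
  "regular_jump_path p \<longleftrightarrow>
     (\<forall>t\<ge>0. \<exists>e>0. \<forall>s\<in>{t..<t + e}. p s = p t) \<and>
     (\<forall>t\<ge>0. finite (jump_times p \<inter> {..t}))"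

text \<open>\<open>M x\<close> is the law of the chain started in \<open>x\<close>.\<close>

definition transition :: "('a \<Rightarrow> 'w measure) \<Rightarrow> (real \<Rightarrow> 'w \<Rightarrow> 'a) \<Rightarrow> real \<Rightarrow> 'a \<Rightarrow> 'a \<Rightarrow> real" where
  "transition M X t x y = \<P>(w in M x. X t w = y)"

definition regular_jump_markov_chain ::
  "'a set \<Rightarrow> ('a \<Rightarrow> 'w measure) \<Rightarrow> (real \<Rightarrow> 'w \<Rightarrow> 'a) \<Rightarrow> bool" where
  "regular_jump_markov_chain A M X \<longleftrightarrow>
     (\<forall>x\<in>A. prob_space (M x) \<and>
        (\<forall>t\<ge>0. X t \<in> measurable (M x) (count_space A)) \<and>
        (AE w in M x. X 0 w = x) \<and>
        (AE w in M x. regular_jump_path (\<lambda>t. X t w)) \<and>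
        (\<forall>s\<ge>0. \<forall>t\<ge>0. \<forall>U h. \<forall>z\<in>A. \<forall>y\<in>A.
           finite U \<longrightarrow> U \<subseteq> {0..<s} \<longrightarrow>
           \<P>(w in M x. X s w = z \<and> (\<forall>u\<in>U. X u w = h u)) > 0 \<longrightarrow>
           \<P>(w in M x. X (s + t) w = y \<bar> X s w = z \<and> (\<forall>u\<in>U. X u w = h u))
             = transition M X t z y))"

definition is_generator :: "'a set \<Rightarrow> ('a \<Rightarrow> 'w measure) \<Rightarrow> (real \<Rightarrow> 'w \<Rightarrow> 'a) \<Rightarrow> ('a \<Rightarrow> 'a \<Rightarrow> real) \<Rightarrow> bool" where
  "is_generator A M X q \<longleftrightarrow>
     (\<forall>x\<in>A. \<forall>y\<in>A.
        ((\<lambda>h. (transition M X h x y - (if x = y then 1 else 0)) / h) \<longlongrightarrow> q x y) (at_right 0))"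

text \<open>Stability (finite diagonal) is built into the real-valued type of the entries.\<close>

definition conservative_q_matrix :: "'a set \<Rightarrow> ('a \<Rightarrow> 'a \<Rightarrow> real) \<Rightarrow> bool" where
  "conservative_q_matrix A q \<longleftrightarrow>
     (\<forall>x\<in>A. (\<forall>y\<in>A. y \<noteq> x \<longrightarrow> 0 \<le> q x y) \<and> (q x has_sum 0) A)"

definition irreducible_chain :: "'a set \<Rightarrow> ('a \<Rightarrow> 'w measure) \<Rightarrow> (real \<Rightarrow> 'w \<Rightarrow> 'a) \<Rightarrow> bool" where
  "irreducible_chain A M X \<longleftrightarrow> (\<forall>x\<in>A. \<forall>y\<in>A. \<exists>t>0. transition M X t x y > 0)"

text \<open>First time the path is in \<open>x\<close> after having left \<open>x\<close>; infinite if there is no such time.\<close>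

definition return_time :: "(real \<Rightarrow> 'a) \<Rightarrow> 'a \<Rightarrow> ennreal" where
  "return_time p x = (INF t\<in>{t. p t = x \<and> (\<exists>s\<ge>0. s < t \<and> p s \<noteq> x)}. ennreal t)"

definition positive_recurrent_chain :: "'a set \<Rightarrow> ('a \<Rightarrow> 'w measure) \<Rightarrow> (real \<Rightarrow> 'w \<Rightarrow> 'a) \<Rightarrow> bool" where
  "positive_recurrent_chain A M X \<longleftrightarrow>
     (\<forall>x\<in>A. (\<integral>\<^sup>+ w. return_time (\<lambda>t. X t w) x \<partial>M x) < \<infinity>)"

definition ergodic_chain :: "'a set \<Rightarrow> ('a \<Rightarrow> 'w measure) \<Rightarrow> (real \<Rightarrow> 'w \<Rightarrow> 'a) \<Rightarrow> bool" where
  "ergodic_chain A M X \<longleftrightarrow> irreducible_chain A M X \<and> positive_recurrent_chain A M X"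

definition stationary_distribution :: "'a set \<Rightarrow> ('a \<Rightarrow> 'a \<Rightarrow> real) \<Rightarrow> ('a \<Rightarrow> real) \<Rightarrow> bool" where
  "stationary_distribution A q p \<longleftrightarrow>
     (\<forall>x\<in>A. 0 \<le> p x) \<and> (p has_sum 1) A \<and> (\<forall>y\<in>A. ((\<lambda>x. p x * q x y) has_sum 0) A)"


section \<open>Communicating classes of a q-matrix\<close>

definition accessible :: "'a set \<Rightarrow> ('a \<Rightarrow> 'a \<Rightarrow> real) \<Rightarrow> 'a \<Rightarrow> 'a \<Rightarrow> bool" where
  "accessible A q x y \<longleftrightarrow> (x, y) \<in> {(u, w). u \<in> A \<and> w \<in> A \<and> u \<noteq> w \<and> q u w > 0}\<^sup>*"

definition communicating_class :: "'a set \<Rightarrow> ('a \<Rightarrow> 'a \<Rightarrow> real) \<Rightarrow> 'a set \<Rightarrow> bool" where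
  "communicating_class A q C \<longleftrightarrow>
     (\<exists>x\<in>A. C = {y\<in>A. accessible A q x y \<and> accessible A q y x})"

definition closed_communicating_class :: "'a set \<Rightarrow> ('a \<Rightarrow> 'a \<Rightarrow> real) \<Rightarrow> 'a set \<Rightarrow> bool" where
  "closed_communicating_class A q C \<longleftrightarrow>
     communicating_class A q C \<and> (\<forall>x\<in>C. \<forall>y\<in>A. accessible A q x y \<longrightarrow> y \<in> C)"


section \<open>Truncations\<close>

text \<open>The last-column-block-augmented truncation; meaningful for \<open>n \<ge> 1\<close>, where all levels
  \<open>m \<ge> n\<close> carry the same phases.\<close>

definition LC_truncation :: "nat \<Rightarrow> (state \<Rightarrow> state \<Rightarrow> real) \<Rightarrow> state \<Rightarrow> state \<Rightarrow> real" where
  "LC_truncation n Q = (\<lambda>(k, i) (l, j).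
     if l < n then Q (k, i) (l, j)
     else if l = n then Q (k, i) (n, j) + (\<Sum>\<^sub>\<infinity>m\<in>{n<..} - {k}. Q (k, i) (m, j))
     else if k = l then Q (k, i) (k, j)
     else 0)"

text \<open>Powers and exponential of the finite matrix \<open>A\<close> with rows and columns indexed by \<open>I\<close>.\<close>

primrec mat_power :: "'a set \<Rightarrow> ('a \<Rightarrow> 'a \<Rightarrow> real) \<Rightarrow> nat \<Rightarrow> 'a \<Rightarrow> 'a \<Rightarrow> real" where
  "mat_power I A 0 x y = (if x = y then 1 else 0)"
| "mat_power I A (Suc n) x y = (\<Sum>z\<in>I. A x z * mat_power I A n z y)"

definition mat_exp :: "'a set \<Rightarrow> ('a \<Rightarrow> 'a \<Rightarrow> real) \<Rightarrow> real \<Rightarrow> 'a \<Rightarrow> 'a \<Rightarrow> real" where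
  "mat_exp I A t x y = (\<Sum>n. t ^ n / fact n * mat_power I A n x y)"

definition Phi :: "('a \<Rightarrow> 'w measure) \<Rightarrow> (real \<Rightarrow> 'w \<Rightarrow> 'a) \<Rightarrow> real \<Rightarrow> 'a \<Rightarrow> 'a \<Rightarrow> real" where
  "Phi M X \<beta> x y = (LBINT t:{0..}. \<beta> * exp (- \<beta> * t) * transition M X t x y)"

definition Phi_trunc :: "(nat \<Rightarrow> nat) \<Rightarrow> (state \<Rightarrow> state \<Rightarrow> real) \<Rightarrow> real \<Rightarrow> nat \<Rightarrow> state \<Rightarrow> state \<Rightarrow> real" where
  "Phi_trunc S Q \<beta> N x y =
     (LBINT t:{0..}. \<beta> * exp (- \<beta> * t) * mat_exp (states_upto S N) Q t x y)"

definition phi_bar :: "(nat \<Rightarrow> nat) \<Rightarrow> (state \<Rightarrow> state \<Rightarrow> real) \<Rightarrow> real \<Rightarrow> nat \<Rightarrow> nat \<Rightarrow> real" where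
  "phi_bar S Q \<beta> K N =
     (SUP y\<in>states_upto S N. Min ((\<lambda>x. Phi_trunc S Q \<beta> N x y) ` states_upto S K))"


section \<open>Drift inequalities and error bounds\<close>

text \<open>The inequality \<open>q v \<le> h\<close> for a nonnegative column vector \<open>v\<close>.  Summability is stated because
  the series could a priori be \<open>+\<infinity>\<close>, where \<open>infsum\<close> would return \<open>0\<close>.\<close>

definition q_apply_le :: "'a set \<Rightarrow> ('a \<Rightarrow> 'a \<Rightarrow> real) \<Rightarrow> ('a \<Rightarrow> real) \<Rightarrow> ('a \<Rightarrow> real) \<Rightarrow> bool" where
  "q_apply_le A q v h \<longleftrightarrow>
     (\<forall>x\<in>A. (\<lambda>y. q x y * v y) summable_on A \<and> (\<Sum>\<^sub>\<infinity>y\<in>A. q x y * v y) \<le> h x)"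

text \<open>Sums of nonnegative terms are taken in the extended nonnegative reals, so that no convergence
  convention enters.  Below, \<open>Q x y\<close> is an off-diagonal entry wherever it occurs.\<close>

definition nn_pairing :: "'a set \<Rightarrow> ('a \<Rightarrow> real) \<Rightarrow> ('a \<Rightarrow> real) \<Rightarrow> ennreal" where
  "nn_pairing A p g = (\<Sum>\<^sub>\<infinity>x\<in>A. ennreal (p x * g x))"

text \<open>In the next two definitions \<open>pn\<close> is the stationary distribution of the truncation at \<open>n\<close>, and
  \<open>\<phi>\<close> stands for the value of \<open>phi_bar\<close>.\<close>

definition E_bound :: "(nat \<Rightarrow> nat) \<Rightarrow> (state \<Rightarrow> state \<Rightarrow> real) \<Rightarrow> (state \<Rightarrow> real) \<Rightarrow> (state \<Rightarrow> real)
    \<Rightarrow> real \<Rightarrow> real \<Rightarrow> real \<Rightarrow> real \<Rightarrow> nat \<Rightarrow> ennreal" where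
  "E_bound S Q pn v b c \<beta> \<phi> n =
     2 * (\<Sum>x\<in>states_upto S n. ennreal (pn x) *
       (\<Sum>\<^sub>\<infinity>(m, j)\<in>states S - states_upto S n.
          ennreal (Q x (m, j) * (v (m, j) + v (n, j) + 2 * b * (1 / c + 2 / (\<beta> * \<phi>))))))"

definition E_bound_plus :: "(nat \<Rightarrow> nat) \<Rightarrow> (state \<Rightarrow> state \<Rightarrow> real) \<Rightarrow> (state \<Rightarrow> real) \<Rightarrow> (state \<Rightarrow> real)
    \<Rightarrow> real \<Rightarrow> real \<Rightarrow> real \<Rightarrow> real \<Rightarrow> nat \<Rightarrow> ennreal" where
  "E_bound_plus S Q pn v b c \<beta> \<phi> n =
     4 * (\<Sum>x\<in>states_upto S n. ennreal (pn x) *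
       (\<Sum>\<^sub>\<infinity>(m, j)\<in>states S - states_upto S n.
          ennreal (Q x (m, j) * (v (m, j) + b * (1 / c + 2 / (\<beta> * \<phi>))))))"

text \<open>The two suprema controlling the convergence rate.  In the second one, the inner supremum over
  \<open>i\<close> is the uniform norm of a nonnegative vector on the phases of level \<open>k\<close>.\<close>

definition sup0 :: "(nat \<Rightarrow> nat) \<Rightarrow> (real \<Rightarrow> real) \<Rightarrow> (real \<Rightarrow> real) \<Rightarrow> (state \<Rightarrow> real) \<Rightarrow> ennreal" where
  "sup0 S V T f = (SUP (k, i)\<in>states S. ennreal (T (real k) * V (real k) / f (k, i)))"

definition sup1 :: "(nat \<Rightarrow> nat) \<Rightarrow> (state \<Rightarrow> state \<Rightarrow> real) \<Rightarrow> (real \<Rightarrow> real) \<Rightarrow> (real \<Rightarrow> real)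
    \<Rightarrow> (nat \<Rightarrow> real) \<Rightarrow> ennreal" where
  "sup1 S Q V T a = (SUP (k, l)\<in>UNIV. ennreal (T (real l)) *
     (SUP i\<in>{..S k}. \<Sum>\<^sub>\<infinity>m\<in>{l<..}. \<Sum>j\<le>S 1. ennreal (Q (k, i) (k + m, j) * V (real m) * a j)))"

end

theory Submission
  imports Defs "HOL-Real_Asymp.Real_Asymp"
begin

text \<open>
The weighted distance between \<open>\<pi>\<close> and the stationary vector \<open>p\<close> of a truncation \<open>Q\<^sub>n\<close> is controlled through a
Poisson equation.  Given \<open>0 \<le> g \<le> c v\<close>, let \<open>f\<close> be \<open>g\<close> times the sign of \<open>\<pi> - p\<close>, so that \<open>\<bar>\<pi> - p\<bar> g = \<pi> f - p f\<close>,
and let \<open>h\<close> solve \<open>Q h = \<pi> f - f\<close>.  Then \<open>\<pi> f - p f = p (Q h) = p ((Q - Q\<^sub>n) h)\<close>, because \<open>p Q\<^sub>n = 0\<close>, and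
\<open>Q - Q\<^sub>n\<close> only contains, in the rows that \<open>p\<close> charges, the jumps over level \<open>n\<close> that \<open>Q\<^sub>n\<close> redirects to level \<open>n\<close>.
Hence a pointwise bound \<open>\<bar>h\<bar> \<le> (\<pi> g + 1) (v + b (1/c + 2/(\<beta> \<phi>)))\<close> is all that the first two claims need
(lemmas \<open>truncation_mean_generator\<close> and \<open>truncation_error_bound\<close>).

The function \<open>h\<close> is constructed in discrete time, for the resolvent kernel \<open>\<Phi> = \<beta> (\<beta> - Q)\<^sup>-\<^sup>1\<close>.  The drift
condition on \<open>v\<close> turns into \<open>\<Phi> v \<le> v - (c/\<beta>) \<Phi> v + (b/\<beta>) \<Phi> 1\<^sub>K\<close>, and \<open>\<Phi>(x, y0) \<ge> \<phi>\<close> on the finite set \<open>K\<close> for a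
suitable state \<open>y0\<close>.  Removing this atom leaves a kernel \<open>G\<close>, the chain killed at a regeneration, and the
reward collected before the regeneration is bounded by the supersolution
\<open>u = v + (b/\<beta>) (1/\<phi> + 1 - 1\<^sub>K)\<close>.  For a centred function the
reward of a whole cycle has mean zero, which turns this reward into a solution of the Poisson equation
(lemma \<open>supersolution\<close>, theorem \<open>poisson_equation\<close>).

The facts about \<open>\<Phi>\<close> are those that hold for the minimal nonnegative solution of \<open>(\<beta> - Q) \<Phi> = \<beta> I\<close>, the limit
of the resolvents of the finite corners of \<open>Q\<close>.  They are inverses of M-matrices, so that each
inequality is an instance of inverse monotonicity followed by a monotone limit.  That the rows of
the limit have sum 1 is where the process enters: a path with finitely many jumps in every bounded
interval visits finitely many states, hence stays inside a large finite set with probability close to 1,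
and the probability of staying inside is at most the row sum of the exponential of the corner
(lemma \<open>mat_exp_row_sum_tendsto_1\<close>).  In particular \<open>\<pi> Q = 0\<close> implies \<open>\<pi> \<Phi> = \<pi>\<close>, which may fail for an
explosive generator.

For the explicit rate, log-subadditivity bounds the rate of \<open>V\<close>-weighted jumps from level \<open>k\<close> over level \<open>n\<close>
by a multiple of \<open>T(k) V(k) / T(n)\<close>, hence by a multiple of \<open>f\<^sub>s / T(n)\<close>; the second drift condition, which
passes to the truncation because \<open>v\<^sub>s\<close> is level-wise nondecreasing, gives \<open>p f\<^sub>s \<le> b\<^sub>s\<close>.
\<close>

section \<open>Powers and the exponential of a finite matrix\<close>

lemma sum_delta_mult:
  fixes f :: "'a \<Rightarrow> real"
  assumes "finite I" "x \<in> I"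
  shows "(\<Sum>z\<in>I. (if x = z then 1 else 0) * f z) = f x"
    and "(\<Sum>z\<in>I. (if z = x then 1 else 0) * f z) = f x"
    and "(\<Sum>z\<in>I. f z * (if z = x then 1 else 0)) = f x"
    and "(\<Sum>z\<in>I. f z * (if x = z then 1 else 0)) = f x"
  using assms by (simp_all add: if_distrib if_distribR cong: if_cong)

lemma mat_power_add:
  assumes "finite I" "x \<in> I"
  shows "mat_power I A (m + n) x y = (\<Sum>z\<in>I. mat_power I A m x z * mat_power I A n z y)"
  using assms(2)
proof (induction m arbitrary: x)
  case 0
  then show ?case using assms(1) by (simp add: sum_delta_mult)
next
  case (Suc m)
  have "mat_power I A (Suc m + n) x y
      = (\<Sum>w\<in>I. A x w * (\<Sum>z\<in>I. mat_power I A m w z * mat_power I A n z y))"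
    using Suc.IH by simp
  also have "\<dots> = (\<Sum>w\<in>I. \<Sum>z\<in>I. A x w * mat_power I A m w z * mat_power I A n z y)"
    by (simp add: sum_distrib_left mult_ac)
  also have "\<dots> = (\<Sum>z\<in>I. \<Sum>w\<in>I. A x w * mat_power I A m w z * mat_power I A n z y)"
    by (rule sum.swap)
  finally show ?case by (simp add: sum_distrib_right)
qed

lemma mat_power_1: "finite I \<Longrightarrow> y \<in> I \<Longrightarrow> mat_power I A (Suc 0) x y = A x y"
  by (simp add: sum_delta_mult)

lemma mat_power_Suc_right:
  assumes "finite I" "x \<in> I" "y \<in> I"
  shows "mat_power I A (Suc n) x y = (\<Sum>z\<in>I. mat_power I A n x z * A z y)"
  using mat_power_add[OF assms(1,2), of A n 1 y] assms(3,1) mat_power_1[of I y A]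
  by simp

text \<open>A crude norm, but its powers dominate the entries of the matrix powers.\<close>

definition mat_norm :: "'a set \<Rightarrow> ('a \<Rightarrow> 'a \<Rightarrow> real) \<Rightarrow> real" where
  "mat_norm I A = (\<Sum>x\<in>I. \<Sum>y\<in>I. \<bar>A x y\<bar>)"

lemma mat_norm_nonneg: "0 \<le> mat_norm I A"
  unfolding mat_norm_def by (intro sum_nonneg) auto

lemma row_le_mat_norm: "finite I \<Longrightarrow> x \<in> I \<Longrightarrow> (\<Sum>y\<in>I. \<bar>A x y\<bar>) \<le> mat_norm I A"
  unfolding mat_norm_def by (rule member_le_sum) (auto intro: sum_nonneg)

lemma abs_mat_power_le:
  assumes "finite I" "x \<in> I"
  shows "\<bar>mat_power I A n x y\<bar> \<le> mat_norm I A ^ n"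
  using assms(2)
proof (induction n arbitrary: x)
  case (Suc n)
  have "\<bar>mat_power I A (Suc n) x y\<bar> \<le> (\<Sum>z\<in>I. \<bar>A x z\<bar> * \<bar>mat_power I A n z y\<bar>)"
    by (simp add: abs_mult[symmetric])
  also have "\<dots> \<le> (\<Sum>z\<in>I. \<bar>A x z\<bar> * mat_norm I A ^ n)"
    by (intro sum_mono mult_left_mono Suc.IH) auto
  also have "\<dots> \<le> mat_norm I A * mat_norm I A ^ n"
    unfolding sum_distrib_right[symmetric]
    by (intro mult_right_mono row_le_mat_norm) (use Suc.prems assms mat_norm_nonneg[of I A] in auto)
  finally show ?case by simp
qed simp

lemma mat_exp_term_le:
  assumes "finite I" "x \<in> I"
  shows "norm (t ^ n / fact n * mat_power I A n x y) \<le> (\<bar>t\<bar> * mat_norm I A) ^ n /\<^sub>R fact n"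
proof -
  have "norm (t ^ n / fact n * mat_power I A n x y) = \<bar>t\<bar> ^ n / fact n * \<bar>mat_power I A n x y\<bar>"
    by (simp add: abs_mult power_abs)
  also have "\<dots> \<le> \<bar>t\<bar> ^ n / fact n * mat_norm I A ^ n"
    by (intro mult_left_mono abs_mat_power_le assms) auto
  finally show ?thesis by (simp add: power_mult_distrib divide_inverse mult_ac)
qed

lemma summable_mat_exp:
  assumes "finite I" "x \<in> I"
  shows "summable (\<lambda>n. norm (t ^ n / fact n * mat_power I A n x y))"
  by (rule summable_comparison_test'[OF summable_exp_generic[of "\<bar>t\<bar> * mat_norm I A"], of 0])
     (use mat_exp_term_le[OF assms, of t _ A y] in simp)

lemma abs_mat_exp_le:
  assumes "finite I" "x \<in> I"
  shows "\<bar>mat_exp I A t x y\<bar> \<le> exp (\<bar>t\<bar> * mat_norm I A)"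
proof -
  have "\<bar>mat_exp I A t x y\<bar> \<le> (\<Sum>n. norm (t ^ n / fact n * mat_power I A n x y))"
    unfolding mat_exp_def using summable_norm[OF summable_mat_exp[OF assms]] by simp
  also have "\<dots> \<le> (\<Sum>n. (\<bar>t\<bar> * mat_norm I A) ^ n /\<^sub>R fact n)"
    by (intro suminf_le summable_mat_exp summable_exp_generic mat_exp_term_le assms)
  finally show ?thesis by (simp add: exp_def)
qed

lemma mat_exp_0: "mat_exp I A 0 x y = (if x = y then 1 else 0)"
  unfolding mat_exp_def
  using powser_zero[of "\<lambda>n. mat_power I A n x y / fact n"] by (simp add: mult.commute)

text \<open>The Cauchy product of the two series, with the binomial theorem for the commuting scalars and
  additivity of the exponent for the matrix powers.\<close>

lemma mat_exp_add:
  assumes "finite I" "x \<in> I"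
  shows "mat_exp I A (s + t) x y = (\<Sum>z\<in>I. mat_exp I A s x z * mat_exp I A t z y)"
proof -
  let ?a = "\<lambda>z n. s ^ n / fact n * mat_power I A n x z"
  let ?b = "\<lambda>z n. t ^ n / fact n * mat_power I A n z y"
  have coeff: "(s + t) ^ n / fact n * mat_power I A n x y
      = (\<Sum>z\<in>I. \<Sum>k\<le>n. ?a z k * ?b z (n - k))" for n
  proof -
    have "(s + t) ^ n / fact n * mat_power I A n x y
        = (\<Sum>k\<le>n. (s ^ k / fact k) * (t ^ (n - k) / fact (n - k)) * mat_power I A n x y)"
      by (simp add: binomial_ring sum_divide_distrib sum_distrib_right sum_distrib_left binomial_fact mult_ac)
    also have "\<dots> = (\<Sum>k\<le>n. \<Sum>z\<in>I. ?a z k * ?b z (n - k))"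
    proof (intro sum.cong refl)
      fix k assume "k \<in> {..n}"
      then have "mat_power I A n x y = (\<Sum>z\<in>I. mat_power I A k x z * mat_power I A (n - k) z y)"
        using mat_power_add[OF assms, of A k "n - k" y] by simp
      then show "(s ^ k / fact k) * (t ^ (n - k) / fact (n - k)) * mat_power I A n x y
          = (\<Sum>z\<in>I. ?a z k * ?b z (n - k))"
        by (simp add: sum_distrib_left mult_ac)
    qed
    also have "\<dots> = (\<Sum>z\<in>I. \<Sum>k\<le>n. ?a z k * ?b z (n - k))"
      by (rule sum.swap)
    finally show ?thesis .
  qed
  have "mat_exp I A (s + t) x y = (\<Sum>n. \<Sum>z\<in>I. \<Sum>k\<le>n. ?a z k * ?b z (n - k))"
    unfolding mat_exp_def coeff ..
  also have "\<dots> = (\<Sum>z\<in>I. \<Sum>n. \<Sum>k\<le>n. ?a z k * ?b z (n - k))"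
    by (intro suminf_sum summable_Cauchy_product summable_mat_exp assms)
  also have "\<dots> = (\<Sum>z\<in>I. mat_exp I A s x z * mat_exp I A t z y)"
    unfolding mat_exp_def
    by (intro sum.cong refl Cauchy_product[symmetric] summable_mat_exp assms)
  finally show ?thesis .
qed

lemma DERIV_mat_exp_0:
  assumes "finite I" "x \<in> I" "y \<in> I"
  shows "((\<lambda>t. mat_exp I A t x y) has_real_derivative A x y) (at 0)"
proof -
  let ?c = "\<lambda>n. mat_power I A n x y / fact n"
  have "summable (\<lambda>n. ?c n * 1 ^ n)"
    using summable_norm_cancel[OF summable_mat_exp[OF assms(1,2), of 1 A y]] by simp
  then have "DERIV (\<lambda>t. \<Sum>n. ?c n * t ^ n) 0 :> (\<Sum>n. diffs ?c n * 0 ^ n)"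
    by (rule termdiffs_strong) simp
  moreover have "(\<Sum>n. diffs ?c n * 0 ^ n) = A x y"
    using assms by (simp only: powser_zero) (simp add: diffs_def sum_delta_mult)
  ultimately show ?thesis
    unfolding mat_exp_def by (simp add: mult_ac)
qed

text \<open>By the semigroup property the derivative at any time is determined by the one at 0; splitting off
  the small time on the left or on the right gives the backward and the forward equation.\<close>

lemma DERIV_mat_exp_left:
  assumes "finite I" "x \<in> I" "y \<in> I"
  shows "((\<lambda>t. mat_exp I A t x y) has_real_derivative (\<Sum>z\<in>I. A x z * mat_exp I A t z y)) (at t)"
proof -
  have "((\<lambda>h. \<Sum>z\<in>I. mat_exp I A h x z * mat_exp I A t z y)
      has_real_derivative (\<Sum>z\<in>I. A x z * mat_exp I A t z y)) (at 0)"
    by (intro DERIV_sum DERIV_cmult_right DERIV_mat_exp_0 assms)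
  then have "((\<lambda>h. mat_exp I A (h + t) x y)
      has_real_derivative (\<Sum>z\<in>I. A x z * mat_exp I A t z y)) (at 0)"
    by (simp add: mat_exp_add[OF assms(1,2)])
  then show ?thesis
    using DERIV_shift[of "\<lambda>h. mat_exp I A h x y" _ 0 t] by simp
qed

lemma DERIV_mat_exp_right:
  assumes "finite I" "x \<in> I" "y \<in> I"
  shows "((\<lambda>t. mat_exp I A t x y) has_real_derivative (\<Sum>z\<in>I. mat_exp I A t x z * A z y)) (at t)"
proof -
  have "((\<lambda>h. \<Sum>z\<in>I. mat_exp I A t x z * mat_exp I A h z y)
      has_real_derivative (\<Sum>z\<in>I. mat_exp I A t x z * A z y)) (at 0)"
    by (intro DERIV_sum DERIV_cmult DERIV_mat_exp_0 assms)
  then have "((\<lambda>h. mat_exp I A (h + t) x y)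
      has_real_derivative (\<Sum>z\<in>I. mat_exp I A t x z * A z y)) (at 0)"
    by (simp add: mat_exp_add[OF assms(1,2), symmetric] add.commute)
  then show ?thesis
    using DERIV_shift[of "\<lambda>h. mat_exp I A h x y" _ 0 t] by simp
qed

lemma filterlim_divide_nat_at_right:
  assumes "0 < t"
  shows "filterlim (\<lambda>m. t / real m) (at_right 0) sequentially"
  unfolding filterlim_at
proof
  show "\<forall>\<^sub>F m in sequentially. t / real m \<in> {0<..} \<and> t / real m \<noteq> 0"
    using eventually_gt_at_top[of 0] by eventually_elim (use assms in auto)
  show "(\<lambda>m. t / real m) \<longlonglongrightarrow> 0"
    by (intro tendsto_divide_0[OF tendsto_const] filterlim_at_top_imp_at_infinity
        filterlim_real_sequentially)
qed

text \<open>The telescoping argument behind the Lax equivalence theorem: a step of length \<open>h\<close> of the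
  family \<open>P\<close> and of the exponential differ by \<open>o(h)\<close>, and these errors add up over the \<open>m\<close> steps
  because the powers of \<open>P h\<close> are contractions.  The family will be the transition probabilities
  of the chain, and Euler's \<open>I + h A\<close>.\<close>

lemma mat_power_tendsto_mat_exp:
  fixes P :: "real \<Rightarrow> 'a \<Rightarrow> 'a \<Rightarrow> real"
  assumes I: "finite I"
    and deriv: "\<And>x y. x \<in> I \<Longrightarrow> y \<in> I \<Longrightarrow>
      ((\<lambda>h. (P h x y - (if x = y then 1 else 0)) / h) \<longlongrightarrow> A x y) (at_right 0)"
    and substoch: "\<forall>\<^sub>F h in at_right 0. \<forall>x\<in>I. (\<forall>y\<in>I. 0 \<le> P h x y) \<and> (\<Sum>y\<in>I. P h x y) \<le> 1"
    and t: "0 < t" and x: "x \<in> I" and y: "y \<in> I"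
  shows "(\<lambda>m. mat_power I (P (t / real m)) m x y) \<longlonglongrightarrow> mat_exp I A t x y"
proof -
  define C where "C = exp (t * mat_norm I A)"
  have C0: "C > 0" by (simp add: C_def)
  have C: "\<bar>mat_exp I A s u w\<bar> \<le> C" if "0 \<le> s" "s \<le> t" "u \<in> I" for s u w
  proof -
    have "\<bar>s\<bar> * mat_norm I A \<le> t * mat_norm I A"
      using that mat_norm_nonneg[of I A] by (intro mult_right_mono) auto
    then show ?thesis
      using order.trans[OF abs_mat_exp_le[OF I that(3)]] by (auto simp: C_def)
  qed
  have diff: "((\<lambda>h. (P h u w - mat_exp I A h u w) / h) \<longlongrightarrow> 0) (at_right 0)"
    if "u \<in> I" "w \<in> I" for u w
  proof -
    have "((\<lambda>h. (mat_exp I A h u w - (if u = w then 1 else 0)) / h) \<longlongrightarrow> A u w) (at 0)"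
      using DERIV_mat_exp_0[OF I that, of A] by (simp add: DERIV_def mat_exp_0)
    then have "((\<lambda>h. (mat_exp I A h u w - (if u = w then 1 else 0)) / h) \<longlongrightarrow> A u w) (at_right 0)"
      by (rule filterlim_mono) (auto simp: at_le)
    from tendsto_diff[OF deriv[OF that] this] show ?thesis
      by (simp add: diff_divide_distrib[symmetric])
  qed
  show ?thesis
  proof (rule LIMSEQ_I)
    fix e :: real assume e: "e > 0"
    \<comment> \<open>The \<open>m\<close> steps of length \<open>t / m\<close> accumulate an error of \<open>d t C card I\<close>, here at most \<open>e / 2\<close>.\<close>
    define d where "d = e / (2 * t * C * (real (card I) + 1))"
    have d: "d > 0" using e t C0 by (simp add: d_def)
    have "\<forall>\<^sub>F h in at_right 0. \<forall>u\<in>I. \<forall>w\<in>I. \<bar>(P h u w - mat_exp I A h u w) / h\<bar> < d"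
    proof (intro eventually_ball_finite ballI I)
      fix u w assume "u \<in> I" "w \<in> I"
      from tendstoD[OF diff[OF this] d]
      show "\<forall>\<^sub>F h in at_right 0. \<bar>(P h u w - mat_exp I A h u w) / h\<bar> < d"
        by (simp add: dist_real_def)
    qed
    with substoch have "\<forall>\<^sub>F h in at_right 0.
        (\<forall>u\<in>I. (\<forall>w\<in>I. 0 \<le> P h u w) \<and> (\<Sum>w\<in>I. P h u w) \<le> 1) \<and>
        (\<forall>u\<in>I. \<forall>w\<in>I. \<bar>(P h u w - mat_exp I A h u w) / h\<bar> < d)"
      by (rule eventually_conj)
    moreover have "filterlim (\<lambda>m. t / real m) (at_right 0) sequentially"
      by (rule filterlim_divide_nat_at_right[OF t])
    ultimately have "\<forall>\<^sub>F m in sequentially.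
        (\<forall>u\<in>I. (\<forall>w\<in>I. 0 \<le> P (t / real m) u w) \<and> (\<Sum>w\<in>I. P (t / real m) u w) \<le> 1) \<and>
        (\<forall>u\<in>I. \<forall>w\<in>I. \<bar>(P (t / real m) u w - mat_exp I A (t / real m) u w) / (t / real m)\<bar> < d)"
      by (rule eventually_compose_filterlim)
    then have "\<forall>\<^sub>F m in sequentially. norm (mat_power I (P (t / real m)) m x y - mat_exp I A t x y) < e"
      using eventually_gt_at_top[of 0]
    proof eventually_elim
      case (elim m)
      define h where "h = t / real m"
      have h: "h > 0" "real m * h = t" using elim t by (auto simp: h_def)
      have step: "\<bar>P h u w - mat_exp I A h u w\<bar> \<le> d * h" if "u \<in> I" "w \<in> I" for u w
      proof -
        have "\<bar>(P h u w - mat_exp I A h u w) / h\<bar> < d"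
          using elim that by (auto simp: h_def)
        then show ?thesis using h by (simp add: field_simps)
      qed
      have "\<bar>mat_power I (P h) k u y - mat_exp I A (real k * h) u y\<bar> \<le> real k * (d * h * C * real (card I))"
        if "k \<le> m" "u \<in> I" for k u
        using that
      proof (induction k arbitrary: u)
        case 0
        then show ?case by (simp add: mat_exp_0)
      next
        case (Suc k)
        let ?D = "d * h * C * real (card I)"
        have kh: "0 \<le> real k * h" "real k * h \<le> t"
          using Suc.prems h mult_right_mono[of "real k" "real m" h] by auto
        have eq: "mat_exp I A (real (Suc k) * h) u y
            = (\<Sum>z\<in>I. mat_exp I A h u z * mat_exp I A (real k * h) z y)"
          using mat_exp_add[OF I Suc.prems(2), of A h "real k * h" y] by (simp add: algebra_simps)
        have "mat_power I (P h) (Suc k) u y - mat_exp I A (real (Suc k) * h) u y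
           = (\<Sum>z\<in>I. P h u z * (mat_power I (P h) k z y - mat_exp I A (real k * h) z y))
             + (\<Sum>z\<in>I. (P h u z - mat_exp I A h u z) * mat_exp I A (real k * h) z y)"
          unfolding eq by (simp add: sum.distrib[symmetric] sum_subtractf[symmetric] algebra_simps)
        then have "\<bar>mat_power I (P h) (Suc k) u y - mat_exp I A (real (Suc k) * h) u y\<bar>
           \<le> \<bar>\<Sum>z\<in>I. P h u z * (mat_power I (P h) k z y - mat_exp I A (real k * h) z y)\<bar>
             + \<bar>\<Sum>z\<in>I. (P h u z - mat_exp I A h u z) * mat_exp I A (real k * h) z y\<bar>"
          by (simp only: abs_triangle_ineq)
        also have "\<dots> \<le> (\<Sum>z\<in>I. P h u z * (real k * ?D)) + (\<Sum>z\<in>I. d * h * C)"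
        proof (rule add_mono; rule order.trans[OF sum_abs sum_mono])
          fix z assume z: "z \<in> I"
          have "0 \<le> P h u z" using elim Suc.prems z by (auto simp: h_def)
          then show "\<bar>P h u z * (mat_power I (P h) k z y - mat_exp I A (real k * h) z y)\<bar>
              \<le> P h u z * (real k * ?D)"
            using Suc.IH[of z] Suc.prems z by (simp add: abs_mult mult_left_mono)
          show "\<bar>(P h u z - mat_exp I A h u z) * mat_exp I A (real k * h) z y\<bar> \<le> d * h * C"
            unfolding abs_mult using step[OF Suc.prems(2) z] C[OF kh z, of y] d h
            by (intro mult_mono) auto
        qed
        also have "(\<Sum>z\<in>I. P h u z * (real k * ?D)) \<le> 1 * (real k * ?D)"
          unfolding sum_distrib_right[symmetric]
        proof (rule mult_right_mono)
          show "(\<Sum>z\<in>I. P h u z) \<le> 1" using elim Suc.prems by (auto simp: h_def)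
          show "0 \<le> real k * ?D" using d h C0 by simp
        qed
        finally show ?case by (simp add: algebra_simps)
      qed
      from this[of m x] have "\<bar>mat_power I (P h) m x y - mat_exp I A t x y\<bar>
          \<le> d * t * C * real (card I)"
        using x h(2) by (metis (no_types, lifting) mult.assoc mult.commute order_refl)
      also have "\<dots> \<le> d * t * C * (real (card I) + 1)"
        using d t C0 by (intro mult_left_mono) auto
      also have "\<dots> = e / 2"
      proof -
        have "2 * t * C * (real (card I) + 1) \<noteq> 0" using t C0 by auto
        then have "d * (2 * t * C * (real (card I) + 1)) = e" unfolding d_def by simp
        then show ?thesis by (simp add: algebra_simps)
      qed
      also have "\<dots> < e" using e by simp
      finally show ?case by (simp add: h_def)
    qed
    then show "\<exists>no. \<forall>n\<ge>no. norm (mat_power I (P (t / real n)) n x y - mat_exp I A t x y) < e"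
      by (simp add: eventually_sequentially)
  qed
qed

lemma mat_power_substochastic:
  assumes "finite I" "\<And>x y. x \<in> I \<Longrightarrow> y \<in> I \<Longrightarrow> 0 \<le> P x y" "\<And>x. x \<in> I \<Longrightarrow> (\<Sum>y\<in>I. P x y) \<le> (1::real)"
    and "x \<in> I"
  shows "(\<forall>y\<in>I. 0 \<le> mat_power I P n x y) \<and> (\<Sum>y\<in>I. mat_power I P n x y) \<le> 1"
  using assms(4)
proof (induction n arbitrary: x)
  case 0
  then show ?case using assms(1) by simp
next
  case (Suc n)
  have sum_eq: "(\<Sum>y\<in>I. mat_power I P (Suc n) x y) = (\<Sum>z\<in>I. P x z * (\<Sum>y\<in>I. mat_power I P n z y))"
    unfolding mat_power.simps sum_distrib_left by (rule sum.swap)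
  also have "\<dots> \<le> (\<Sum>z\<in>I. P x z * 1)"
    using Suc assms(2) by (intro sum_mono mult_left_mono) auto
  also have "\<dots> \<le> 1" using assms(3) Suc.prems by simp
  finally have "(\<Sum>y\<in>I. mat_power I P (Suc n) x y) \<le> 1"
    by simp
  then show ?case using Suc assms(1,2) by (auto intro!: sum_nonneg mult_nonneg_nonneg)
qed

text \<open>A finite matrix which is a northwest corner of a q-matrix.\<close>

definition sub_q_matrix :: "'a set \<Rightarrow> ('a \<Rightarrow> 'a \<Rightarrow> real) \<Rightarrow> bool" where
  "sub_q_matrix I A \<longleftrightarrow> finite I \<and>
     (\<forall>x\<in>I. (\<forall>y\<in>I. y \<noteq> x \<longrightarrow> 0 \<le> A x y) \<and> (\<Sum>y\<in>I. A x y) \<le> 0)"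

text \<open>Euler's matrix \<open>I + h A\<close> is substochastic for small \<open>h\<close>, hence so are its powers and their limits.\<close>

lemma mat_exp_substochastic:
  assumes A: "sub_q_matrix I A" and t: "0 \<le> t" and x: "x \<in> I"
  shows "(\<forall>y\<in>I. 0 \<le> mat_exp I A t x y) \<and> (\<Sum>y\<in>I. mat_exp I A t x y) \<le> 1"
proof (cases "t = 0")
  case True
  then show ?thesis using A x by (simp add: mat_exp_0 sub_q_matrix_def)
next
  case False
  let ?P = "\<lambda>h x y. (if x = y then 1 else 0) + h * A x y"
  have I: "finite I" using A by (simp add: sub_q_matrix_def)
  have sub: "\<forall>\<^sub>F h in at_right 0. \<forall>x\<in>I. (\<forall>y\<in>I. 0 \<le> ?P h x y) \<and> (\<Sum>y\<in>I. ?P h x y) \<le> 1"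
  proof -
    have "\<forall>\<^sub>F h in at_right 0. h < 1 / (mat_norm I A + 1)"
      using mat_norm_nonneg[of I A] by (intro eventually_at_rightI[of 0 "1 / (mat_norm I A + 1)"]) auto
    then show ?thesis using eventually_at_right_less[of 0]
    proof eventually_elim
      case (elim h)
      have h: "h * (mat_norm I A + 1) < 1" using elim mat_norm_nonneg[of I A] by (simp add: field_simps)
      show ?case
      proof (intro ballI conjI)
        fix x y assume xy: "x \<in> I" "y \<in> I"
        show "0 \<le> ?P h x y"
        proof (cases "x = y")
          case True
          have "\<bar>A x x\<bar> \<le> (\<Sum>y\<in>I. \<bar>A x y\<bar>)" using xy I by (intro member_le_sum) auto
          also have "\<dots> \<le> mat_norm I A" using xy I by (intro row_le_mat_norm) auto
          finally have "h * \<bar>A x x\<bar> \<le> h * (mat_norm I A + 1)"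
            using elim by (intro mult_left_mono) auto
          with h have "h * \<bar>A x x\<bar> \<le> 1" by linarith
          then have "\<bar>h * A x x\<bar> \<le> 1" using elim by (simp add: abs_mult)
          then show ?thesis using True by simp
        next
          case False
          then show ?thesis using A elim xy by (auto simp: sub_q_matrix_def)
        qed
      next
        fix x assume "x \<in> I"
        then show "(\<Sum>y\<in>I. ?P h x y) \<le> 1"
          using A elim by (simp add: sub_q_matrix_def sum.distrib sum_distrib_left[symmetric] mult_nonneg_nonpos)
      qed
    qed
  qed
  have lim: "(\<lambda>m. mat_power I (?P (t / real m)) m x y) \<longlonglongrightarrow> mat_exp I A t x y" if "y \<in> I" for y
  proof (rule mat_power_tendsto_mat_exp[OF I _ sub])
    show "((\<lambda>h. (?P h u w - (if u = w then 1 else 0)) / h) \<longlongrightarrow> A u w) (at_right 0)" for u w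
      by (rule tendsto_eventually) (use eventually_at_right_less[of 0] in eventually_elim, simp)
  qed (use t False x that in auto)
  have ev: "\<forall>\<^sub>F m in sequentially. (\<forall>y\<in>I. 0 \<le> mat_power I (?P (t / real m)) m x y)
      \<and> (\<Sum>y\<in>I. mat_power I (?P (t / real m)) m x y) \<le> 1"
  proof -
    have "filterlim (\<lambda>m. t / real m) (at_right 0) sequentially"
      by (rule filterlim_divide_nat_at_right) (use t False in auto)
    from eventually_compose_filterlim[OF sub this] show ?thesis
    proof eventually_elim
      case (elim m)
      show ?case
        by (rule mat_power_substochastic[OF I _ _ x]) (use elim in blast)+
    qed
  qed
  show ?thesis
  proof (intro ballI conjI)
    fix y assume y: "y \<in> I"
    have "\<forall>\<^sub>F m in sequentially. 0 \<le> mat_power I (?P (t / real m)) m x y"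
      using ev by eventually_elim (use y in blast)
    then show "0 \<le> mat_exp I A t x y"
      by (rule tendsto_lowerbound[OF lim[OF y]]) simp
  next
    have "\<forall>\<^sub>F m in sequentially. (\<Sum>y\<in>I. mat_power I (?P (t / real m)) m x y) \<le> 1"
      using ev by eventually_elim blast
    then show "(\<Sum>y\<in>I. mat_exp I A t x y) \<le> 1"
      by (intro tendsto_upperbound[OF tendsto_sum[OF lim]]) simp_all
  qed
qed

section \<open>Resolvents of finite matrices\<close>

definition finite_resolvent :: "'a set \<Rightarrow> ('a \<Rightarrow> 'a \<Rightarrow> real) \<Rightarrow> real \<Rightarrow> 'a \<Rightarrow> 'a \<Rightarrow> real" where
  "finite_resolvent I A \<beta> x y = (LBINT t:{0..}. \<beta> * exp (- \<beta> * t) * mat_exp I A t x y)"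

text \<open>The derivative may change sign here, so integrability is a hypothesis and cannot be concluded from
  the existence of the limit.\<close>

lemma LBINT_atLeast_FTC:
  fixes F f :: "real \<Rightarrow> real"
  assumes "\<And>t. (F has_real_derivative f t) (at t)" "\<And>t. isCont f t"
    and int: "set_integrable lborel {0..} f" and lim: "(F \<longlongrightarrow> 0) at_top"
  shows "(LBINT t:{0..}. f t) = - F 0"
proof -
  have "((\<lambda>b. LBINT t:{0..b}. f t) \<longlongrightarrow> (LBINT t:{0..}. f t)) at_top"
    by (rule tendsto_set_lebesgue_integral_at_top) (use int in auto)
  moreover have "\<forall>\<^sub>F b in at_top. F b - F 0 = (LBINT t:{0..b}. f t)"
    using eventually_ge_at_top[of 0]
  proof eventually_elim
    case (elim b)
    show ?case
      using integral_FTC_Icc_real[OF elim assms(1,2)]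
      by (simp add: set_lebesgue_integral_def mult.commute)
  qed
  then have "((\<lambda>b. LBINT t:{0..b}. f t) \<longlongrightarrow> 0 - F 0) at_top"
    by (rule Lim_transform_eventually[rotated]) (intro tendsto_diff lim tendsto_const)
  ultimately show ?thesis
    using tendsto_unique trivial_limit_at_top_linorder by fastforce
qed

lemma
  assumes "0 < (\<beta>::real)"
  shows exp_weight_integrable: "set_integrable lborel {0..} (\<lambda>t. \<beta> * exp (- \<beta> * t))"
    and exp_weight_integral: "(LBINT t:{0..}. \<beta> * exp (- \<beta> * t)) = 1"
proof -
  have lim: "((\<lambda>t. - exp (- \<beta> * t)) \<longlongrightarrow> 0) at_top"
    using assms by real_asymp
  have deriv: "((\<lambda>t. - exp (- \<beta> * t)) has_real_derivative \<beta> * exp (- \<beta> * t)) (at t)" for t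
    by (auto intro!: derivative_eq_intros)
  have "(\<integral>\<^sup>+t. ennreal (\<beta> * exp (- \<beta> * t)) * indicator {0..} t \<partial>lborel) = ennreal (0 - (- exp (- \<beta> * 0)))"
    by (rule nn_integral_FTC_atLeast[OF _ deriv _ lim]) (use assms in auto)
  then have "(\<integral>\<^sup>+t. ennreal (\<beta> * exp (- \<beta> * t)) * indicator {0..} t \<partial>lborel) < \<infinity>"
    by simp
  moreover have "ennreal (\<beta> * exp (- \<beta> * t)) * indicator {0..} t
      = ennreal (indicator {0..} t *\<^sub>R (\<beta> * exp (- \<beta> * t)))" for t
    by (simp split: split_indicator)
  ultimately have "(\<integral>\<^sup>+t. ennreal (indicator {0..} t *\<^sub>R (\<beta> * exp (- \<beta> * t))) \<partial>lborel) < \<infinity>"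
    by simp
  then show int: "set_integrable lborel {0..} (\<lambda>t. \<beta> * exp (- \<beta> * t))"
    unfolding set_integrable_def using assms
    by (intro integrableI_nonneg) auto
  show "(LBINT t:{0..}. \<beta> * exp (- \<beta> * t)) = 1"
    by (subst LBINT_atLeast_FTC[OF deriv _ int lim]) auto
qed

lemma isCont_mat_exp:
  "finite I \<Longrightarrow> x \<in> I \<Longrightarrow> y \<in> I \<Longrightarrow> isCont (\<lambda>t. mat_exp I A t x y) t"
  by (rule DERIV_isCont[OF DERIV_mat_exp_left])

lemma borel_measurable_mat_exp:
  assumes "finite I" "x \<in> I" "y \<in> I"
  shows "(\<lambda>t. mat_exp I A t x y) \<in> borel_measurable borel"
  by (intro borel_measurable_continuous_onI continuous_at_imp_continuous_on ballI
      isCont_mat_exp assms)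

context
  fixes I :: "'a set" and A :: "'a \<Rightarrow> 'a \<Rightarrow> real" and \<beta> :: real
  assumes A: "sub_q_matrix I A" and \<beta>: "0 < \<beta>"
begin

lemma finite_index: "finite I"
  using A by (simp add: sub_q_matrix_def)

lemma mat_exp_bounds:
  assumes "0 \<le> t" "x \<in> I" "y \<in> I"
  shows "0 \<le> mat_exp I A t x y" "mat_exp I A t x y \<le> 1"
proof -
  show *: "0 \<le> mat_exp I A t x y"
    using mat_exp_substochastic[OF A assms(1,2)] assms(3) by blast
  have "mat_exp I A t x y \<le> (\<Sum>y\<in>I. mat_exp I A t x y)"
    using mat_exp_substochastic[OF A assms(1,2)] assms(3) finite_index by (intro member_le_sum) auto
  then show "mat_exp I A t x y \<le> 1"
    using mat_exp_substochastic[OF A assms(1,2)] by linarith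
qed

lemma resolvent_integrable:
  assumes "x \<in> I" "y \<in> I"
  shows "set_integrable lborel {0..} (\<lambda>t. \<beta> * exp (- \<beta> * t) * mat_exp I A t x y)"
proof (rule set_integrable_bound[OF exp_weight_integrable[OF \<beta>]])
  show "set_borel_measurable lborel {0..} (\<lambda>t. \<beta> * exp (- \<beta> * t) * mat_exp I A t x y)"
    unfolding set_borel_measurable_def
    using borel_measurable_mat_exp[OF finite_index assms] by measurable
  show "AE t in lborel. t \<in> {0..} \<longrightarrow>
      norm (\<beta> * exp (- \<beta> * t) * mat_exp I A t x y) \<le> norm (\<beta> * exp (- \<beta> * t))"
    using mat_exp_bounds[OF _ assms] \<beta> by (intro AE_I2) (auto simp: abs_mult mult_le_cancel_left1)
qed

lemma finite_resolvent_nonneg: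
  assumes "x \<in> I" "y \<in> I"
  shows "0 \<le> finite_resolvent I A \<beta> x y"
  unfolding finite_resolvent_def set_lebesgue_integral_def
  using mat_exp_bounds(1)[OF _ assms] \<beta>
  by (intro Bochner_Integration.integral_nonneg) (auto split: split_indicator)

lemma finite_resolvent_row_sum_eq:
  assumes "x \<in> I"
  shows "(\<Sum>y\<in>I. finite_resolvent I A \<beta> x y)
    = (LBINT t:{0..}. \<beta> * exp (- \<beta> * t) * (\<Sum>y\<in>I. mat_exp I A t x y))"
proof -
  have "(LBINT t:{0..}. \<beta> * exp (- \<beta> * t) * (\<Sum>y\<in>I. mat_exp I A t x y))
      = (LBINT t. (\<Sum>y\<in>I. indicator {0..} t *\<^sub>R (\<beta> * exp (- \<beta> * t) * mat_exp I A t x y)))"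
    unfolding set_lebesgue_integral_def by (simp add: sum_distrib_left)
  also have "\<dots> = (\<Sum>y\<in>I. finite_resolvent I A \<beta> x y)"
    unfolding finite_resolvent_def set_lebesgue_integral_def
    using resolvent_integrable[OF assms] by (intro Bochner_Integration.integral_sum) (auto simp: set_integrable_def)
  finally show ?thesis ..
qed

lemma finite_resolvent_row_sum_le:
  assumes "x \<in> I"
  shows "(\<Sum>y\<in>I. finite_resolvent I A \<beta> x y) \<le> 1"
proof -
  have "(\<Sum>y\<in>I. finite_resolvent I A \<beta> x y) \<le> (LBINT t:{0..}. \<beta> * exp (- \<beta> * t))"
    unfolding finite_resolvent_row_sum_eq[OF assms]
  proof (rule set_integral_mono[OF _ exp_weight_integrable[OF \<beta>]])
    have "set_integrable lborel {0..} (\<lambda>t. \<Sum>y\<in>I. \<beta> * exp (- \<beta> * t) * mat_exp I A t x y)"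
      unfolding set_integrable_def scaleR_sum_right
      using resolvent_integrable[OF assms]
      by (intro Bochner_Integration.integrable_sum) (auto simp: set_integrable_def)
    then show "set_integrable lborel {0..} (\<lambda>t. \<beta> * exp (- \<beta> * t) * (\<Sum>y\<in>I. mat_exp I A t x y))"
      by (simp add: sum_distrib_left)
    show "\<beta> * exp (- \<beta> * t) * (\<Sum>y\<in>I. mat_exp I A t x y) \<le> \<beta> * exp (- \<beta> * t)" if "t \<in> {0..}" for t
      using mat_exp_substochastic[OF A _ assms, of t] that \<beta> by (simp add: mult_left_le)
  qed
  then show ?thesis unfolding exp_weight_integral[OF \<beta>] .
qed

lemma resolvent_exp_tendsto_0:
  assumes "x \<in> I" "y \<in> I"
  shows "((\<lambda>t. exp (- \<beta> * t) * mat_exp I A t x y) \<longlongrightarrow> 0) at_top"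
proof (rule tendsto_sandwich[where f = "\<lambda>_. 0" and h = "\<lambda>t. exp (- \<beta> * t)"])
  show "((\<lambda>t. exp (- \<beta> * t)) \<longlongrightarrow> 0) at_top" using \<beta> by real_asymp
  show "\<forall>\<^sub>F t in at_top. 0 \<le> exp (- \<beta> * t) * mat_exp I A t x y"
    using eventually_ge_at_top[of 0] by eventually_elim (simp add: mat_exp_bounds assms)
  show "\<forall>\<^sub>F t in at_top. exp (- \<beta> * t) * mat_exp I A t x y \<le> exp (- \<beta> * t)"
    using eventually_ge_at_top[of 0] by eventually_elim (simp add: mat_exp_bounds assms)
qed simp

text \<open>Integration by parts of a differential equation for one entry of the exponential.  The right-hand
  side is a combination of other entries, which covers both the backward and the forward equation.\<close>

lemma finite_resolvent_by_parts:
  assumes xy: "x \<in> I" "y \<in> I" and rs: "\<And>z. z \<in> I \<Longrightarrow> r z \<in> I \<and> s z \<in> I"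
    and deriv: "\<And>t. ((\<lambda>t. mat_exp I A t x y) has_real_derivative
      (\<Sum>z\<in>I. a z * mat_exp I A t (r z) (s z))) (at t)"
  shows "\<beta> * finite_resolvent I A \<beta> x y
    = \<beta> * (if x = y then 1 else 0) + (\<Sum>z\<in>I. a z * finite_resolvent I A \<beta> (r z) (s z))"
proof -
  let ?w = "\<lambda>t::real. \<beta> * exp (- \<beta> * t)" and ?E = "\<lambda>t. mat_exp I A t x y"
  let ?D = "\<lambda>t. \<Sum>z\<in>I. a z * mat_exp I A t (r z) (s z)"
  let ?f = "\<lambda>t. ?w t * ?D t - \<beta> * (?w t * ?E t)"
  have intz: "integrable lborel (\<lambda>t. a z * (indicator {0..} t *\<^sub>R (?w t * mat_exp I A t (r z) (s z))))"
    if "z \<in> I" for z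
    using resolvent_integrable[of "r z" "s z"] rs[OF that] by (auto simp: set_integrable_def)
  have eq: "indicator {0..} t *\<^sub>R (?w t * ?D t)
      = (\<Sum>z\<in>I. a z * (indicator {0..} t *\<^sub>R (?w t * mat_exp I A t (r z) (s z))))" for t
    by (simp add: sum_distrib_left mult_ac)
  have intD: "set_integrable lborel {0..} (\<lambda>t. ?w t * ?D t)"
    unfolding set_integrable_def eq by (intro Bochner_Integration.integrable_sum intz)
  have D: "(LBINT t:{0..}. ?w t * ?D t) = (\<Sum>z\<in>I. a z * finite_resolvent I A \<beta> (r z) (s z))"
    unfolding finite_resolvent_def set_lebesgue_integral_def eq
    by (subst Bochner_Integration.integral_sum) (use intz in auto)
  have intE: "set_integrable lborel {0..} (\<lambda>t. \<beta> * (?w t * ?E t))"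
    using resolvent_integrable[OF xy] by (intro set_integrable_mult_right) auto
  have "(LBINT t:{0..}. ?f t) = - (\<beta> * (exp (- \<beta> * 0) * ?E 0))"
  proof (rule LBINT_atLeast_FTC)
    show "((\<lambda>t. \<beta> * (exp (- \<beta> * t) * ?E t)) has_real_derivative ?f t) (at t)" for t
      by (auto intro!: derivative_eq_intros deriv simp: algebra_simps)
    show "isCont ?f t" for t
      using rs by (intro continuous_intros isCont_mat_exp finite_index xy) auto
    show "set_integrable lborel {0..} ?f"
      by (rule set_integral_diff(1)[OF intD intE])
    show "((\<lambda>t. \<beta> * (exp (- \<beta> * t) * ?E t)) \<longlongrightarrow> 0) at_top"
      using tendsto_mult_right_zero[OF resolvent_exp_tendsto_0[OF xy]] by simp
  qed
  moreover have "(LBINT t:{0..}. ?f t)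
      = (\<Sum>z\<in>I. a z * finite_resolvent I A \<beta> (r z) (s z)) - \<beta> * finite_resolvent I A \<beta> x y"
    unfolding D[symmetric] unfolding finite_resolvent_def
    by (subst set_integral_diff(2)[OF intD intE]) simp
  ultimately show ?thesis by (simp add: mat_exp_0)
qed

lemma finite_resolvent_backward:
  assumes "x \<in> I" "y \<in> I"
  shows "\<beta> * finite_resolvent I A \<beta> x y
    = \<beta> * (if x = y then 1 else 0) + (\<Sum>z\<in>I. A x z * finite_resolvent I A \<beta> z y)"
  by (rule finite_resolvent_by_parts[OF assms _ DERIV_mat_exp_left[OF finite_index assms]]) (use assms in auto)

lemma finite_resolvent_forward:
  assumes "x \<in> I" "y \<in> I"
  shows "\<beta> * finite_resolvent I A \<beta> x y
    = \<beta> * (if x = y then 1 else 0) + (\<Sum>z\<in>I. finite_resolvent I A \<beta> x z * A z y)"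
  using finite_resolvent_by_parts[OF assms, of "\<lambda>_. x" "\<lambda>z. z" "\<lambda>z. A z y"]
    DERIV_mat_exp_right[OF finite_index assms] assms by (simp add: mult.commute)

text \<open>The resolvent is a nonnegative left inverse of \<open>I - A/\<beta>\<close>, so this matrix is inverse-monotone.\<close>

lemma finite_resolvent_le_supersolution:
  assumes u: "\<And>x. x \<in> I \<Longrightarrow> \<beta> * f x + (\<Sum>z\<in>I. A x z * u z) \<le> \<beta> * u x"
    and w: "w \<in> I"
  shows "(\<Sum>x\<in>I. finite_resolvent I A \<beta> w x * f x) \<le> u w"
proof -
  let ?R = "finite_resolvent I A \<beta>"
  have "\<beta> * (\<Sum>x\<in>I. ?R w x * f x) \<le> (\<Sum>x\<in>I. ?R w x * (\<beta> * u x - (\<Sum>z\<in>I. A x z * u z)))"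
    unfolding sum_distrib_left
  proof (rule sum_mono)
    fix x assume "x \<in> I"
    then show "\<beta> * (?R w x * f x) \<le> ?R w x * (\<beta> * u x - (\<Sum>z\<in>I. A x z * u z))"
      using mult_left_mono[OF _ finite_resolvent_nonneg[OF w, of x], of "\<beta> * f x" "\<beta> * u x - (\<Sum>z\<in>I. A x z * u z)"] u[of x]
      by (simp add: algebra_simps)
  qed
  also have "\<dots> = (\<Sum>x\<in>I. \<beta> * ?R w x * u x) - (\<Sum>x\<in>I. \<Sum>z\<in>I. ?R w x * A x z * u z)"
    by (simp add: sum_subtractf algebra_simps sum_distrib_left)
  also have "(\<Sum>x\<in>I. \<Sum>z\<in>I. ?R w x * A x z * u z) = (\<Sum>z\<in>I. (\<Sum>x\<in>I. ?R w x * A x z) * u z)"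
    unfolding sum_distrib_right by (rule sum.swap)
  also have "(\<Sum>x\<in>I. \<beta> * ?R w x * u x) - \<dots> = (\<Sum>z\<in>I. (if w = z then 1 else 0) * (\<beta> * u z))"
    unfolding sum_subtractf[symmetric]
    by (intro sum.cong refl) (use finite_resolvent_forward[OF w] in \<open>simp add: algebra_simps\<close>)
  also have "\<dots> = \<beta> * u w"
    using w finite_index by (rule sum_delta_mult(1)[rotated])
  finally show ?thesis using \<beta> by simp
qed

text \<open>The same argument on the other side: the resolvent is also a right inverse.\<close>

lemma finite_resolvent_le_superinvariant:
  assumes p: "\<And>y. y \<in> I \<Longrightarrow> \<beta> * f y + (\<Sum>x\<in>I. p x * A x y) \<le> \<beta> * p y"
    and w: "w \<in> I"
  shows "(\<Sum>y\<in>I. f y * finite_resolvent I A \<beta> y w) \<le> p w"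
proof -
  let ?R = "finite_resolvent I A \<beta>"
  have "\<beta> * (\<Sum>y\<in>I. f y * ?R y w) \<le> (\<Sum>y\<in>I. (\<beta> * p y - (\<Sum>x\<in>I. p x * A x y)) * ?R y w)"
    unfolding sum_distrib_left
  proof (rule sum_mono)
    fix y assume "y \<in> I"
    then show "\<beta> * (f y * ?R y w) \<le> (\<beta> * p y - (\<Sum>x\<in>I. p x * A x y)) * ?R y w"
      using mult_right_mono[OF _ finite_resolvent_nonneg[OF _ w, of y], of "\<beta> * f y" "\<beta> * p y - (\<Sum>x\<in>I. p x * A x y)"] p[of y]
      by (simp add: algebra_simps)
  qed
  also have "\<dots> = (\<Sum>y\<in>I. p y * (\<beta> * ?R y w)) - (\<Sum>y\<in>I. \<Sum>x\<in>I. p x * (A x y * ?R y w))"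
    by (simp add: sum_subtractf algebra_simps sum_distrib_left)
  also have "(\<Sum>y\<in>I. \<Sum>x\<in>I. p x * (A x y * ?R y w)) = (\<Sum>x\<in>I. p x * (\<Sum>y\<in>I. A x y * ?R y w))"
    unfolding sum_distrib_left by (rule sum.swap)
  also have "(\<Sum>y\<in>I. p y * (\<beta> * ?R y w)) - \<dots> = (\<Sum>z\<in>I. (\<beta> * p z) * (if z = w then 1 else 0))"
    unfolding sum_subtractf[symmetric]
    by (intro sum.cong refl) (use finite_resolvent_backward[OF _ w] in \<open>simp add: algebra_simps\<close>)
  also have "\<dots> = \<beta> * p w"
    using w finite_index by (rule sum_delta_mult(3)[rotated])
  finally show ?thesis using \<beta> by simp
qed

end

lemma sub_q_matrix_subset:
  assumes "sub_q_matrix J A" "I \<subseteq> J"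
  shows "sub_q_matrix I A"
  unfolding sub_q_matrix_def
proof (intro conjI ballI)
  show I: "finite I" using assms finite_subset by (auto simp: sub_q_matrix_def)
  fix x assume x: "x \<in> I"
  have "(\<Sum>y\<in>I. A x y) \<le> (\<Sum>y\<in>J. A x y)"
  proof (rule sum_mono2)
    fix b assume "b \<in> J - I"
    with x have "b \<noteq> x" "b \<in> J" "x \<in> J" using assms(2) by auto
    then show "0 \<le> A x b" using assms(1) by (auto simp: sub_q_matrix_def)
  qed (use assms in \<open>auto simp: sub_q_matrix_def\<close>)
  then show "(\<Sum>y\<in>I. A x y) \<le> 0"
    using assms x by (force simp: sub_q_matrix_def)
qed (use assms in \<open>auto simp: sub_q_matrix_def\<close>)

text \<open>The larger resolvent, restricted to the smaller index set, is a supersolution there.\<close>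

lemma finite_resolvent_mono:
  assumes A: "sub_q_matrix J A" and IJ: "I \<subseteq> J" and \<beta>: "0 < \<beta>" and xy: "x \<in> I" "y \<in> I"
  shows "finite_resolvent I A \<beta> x y \<le> finite_resolvent J A \<beta> x y"
proof -
  note A' = sub_q_matrix_subset[OF A IJ]
  have fin: "finite I" "finite J" using A A' by (auto simp: sub_q_matrix_def)
  have "(\<Sum>w\<in>I. finite_resolvent I A \<beta> x w * (if y = w then 1 else 0)) \<le> finite_resolvent J A \<beta> x y"
  proof (rule finite_resolvent_le_supersolution[OF A' \<beta> _ xy(1)])
    fix w assume w: "w \<in> I"
    have "(\<Sum>z\<in>I. A w z * finite_resolvent J A \<beta> z y) \<le> (\<Sum>z\<in>J. A w z * finite_resolvent J A \<beta> z y)"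
    proof (rule sum_mono2[OF fin(2) IJ])
      fix z assume z: "z \<in> J - I"
      then have "0 \<le> A w z" using A w IJ by (auto simp: sub_q_matrix_def)
      then show "0 \<le> A w z * finite_resolvent J A \<beta> z y"
        using finite_resolvent_nonneg[OF A \<beta>] z xy IJ by auto
    qed
    then show "\<beta> * (if y = w then 1 else 0) + (\<Sum>z\<in>I. A w z * finite_resolvent J A \<beta> z y)
        \<le> \<beta> * finite_resolvent J A \<beta> w y"
      using finite_resolvent_backward[OF A \<beta>, of w y] w xy IJ by (auto simp: subset_iff)
  qed
  then show ?thesis using sum_delta_mult(4)[OF fin(1) xy(2)] by simp
qed

text \<open>Dominated convergence, the weight being the exponential density.\<close>

lemma finite_resolvent_row_sum_tendsto_1:
  assumes A: "\<And>N. sub_q_matrix (F N) A" and x: "\<forall>\<^sub>F N in sequentially. x \<in> F N" and \<beta>: "0 < \<beta>"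
    and lim: "\<And>t. 0 \<le> t \<Longrightarrow> (\<lambda>N. \<Sum>y\<in>F N. mat_exp (F N) A t x y) \<longlonglongrightarrow> 1"
  shows "(\<lambda>N. \<Sum>y\<in>F N. finite_resolvent (F N) A \<beta> x y) \<longlonglongrightarrow> 1"
proof -
  obtain N0 where N0: "\<And>N. N \<ge> N0 \<Longrightarrow> x \<in> F N"
    using x by (auto simp: eventually_sequentially)
  let ?w = "\<lambda>t::real. \<beta> * exp (- \<beta> * t)"
  let ?s = "\<lambda>N t. indicator {0..} t *\<^sub>R (?w t * (\<Sum>y\<in>F (N + N0). mat_exp (F (N + N0)) A t x y))"
  have "(\<lambda>N. LINT t|lborel. ?s N t) \<longlonglongrightarrow> (LINT t|lborel. indicator {0..} t *\<^sub>R ?w t)"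
  proof (rule integral_dominated_convergence[where w = "\<lambda>t. indicator {0..} t *\<^sub>R ?w t"])
    show int: "integrable lborel (\<lambda>t. indicator {0..} t *\<^sub>R ?w t)"
      using exp_weight_integrable[OF \<beta>] by (simp add: set_integrable_def)
    then show "(\<lambda>t. indicator {0..} t *\<^sub>R ?w t) \<in> borel_measurable lborel" by auto
    show "?s N \<in> borel_measurable lborel" for N
    proof -
      have [measurable]: "(\<lambda>t. mat_exp (F (N + N0)) A t x y) \<in> borel_measurable borel"
        if "y \<in> F (N + N0)" for y
        using A[of "N + N0"] N0[of "N + N0"] that
        by (intro borel_measurable_mat_exp) (auto simp: sub_q_matrix_def)
      show ?thesis by measurable
    qed
    show "AE t in lborel. (\<lambda>N. ?s N t) \<longlonglongrightarrow> indicator {0..} t *\<^sub>R ?w t"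
    proof (rule AE_I2)
      fix t :: real
      show "(\<lambda>N. ?s N t) \<longlonglongrightarrow> indicator {0..} t *\<^sub>R ?w t"
      proof (cases "0 \<le> t")
        case True
        from LIMSEQ_ignore_initial_segment[OF lim[OF this], of N0]
        have "(\<lambda>N. ?s N t) \<longlonglongrightarrow> indicator {0..} t *\<^sub>R (?w t * 1)"
          by (intro tendsto_intros)
        then show ?thesis by simp
      qed simp
    qed
    show "AE t in lborel. norm (?s N t) \<le> indicator {0..} t *\<^sub>R ?w t" for N
    proof (rule AE_I2)
      fix t :: real
      show "norm (?s N t) \<le> indicator {0..} t *\<^sub>R ?w t"
      proof (cases "0 \<le> t")
        case True
        let ?r = "\<Sum>y\<in>F (N + N0). mat_exp (F (N + N0)) A t x y"
        have "0 \<le> ?r" "?r \<le> 1"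
          using mat_exp_substochastic[OF A True N0[of "N + N0"]] by (auto intro: sum_nonneg)
        then show ?thesis using True \<beta> by (simp add: abs_mult mult_left_le)
      qed simp
    qed
  qed
  moreover have "(LINT t|lborel. ?s N t) = (\<Sum>y\<in>F (N + N0). finite_resolvent (F (N + N0)) A \<beta> x y)" for N
    using finite_resolvent_row_sum_eq[OF A \<beta> N0[of "N + N0"]] by (simp add: set_lebesgue_integral_def)
  moreover have "(LINT t|lborel. indicator {0..} t *\<^sub>R ?w t) = 1"
    using exp_weight_integral[OF \<beta>] unfolding set_lebesgue_integral_def .
  ultimately have "(\<lambda>N. \<Sum>y\<in>F (N + N0). finite_resolvent (F (N + N0)) A \<beta> x y) \<longlonglongrightarrow> 1"
    by (simp only:)
  then show ?thesis by (rule LIMSEQ_offset)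
qed

section \<open>Minimality of the transition function of a regular jump process\<close>

text \<open>A point with its right neighbourhood takes one value; the left neighbourhood contains no jump if it is
  short, and a locally constant function on an interval is constant.  Compactness does the rest.\<close>

lemma regular_jump_path_finite_range:
  fixes p :: "real \<Rightarrow> 'a"
  assumes p: "regular_jump_path p"
  shows "finite (p ` {0..t})"
proof -
  have "\<exists>e>0. finite (p ` ({s - e<..<s + e} \<inter> {0..}))" if s: "0 \<le> s" for s
  proof -
    obtain e1 where e1: "e1 > 0" "\<And>u. u \<in> {s..<s + e1} \<Longrightarrow> p u = p s"
      using p s unfolding regular_jump_path_def by blast
    have "finite (jump_times p \<inter> {..s})"
      using p s unfolding regular_jump_path_def by blast
    from finite_set_avoid[OF this, of s]
    obtain e2 where e2: "e2 > 0" "\<And>u. u \<in> jump_times p \<inter> {..s} \<Longrightarrow> u \<noteq> s \<Longrightarrow> e2 \<le> dist s u"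
      by blast
    let ?C = "{max 0 (s - e2)<..<s}"
    have const: "p u = p u'" if "u \<in> ?C" "u' \<in> ?C" for u u'
    proof (rule connected_local_const[OF _ that])
      show "connected ?C" by simp
      show "\<forall>a\<in>?C. \<forall>\<^sub>F b in at a within ?C. p a = p b"
      proof
        fix a assume a: "a \<in> ?C"
        then have "a \<notin> jump_times p" using e2(2)[of a] by (auto simp: dist_real_def)
        then obtain e where "e > 0" "\<And>u. u \<ge> 0 \<Longrightarrow> \<bar>u - a\<bar> < e \<Longrightarrow> p u = p a"
          using a by (auto simp: jump_times_def)
        then show "\<forall>\<^sub>F b in at a within ?C. p a = p b"
          unfolding eventually_at by (intro exI[of _ e]) (auto simp: dist_real_def)
      qed
    qed
    have fin: "finite (p ` ?C)"
    proof (cases "?C = {}")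
      case False
      then obtain c where "c \<in> ?C" by blast
      then have "p ` ?C \<subseteq> {p c}" using const by blast
      then show ?thesis by (rule finite_subset) simp
    qed simp
    have "p ` ({s - min e1 e2<..<s + min e1 e2} \<inter> {0..}) \<subseteq> insert (p 0) (insert (p s) (p ` ?C))"
    proof (intro image_subsetI)
      fix u assume u: "u \<in> {s - min e1 e2<..<s + min e1 e2} \<inter> {0..}"
      consider "s \<le> u" | "u = 0" | "u \<in> ?C" using u by force
      then show "p u \<in> insert (p 0) (insert (p s) (p ` ?C))"
        using e1(2)[of u] u by cases auto
    qed
    then have "finite (p ` ({s - min e1 e2<..<s + min e1 e2} \<inter> {0..}))"
      by (rule finite_subset) (simp add: fin)
    then show ?thesis using e1(1) e2(1) by (intro exI[of _ "min e1 e2"]) auto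
  qed
  then obtain e where e: "\<And>s. 0 \<le> s \<Longrightarrow> e s > 0"
    "\<And>s. 0 \<le> s \<Longrightarrow> finite (p ` ({s - e s<..<s + e s} \<inter> {0..}))"
    by metis
  obtain D where D: "D \<subseteq> {0..t}" "finite D" "{0..t} \<subseteq> (\<Union>s\<in>D. {s - e s<..<s + e s})"
  proof (rule compactE_image[of "{0..t}" "{0..t}" "\<lambda>s. {s - e s<..<s + e s}"])
    show "{0..t} \<subseteq> (\<Union>s\<in>{0..t}. {s - e s<..<s + e s})" using e(1) by force
  qed auto
  have "p ` {0..t} \<subseteq> (\<Union>s\<in>D. p ` ({s - e s<..<s + e s} \<inter> {0..}))"
    using D(3) by force
  then show ?thesis
    by (rule finite_subset) (use D e(2) in auto)
qed

lemma conservative_imp_sub_q_matrix: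
  assumes q: "conservative_q_matrix A q" and F: "finite F" "F \<subseteq> A"
  shows "sub_q_matrix F q"
  unfolding sub_q_matrix_def
proof (intro conjI ballI F(1))
  fix x assume x: "x \<in> F"
  then have off: "\<And>y. y \<in> A \<Longrightarrow> y \<noteq> x \<Longrightarrow> 0 \<le> q x y" and sum: "(q x has_sum 0) A"
    using q F by (auto simp: conservative_q_matrix_def)
  have "(q x has_sum (\<Sum>y\<in>F. q x y)) F" using F(1) by simp
  then show "(\<Sum>y\<in>F. q x y) \<le> 0"
    by (rule has_sum_mono2[OF _ sum F(2)]) (use off x in auto)
  show "y \<noteq> x \<longrightarrow> 0 \<le> q x y" if "y \<in> F" for y using off that F by auto
qed

lemma q_off_diagonal:
  "conservative_q_matrix A q \<Longrightarrow> x \<in> A \<Longrightarrow> y \<in> A \<Longrightarrow> y \<noteq> x \<Longrightarrow> 0 \<le> q x y"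
  unfolding conservative_q_matrix_def by blast

lemma q_diagonal: "conservative_q_matrix A q \<Longrightarrow> x \<in> A \<Longrightarrow> q x x \<le> 0"
  using conservative_imp_sub_q_matrix[of A q "{x}"] by (auto simp: sub_q_matrix_def)

context
  fixes F :: "nat \<Rightarrow> 'a set" and A :: "'a set"
  assumes F: "incseq F" "\<And>N. finite (F N)" "(\<Union>N. F N) = A"
begin

lemma exhaustion_subset: "F N \<subseteq> A"
  using F(3) by auto

lemma exhaustion_eventually: "x \<in> A \<Longrightarrow> \<forall>\<^sub>F N in sequentially. x \<in> F N"
  using F(1,3) by (auto simp: eventually_sequentially incseq_def)

lemma exhaustion_finite_subset:
  assumes "finite B" "B \<subseteq> A"
  shows "\<exists>N. B \<subseteq> F N"
proof -
  have "\<forall>\<^sub>F N in sequentially. \<forall>x\<in>B. x \<in> F N"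
    using assms exhaustion_eventually by (intro eventually_ball_finite) auto
  then show ?thesis by (auto simp: eventually_sequentially)
qed

end

context
  fixes A :: "'a set" and M :: "'a \<Rightarrow> 'w measure" and X :: "real \<Rightarrow> 'w \<Rightarrow> 'a"
  assumes chain: "regular_jump_markov_chain A M X"
begin

lemma chain_prob_space: "x \<in> A \<Longrightarrow> prob_space (M x)"
  using chain by (auto simp: regular_jump_markov_chain_def)

lemma chain_measurable: "x \<in> A \<Longrightarrow> 0 \<le> t \<Longrightarrow> X t \<in> measurable (M x) (count_space A)"
  using chain by (auto simp: regular_jump_markov_chain_def)

lemma chain_in: "x \<in> A \<Longrightarrow> 0 \<le> t \<Longrightarrow> w \<in> space (M x) \<Longrightarrow> X t w \<in> A"
  using measurable_space[OF chain_measurable] by fastforce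

lemma chain_pred_in:
  assumes "x \<in> A" "0 \<le> t"
  shows "Measurable.pred (M x) (\<lambda>w. X t w \<in> B)"
proof -
  have "{w \<in> space (M x). X t w \<in> B} = X t -` (B \<inter> A) \<inter> space (M x)"
    using chain_in[OF assms] by auto
  also have "\<dots> \<in> sets (M x)"
    by (rule measurable_sets[OF chain_measurable[OF assms]]) simp
  finally show ?thesis by (simp add: pred_def)
qed

lemma chain_pred_eq:
  assumes "x \<in> A" "0 \<le> t"
  shows "Measurable.pred (M x) (\<lambda>w. X t w = z)"
  using chain_pred_in[OF assms, of "{z}"] by simp

text \<open>The Markov property conditions on an exact history; finitely many of these make up the event of
  having been in \<open>F\<close> at the past times.\<close>

lemma markov_property_histories:
  assumes x: "x \<in> A" and zy: "z \<in> A" "y \<in> A" and st: "0 \<le> s" "0 \<le> t"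
    and U: "finite U" "U \<subseteq> {0..<s}" and F: "finite F"
  shows "\<P>(w in M x. X (s + t) w = y \<and> X s w = z \<and> (\<forall>u\<in>U. X u w \<in> F))
    = \<P>(w in M x. X s w = z \<and> (\<forall>u\<in>U. X u w \<in> F)) * transition M X t z y"
proof -
  interpret prob_space "M x" by (rule chain_prob_space[OF x])
  have Upos: "0 \<le> u" if "u \<in> U" for u using that U by auto
  let ?H = "U \<rightarrow>\<^sub>E F"
  let ?E = "\<lambda>h. {w \<in> space (M x). X s w = z \<and> (\<forall>u\<in>U. X u w = h u)}"
  let ?E' = "\<lambda>h. {w \<in> space (M x). X (s + t) w = y \<and> X s w = z \<and> (\<forall>u\<in>U. X u w = h u)}"
  have H: "finite ?H" using U F by (intro finite_PiE) auto
  have past: "Measurable.pred (M x) (\<lambda>w. \<forall>u\<in>U. X u w = h u)" for h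
    using U(1) Upos by (intro pred_intros_finite chain_pred_eq[OF x])
  note [measurable] = chain_pred_eq[OF x st(1)] chain_pred_eq[OF x add_nonneg_nonneg[OF st]] past
  have E: "?E h \<in> events" "?E' h \<in> events" for h
    by measurable
  have hist: "(\<forall>u\<in>U. X u w \<in> F) \<longleftrightarrow> (\<exists>h\<in>?H. \<forall>u\<in>U. X u w = h u)" for w
  proof
    assume "\<forall>u\<in>U. X u w \<in> F"
    then have "restrict (\<lambda>u. X u w) U \<in> ?H" by auto
    then show "\<exists>h\<in>?H. \<forall>u\<in>U. X u w = h u" by (rule bexI[rotated]) simp
  next
    assume "\<exists>h\<in>?H. \<forall>u\<in>U. X u w = h u"
    then show "\<forall>u\<in>U. X u w \<in> F" by (metis PiE_mem)
  qed
  have disj: "disjoint_family_on ?E ?H"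
    unfolding disjoint_family_on_def
  proof (intro ballI impI)
    fix g h assume gh: "g \<in> ?H" "h \<in> ?H" "g \<noteq> h"
    then obtain u where "u \<in> U" "g u \<noteq> h u" by (metis PiE_ext)
    then show "?E g \<inter> ?E h = {}" by auto
  qed
  then have disj': "disjoint_family_on ?E' ?H"
    unfolding disjoint_family_on_def by blast
  have *: "prob (?E' h) = prob (?E h) * transition M X t z y" for h
  proof (cases "prob (?E h) > 0")
    case True
    then have "\<P>(w in M x. X (s + t) w = y \<bar> X s w = z \<and> (\<forall>u\<in>U. X u w = h u)) = transition M X t z y"
      using chain x zy st U unfolding regular_jump_markov_chain_def by blast
    then show ?thesis using True by (simp add: cond_prob_def field_simps)
  next
    case False
    then have "prob (?E h) = 0" using measure_nonneg[of "M x" "?E h"] by linarith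
    moreover have "prob (?E' h) \<le> prob (?E h)"
      using E(1)[of h] by (intro finite_measure_mono) auto
    ultimately show ?thesis using measure_nonneg[of "M x" "?E' h"] by auto
  qed
  have "{w \<in> space (M x). X (s + t) w = y \<and> X s w = z \<and> (\<forall>u\<in>U. X u w \<in> F)} = (\<Union>h\<in>?H. ?E' h)"
    unfolding hist by auto
  then have "\<P>(w in M x. X (s + t) w = y \<and> X s w = z \<and> (\<forall>u\<in>U. X u w \<in> F)) = (\<Sum>h\<in>?H. prob (?E' h))"
    using finite_measure_finite_Union[OF H _ disj'] E by (simp add: image_subset_iff)
  also have "\<dots> = (\<Sum>h\<in>?H. prob (?E h)) * transition M X t z y"
    by (simp add: * sum_distrib_right)
  also have "(\<Sum>h\<in>?H. prob (?E h)) = prob (\<Union>h\<in>?H. ?E h)"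
    using finite_measure_finite_Union[OF H _ disj] E by (simp add: image_subset_iff)
  also have "(\<Union>h\<in>?H. ?E h) = {w \<in> space (M x). X s w = z \<and> (\<forall>u\<in>U. X u w \<in> F)}"
    unfolding hist by auto
  finally show ?thesis .
qed

lemma transition_sum_le_1:
  assumes "x \<in> A" "0 \<le> t" "finite F"
  shows "(\<Sum>y\<in>F. transition M X t x y) \<le> 1"
proof -
  interpret prob_space "M x" by (rule chain_prob_space[OF assms(1)])
  note [measurable] = chain_pred_eq[OF assms(1,2)]
  have "(\<Sum>y\<in>F. transition M X t x y) = prob (\<Union>y\<in>F. {w \<in> space (M x). X t w = y})"
    unfolding transition_def
    by (rule finite_measure_finite_Union[symmetric]) (use assms in \<open>auto simp: disjoint_family_on_def\<close>)
  then show ?thesis by simp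
qed

text \<open>Chapman-Kolmogorov for the skeleton of step \<open>h\<close>, killed on leaving \<open>F\<close>.\<close>

lemma grid_probability:
  assumes F: "finite F" "F \<subseteq> A" and x: "x \<in> F" and y: "y \<in> F" and h: "0 < h"
  shows "\<P>(w in M x. X (real m * h) w = y \<and> (\<forall>u\<in>(\<lambda>k. real k * h) ` {..<m}. X u w \<in> F))
    = mat_power F (transition M X h) m x y"
  using y
proof (induction m arbitrary: y)
  case 0
  have xA: "x \<in> A" using F x by auto
  interpret prob_space "M x" by (rule chain_prob_space[OF xA])
  have [measurable]: "Measurable.pred (M x) (\<lambda>w. X 0 w = y)" by (rule chain_pred_eq[OF xA]) simp
  have ae: "AE w in M x. X 0 w = x"
    using chain xA by (auto simp: regular_jump_markov_chain_def)
  have "prob {w \<in> space (M x). X 0 w = y} = (if x = y then 1 else 0)"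
  proof (cases "x = y")
    case True
    then have "AE w in M x. X 0 w = y" using ae by simp
    then have "prob {w \<in> space (M x). X 0 w = y} = 1" by (subst prob_Collect_eq_1) measurable
    then show ?thesis using True by simp
  next
    case False
    then have "AE w in M x. \<not> X 0 w = y" using ae by auto
    then have "prob {w \<in> space (M x). X 0 w = y} = 0" by (subst prob_Collect_eq_0) measurable
    then show ?thesis using False by simp
  qed
  then show ?case by simp
next
  case (Suc m)
  have xA: "x \<in> A" using F x by auto
  interpret prob_space "M x" by (rule chain_prob_space[OF xA])
  let ?U = "(\<lambda>k. real k * h) ` {..<m}"
  let ?s = "real m * h"
  have "Measurable.pred (M x) (\<lambda>w. \<forall>u\<in>?U. X u w \<in> F)"
    using h by (intro pred_intros_finite chain_pred_in[OF xA]) auto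
  moreover have "0 \<le> ?s" "0 \<le> ?s + h" using h by auto
  moreover note chain_pred_eq[OF xA]
  ultimately have [measurable]: "Measurable.pred (M x) (\<lambda>w. \<forall>u\<in>?U. X u w \<in> F)"
    "Measurable.pred (M x) (\<lambda>w. X ?s w = z)" "Measurable.pred (M x) (\<lambda>w. X (?s + h) w = z)" for z
    by blast+
  let ?G = "\<lambda>z. {w \<in> space (M x). X (?s + h) w = y \<and> X ?s w = z \<and> (\<forall>u\<in>?U. X u w \<in> F)}"
  have G: "?G z \<in> events" for z by measurable
  have "{w \<in> space (M x). X (real (Suc m) * h) w = y \<and> (\<forall>u\<in>(\<lambda>k. real k * h) ` {..<Suc m}. X u w \<in> F)}
      = (\<Union>z\<in>F. ?G z)"
    by (auto simp: lessThan_Suc algebra_simps)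
  then have "\<P>(w in M x. X (real (Suc m) * h) w = y \<and> (\<forall>u\<in>(\<lambda>k. real k * h) ` {..<Suc m}. X u w \<in> F))
      = (\<Sum>z\<in>F. prob (?G z))"
    using finite_measure_finite_Union[OF F(1), of ?G] G by (auto simp: disjoint_family_on_def)
  also have "\<dots> = (\<Sum>z\<in>F. mat_power F (transition M X h) m x z * transition M X h z y)"
  proof (intro sum.cong refl)
    fix z assume z: "z \<in> F"
    show "prob (?G z) = mat_power F (transition M X h) m x z * transition M X h z y"
      unfolding Suc.IH[OF z, symmetric]
      by (rule markov_property_histories[OF xA]) (use F z Suc.prems h in auto)
  qed
  also have "\<dots> = mat_power F (transition M X h) (Suc m) x y"
    by (rule mat_power_Suc_right[symmetric]) (use F x Suc.prems in auto)
  finally show ?case .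
qed

text \<open>The path does not leave \<open>F\<close> up to time \<open>t\<close>, as far as the dyadic points of the interval show.\<close>

definition stays_in :: "'a set \<Rightarrow> real \<Rightarrow> 'w \<Rightarrow> bool" where
  "stays_in F t w \<longleftrightarrow> (\<forall>n. \<forall>k\<le>2 ^ n. X (real k * (t / 2 ^ n)) w \<in> F)"

lemma stays_in_end: "stays_in F t w \<Longrightarrow> X t w \<in> F"
  unfolding stays_in_def by (drule spec[of _ 0], drule spec[of _ 1]) simp

lemma pred_stays_in: "x \<in> A \<Longrightarrow> 0 \<le> t \<Longrightarrow> Measurable.pred (M x) (stays_in F t)"
  unfolding stays_in_def
  by (intro pred_intros_countable pred_intros_imp' chain_pred_in) auto

context
  fixes q :: "'a \<Rightarrow> 'a \<Rightarrow> real"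
  assumes gen: "is_generator A M X q"
begin

text \<open>The probability of being in \<open>F\<close> at all points of the grid with \<open>2 ^ n\<close> steps is an entry of a power of the
  killed skeleton.  These powers converge to the exponential, and being in \<open>F\<close> at all
  dyadic points is a smaller event.\<close>

lemma stays_in_prob_le_mat_exp:
  assumes F: "finite F" "F \<subseteq> A" and xy: "x \<in> F" "y \<in> F" and t: "0 < t"
  shows "\<P>(w in M x. X t w = y \<and> stays_in F t w) \<le> mat_exp F q t x y"
proof -
  have xA: "x \<in> A" using F xy by auto
  interpret prob_space "M x" by (rule chain_prob_space[OF xA])
  have "(\<lambda>m. mat_power F (transition M X (t / real m)) m x y) \<longlonglongrightarrow> mat_exp F q t x y"
  proof (rule mat_power_tendsto_mat_exp[OF F(1) _ _ t xy])
    show "((\<lambda>h. (transition M X h u v - (if u = v then 1 else 0)) / h) \<longlongrightarrow> q u v) (at_right 0)"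
      if "u \<in> F" "v \<in> F" for u v
      using gen F(2) that unfolding is_generator_def by blast
    show "\<forall>\<^sub>F h in at_right 0. \<forall>u\<in>F. (\<forall>v\<in>F. 0 \<le> transition M X h u v) \<and> (\<Sum>v\<in>F. transition M X h u v) \<le> 1"
      using eventually_at_right_less[of "0::real"]
    proof eventually_elim
      case (elim h)
      then show ?case using transition_sum_le_1[of _ h F] F by (auto simp: transition_def)
    qed
  qed
  moreover have "strict_mono (\<lambda>n. 2 ^ n :: nat)" by (rule strict_monoI) simp
  ultimately have lim: "(\<lambda>n. mat_power F (transition M X (t / 2 ^ n)) (2 ^ n) x y) \<longlonglongrightarrow> mat_exp F q t x y"
    using LIMSEQ_subseq_LIMSEQ[of "\<lambda>m. mat_power F (transition M X (t / real m)) m x y" _ "\<lambda>n. 2 ^ n"]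
    by (simp add: o_def)
  show ?thesis
  proof (rule tendsto_lowerbound[OF lim])
    show "\<forall>\<^sub>F n in sequentially. \<P>(w in M x. X t w = y \<and> stays_in F t w)
        \<le> mat_power F (transition M X (t / 2 ^ n)) (2 ^ n) x y"
    proof (intro always_eventually allI)
      fix n
      let ?h = "t / 2 ^ n"
      have "Measurable.pred (M x) (\<lambda>w. X (real (2 ^ n) * ?h) w = y)"
        by (rule chain_pred_eq[OF xA]) (use t in simp)
      moreover have "Measurable.pred (M x) (\<lambda>w. \<forall>u\<in>(\<lambda>k. real k * ?h) ` {..<2 ^ n}. X u w \<in> F)"
        using t by (intro pred_intros_finite chain_pred_in[OF xA]) auto
      ultimately have grid: "{w \<in> space (M x). X (real (2 ^ n) * ?h) w = y
          \<and> (\<forall>u\<in>(\<lambda>k. real k * ?h) ` {..<2 ^ n}. X u w \<in> F)} \<in> events"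
        by measurable
      have "\<P>(w in M x. X t w = y \<and> stays_in F t w)
        \<le> \<P>(w in M x. X (real (2 ^ n) * ?h) w = y \<and> (\<forall>u\<in>(\<lambda>k. real k * ?h) ` {..<2 ^ n}. X u w \<in> F))"
        by (rule finite_measure_mono[OF _ grid]) (auto simp: stays_in_def)
      also have "\<dots> = mat_power F (transition M X ?h) (2 ^ n) x y"
        by (rule grid_probability[OF F xy]) (use t in simp)
      finally show "\<P>(w in M x. X t w = y \<and> stays_in F t w)
        \<le> mat_power F (transition M X (t / 2 ^ n)) (2 ^ n) x y" .
    qed
  qed simp
qed

context
  fixes F :: "nat \<Rightarrow> 'a set"
  assumes F: "incseq F" "\<And>N. finite (F N)" "(\<Union>N. F N) = A"
begin

lemmas exh_subset = exhaustion_subset[OF F]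
lemmas exh_eventually = exhaustion_eventually[OF F]

text \<open>Since almost every path takes only finitely many values up to time \<open>t\<close>, nothing is lost by
  forbidding it to leave a large finite set.\<close>

lemma stays_in_exhaustion_tendsto:
  assumes x: "x \<in> A" and t: "0 \<le> t" and P: "Measurable.pred (M x) P"
  shows "(\<lambda>N. \<P>(w in M x. P w \<and> stays_in (F N) t w)) \<longlonglongrightarrow> \<P>(w in M x. P w)"
proof -
  interpret prob_space "M x" by (rule chain_prob_space[OF x])
  note [measurable] = P pred_stays_in[OF x t]
  let ?E = "\<lambda>N. {w \<in> space (M x). P w \<and> stays_in (F N) t w}"
  have "incseq ?E"
    using F(1) by (fastforce simp: incseq_def stays_in_def)
  then have "(\<lambda>N. prob (?E N)) \<longlonglongrightarrow> prob (\<Union>N. ?E N)"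
    by (intro finite_Lim_measure_incseq) auto
  moreover have "prob (\<Union>N. ?E N) = \<P>(w in M x. P w)"
  proof (rule finite_measure_eq_AE)
    have "AE w in M x. regular_jump_path (\<lambda>t. X t w)"
      using chain x by (auto simp: regular_jump_markov_chain_def)
    then show "AE w in M x. w \<in> (\<Union>N. ?E N) \<longleftrightarrow> w \<in> {w \<in> space (M x). P w}"
      using AE_space
    proof eventually_elim
      case (elim w)
      have "finite ((\<lambda>s. X s w) ` {0..t})"
        by (rule regular_jump_path_finite_range[OF elim(1)])
      moreover have "(\<lambda>s. X s w) ` {0..t} \<subseteq> A" using chain_in[OF x _ elim(2)] by auto
      ultimately obtain N where N: "(\<lambda>s. X s w) ` {0..t} \<subseteq> F N"
        using exhaustion_finite_subset[OF F] by blast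
      have "stays_in (F N) t w"
        unfolding stays_in_def
      proof (intro allI impI)
        fix n k :: nat assume "k \<le> 2 ^ n"
        then have "real k \<le> 2 ^ n" by (metis of_nat_le_iff of_nat_numeral of_nat_power)
        then have "real k * (t / 2 ^ n) \<in> {0..t}"
          using t mult_right_mono[of "real k" "2 ^ n" "t / 2 ^ n"] by auto
        then show "X (real k * (t / 2 ^ n)) w \<in> F N" using N by blast
      qed
      then show ?case using elim by auto
    qed
  qed auto
  ultimately show ?thesis by simp
qed

text \<open>Non-explosion in analytic form: the minimal semigroup built from the finite corners loses no mass.\<close>

lemma mat_exp_row_sum_tendsto_1:
  assumes q: "conservative_q_matrix A q" and x: "x \<in> A" and t: "0 \<le> t"
  shows "(\<lambda>N. \<Sum>y\<in>F N. mat_exp (F N) q t x y) \<longlonglongrightarrow> 1"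
proof (cases "t = 0")
  case True
  have "\<forall>\<^sub>F N in sequentially. (\<Sum>y\<in>F N. mat_exp (F N) q t x y) = 1"
    using exh_eventually[OF x] by eventually_elim (simp add: True mat_exp_0 F(2))
  then show ?thesis by (rule tendsto_eventually)
next
  case False
  note t0 = t
  with False have t: "0 < t" by simp
  interpret prob_space "M x" by (rule chain_prob_space[OF x])
  note [measurable] = chain_pred_eq[OF x t0] pred_stays_in[OF x t0]
  have "(\<lambda>N. \<P>(w in M x. True \<and> stays_in (F N) t w)) \<longlonglongrightarrow> \<P>(w in M x. True)"
    by (rule stays_in_exhaustion_tendsto) (use x t in auto)
  then have lim: "(\<lambda>N. \<P>(w in M x. stays_in (F N) t w)) \<longlonglongrightarrow> 1"
    by (simp add: prob_space)
  show ?thesis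
  proof (rule tendsto_sandwich[OF _ _ lim tendsto_const])
    show "\<forall>\<^sub>F N in sequentially. \<P>(w in M x. stays_in (F N) t w) \<le> (\<Sum>y\<in>F N. mat_exp (F N) q t x y)"
      using exh_eventually[OF x]
    proof eventually_elim
      case (elim N)
      have "{w \<in> space (M x). stays_in (F N) t w}
          = (\<Union>y\<in>F N. {w \<in> space (M x). X t w = y \<and> stays_in (F N) t w})"
        using stays_in_end by auto
      then have "\<P>(w in M x. stays_in (F N) t w) = (\<Sum>y\<in>F N. \<P>(w in M x. X t w = y \<and> stays_in (F N) t w))"
      proof (simp only:, intro finite_measure_finite_Union F(2) image_subsetI)
        show "{w \<in> space (M x). X t w = y \<and> stays_in (F N) t w} \<in> events" for y
          by measurable
      qed (auto simp: disjoint_family_on_def)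
      also have "\<dots> \<le> (\<Sum>y\<in>F N. mat_exp (F N) q t x y)"
        using elim t F(2) exh_subset by (intro sum_mono stays_in_prob_le_mat_exp) auto
      finally show ?case .
    qed
    show "\<forall>\<^sub>F N in sequentially. (\<Sum>y\<in>F N. mat_exp (F N) q t x y) \<le> 1"
      using exh_eventually[OF x]
    proof eventually_elim
      case (elim N)
      then show ?case
        using mat_exp_substochastic[OF conservative_imp_sub_q_matrix[OF q F(2) exh_subset], of t x N] t
        by simp
    qed
  qed
qed

text \<open>By minimality, irreducibility of the transition function is inherited by the generator: the
  exponentials of all corners vanish from a closed class to its complement.\<close>

lemma transition_eq_0_of_closed:
  assumes C: "\<And>x y. x \<in> C \<Longrightarrow> y \<in> A - C \<Longrightarrow> q x y = 0"
    and x: "x \<in> C" "x \<in> A" and y: "y \<in> A - C" and t: "0 < t"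
  shows "transition M X t x y = 0"
proof -
  interpret prob_space "M x" by (rule chain_prob_space[OF x(2)])
  have yA: "y \<in> A" using y by simp
  have power: "mat_power (F N) q n z y = 0" if "z \<in> C" for N n z
    using that
  proof (induction n arbitrary: z)
    case 0
    then show ?case using y by auto
  next
    case (Suc n)
    have "\<forall>u\<in>F N. q z u * mat_power (F N) q n u y = 0"
      using Suc C[of z] exh_subset by auto
    then show ?case by (simp add: sum.neutral)
  qed
  then have exp: "mat_exp (F N) q t x y = 0" for N
    using x(1) by (simp add: mat_exp_def)
  have lim: "(\<lambda>N. \<P>(w in M x. X t w = y \<and> stays_in (F N) t w)) \<longlonglongrightarrow> \<P>(w in M x. X t w = y)"
    by (rule stays_in_exhaustion_tendsto) (use x t chain_pred_eq[OF x(2)] in auto)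
  have "\<forall>\<^sub>F N in sequentially. \<P>(w in M x. X t w = y \<and> stays_in (F N) t w) \<le> 0"
    using exh_eventually[OF x(2)] exh_eventually[OF yA]
  proof eventually_elim
    case (elim N)
    then show ?case
      using stays_in_prob_le_mat_exp[OF F(2) exh_subset, of x N y t] exp t by simp
  qed
  with lim have "\<P>(w in M x. X t w = y) \<le> 0"
    by (rule tendsto_upperbound) simp
  then show ?thesis unfolding transition_def by (simp add: measure_le_0_iff)
qed

end
end
end

section \<open>Sums over countable sets\<close>

abbreviation nsum :: "'a set \<Rightarrow> ('a \<Rightarrow> ennreal) \<Rightarrow> ennreal" where
  "nsum A f \<equiv> (\<integral>\<^sup>+x. f x \<partial>count_space A)"

lemma nsum_mono: "(\<And>x. x \<in> A \<Longrightarrow> f x \<le> g x) \<Longrightarrow> nsum A f \<le> nsum A g"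
  by (intro nn_integral_mono) simp

lemma nsum_cong: "(\<And>x. x \<in> A \<Longrightarrow> f x = g x) \<Longrightarrow> nsum A f = nsum A g"
  by (intro nn_integral_cong) simp

lemma nsum_add: "nsum A (\<lambda>x. f x + g x) = nsum A f + nsum A g"
  by (intro nn_integral_add) auto

lemma nsum_cmult: "nsum A (\<lambda>x. c * f x) = c * nsum A f"
  by (intro nn_integral_cmult) auto

lemma nsum_multc: "nsum A (\<lambda>x. f x * c) = nsum A f * c"
  by (intro nn_integral_multc) auto

lemma nsum_swap:
  "countable A \<Longrightarrow> nsum B (\<lambda>x. nsum A (\<lambda>y. f x y)) = nsum A (\<lambda>y. nsum B (\<lambda>x. f x y))"
  by (rule nn_integral_count_space_nn_integral) auto

lemma nsum_point: "y \<in> A \<Longrightarrow> nsum A (\<lambda>x. if x = y then f x else 0) = f y"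
  by (subst nn_integral_count_space'[of "{y}"]) auto

context
  fixes F :: "nat \<Rightarrow> 'a set" and A :: "'a set"
  assumes F: "incseq F" "\<And>N. finite (F N)" "(\<Union>N. F N) = A"
begin

text \<open>Monotone convergence in the form shared by the sums over the first and over the second index.\<close>

lemma exhaustion_sum_tendsto:
  assumes inc: "\<And>z. incseq (\<lambda>N. t N z)" and lim: "\<And>z. (\<lambda>N. t N z) \<longlonglongrightarrow> s z"
    and supp: "\<And>N z. z \<notin> F N \<Longrightarrow> t N z = 0"
  shows "(\<lambda>N. \<Sum>z\<in>F N. f z * t N z) \<longlonglongrightarrow> nsum A (\<lambda>z. f z * s z)"
proof -
  have s: "s z = (SUP N. t N z)" for z
    using LIMSEQ_SUP[OF inc] lim by (rule LIMSEQ_unique[rotated])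
  have "(\<lambda>N. nsum A (\<lambda>z. f z * t N z)) \<longlonglongrightarrow> nsum A (\<lambda>z. f z * s z)"
  proof (rule nn_integral_LIMSEQ)
    show "incseq (\<lambda>N z. f z * t N z)"
      using inc by (auto simp: incseq_def le_fun_def intro!: mult_left_mono)
    show "(\<lambda>N. f z * t N z) \<longlonglongrightarrow> f z * s z" for z
      unfolding s SUP_mult_left_ennreal
      by (rule LIMSEQ_SUP) (use inc in \<open>auto simp: incseq_def intro!: mult_left_mono\<close>)
  qed auto
  moreover have "nsum A (\<lambda>z. f z * t N z) = (\<Sum>z\<in>F N. f z * t N z)" for N
    by (rule nn_integral_count_space'[OF F(2) _ exhaustion_subset[OF F]]) (simp add: supp)
  ultimately show ?thesis by simp
qed

lemma exhaustion_nsum_tendsto: "(\<lambda>N. \<Sum>z\<in>F N. f z) \<longlonglongrightarrow> nsum A f"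
proof -
  have "(\<lambda>N. \<Sum>z\<in>F N. f z * indicator (F N) z) \<longlonglongrightarrow> nsum A (\<lambda>z. f z * indicator A z)"
  proof (rule exhaustion_sum_tendsto)
    show "incseq (\<lambda>N. indicator (F N) z :: ennreal)" for z
      using F(1) by (auto simp: incseq_def split: split_indicator)
    show "(\<lambda>N. indicator (F N) z :: ennreal) \<longlonglongrightarrow> indicator A z" for z
      using LIMSEQ_indicator_incseq[OF F(1)] by (simp only: F(3))
  qed simp
  moreover have "nsum A (\<lambda>z. f z * indicator A z) = nsum A f" by (rule nsum_cong) simp
  ultimately show ?thesis by simp
qed

end

lemma nsum_eq_SUP:
  assumes "countable A"
  shows "nsum A f = (SUP B\<in>{B. finite B \<and> B \<subseteq> A}. \<Sum>x\<in>B. f x)"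
proof (rule antisym)
  show "nsum A f \<le> (SUP B\<in>{B. finite B \<and> B \<subseteq> A}. \<Sum>x\<in>B. f x)"
  proof (cases "A = {}")
    case False
    define F where "F N = from_nat_into A ` {..N}" for N
    have "\<exists>N. x \<in> F N" if "x \<in> A" for x
      using from_nat_into_surj[OF assms that] by (auto simp: F_def)
    then have F: "incseq F" "finite (F N)" "(\<Union>N. F N) = A" for N
      using from_nat_into[OF False] by (auto simp: incseq_def F_def)
    have "(\<Sum>x\<in>F N. f x) \<le> (SUP B\<in>{B. finite B \<and> B \<subseteq> A}. \<Sum>x\<in>B. f x)" for N
      using F by (intro SUP_upper) auto
    then show ?thesis by (intro LIMSEQ_le_const2[OF exhaustion_nsum_tendsto[OF F]]) auto
  qed (simp add: nn_integral_empty)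
next
  show "(SUP B\<in>{B. finite B \<and> B \<subseteq> A}. \<Sum>x\<in>B. f x) \<le> nsum A f"
  proof (rule SUP_least)
    fix B assume B: "B \<in> {B. finite B \<and> B \<subseteq> A}"
    have "(\<Sum>x\<in>B. f x) = (\<Sum>x\<in>B. f x * indicator B x)" by simp
    also have "\<dots> = nsum A (\<lambda>x. f x * indicator B x)"
      using B by (intro nn_integral_count_space'[symmetric]) auto
    also have "\<dots> \<le> nsum A f"
      by (rule nsum_mono) (auto split: split_indicator)
    finally show "(\<Sum>x\<in>B. f x) \<le> nsum A f" .
  qed
qed

lemma nsum_eq_infsum:
  assumes "countable A"
  shows "nsum A f = (\<Sum>\<^sub>\<infinity>x\<in>A. f x)"
  by (subst nsum_eq_SUP[OF assms], subst nonneg_infsum_complete) simp_all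

lemma has_sum_imp_nsum:
  fixes f :: "'a \<Rightarrow> real"
  assumes "countable A" "\<And>x. x \<in> A \<Longrightarrow> 0 \<le> f x" "(f has_sum r) A"
  shows "nsum A (\<lambda>x. ennreal (f x)) = ennreal r"
proof -
  have "ennreal (infsum f A) = (SUP B\<in>{B. finite B \<and> B \<subseteq> A}. ennreal (sum f B))"
    using assms by (intro infsum_nonneg_is_SUPREMUM_ennreal) (auto simp: summable_on_def)
  also have "\<dots> = (SUP B\<in>{B. finite B \<and> B \<subseteq> A}. \<Sum>x\<in>B. ennreal (f x))"
    using assms(2) by (intro SUP_cong refl) (auto simp: sum_ennreal subset_iff)
  also have "\<dots> = nsum A (\<lambda>x. ennreal (f x))"
    by (rule nsum_eq_SUP[OF assms(1), symmetric])
  finally show ?thesis using assms(3) by (simp add: infsumI)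
qed

lemma nsum_imp_has_sum:
  fixes f :: "'a \<Rightarrow> real"
  assumes "countable A" "\<And>x. x \<in> A \<Longrightarrow> 0 \<le> f x" "nsum A (\<lambda>x. ennreal (f x)) = ennreal r" "0 \<le> r"
  shows "(f has_sum r) A"
proof -
  have le: "sum f B \<le> r" if "finite B" "B \<subseteq> A" for B
  proof -
    have "ennreal (sum f B) = (\<Sum>x\<in>B. ennreal (f x))"
      using that assms(2) by (auto simp: sum_ennreal subset_iff)
    also have "\<dots> \<le> nsum A (\<lambda>x. ennreal (f x))"
      unfolding nsum_eq_SUP[OF assms(1)] using that by (intro SUP_upper) auto
    finally show ?thesis using assms(3,4) by (simp add: ennreal_le_iff)
  qed
  have "f summable_on A"
    using assms(2) le by (intro nonneg_bdd_above_summable_on) (auto simp: bdd_above_def)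
  then have sum: "(f has_sum infsum f A) A" by simp
  with has_sum_imp_nsum[OF assms(1,2) this] assms(3) have "ennreal (infsum f A) = ennreal r" by simp
  moreover have "0 \<le> infsum f A" using assms(2) by (intro infsum_nonneg)
  ultimately have "infsum f A = r" using assms(4) by simp
  with sum show ?thesis by simp
qed

lemma nsum_pos_part_eq_neg_part:
  fixes p f :: "'a \<Rightarrow> real"
  assumes A: "countable A" and p: "\<And>x. x \<in> A \<Longrightarrow> 0 \<le> p x" and f: "((\<lambda>x. p x * f x) has_sum 0) A"
  shows "nsum A (\<lambda>x. ennreal (p x) * ennreal (f x)) = nsum A (\<lambda>x. ennreal (p x) * ennreal (- f x))"
proof -
  have "(\<lambda>x. norm (p x * f x)) summable_on A"
    by (rule summable_on_iff_abs_summable_on_real[THEN iffD1]) (use f in \<open>auto simp: summable_on_def\<close>)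
  then obtain s where s: "((\<lambda>x. \<bar>p x * f x\<bar>) has_sum s) A" by (auto simp: summable_on_def)
  have part: "nsum A (\<lambda>x. ennreal (p x) * ennreal (e * f x)) = ennreal (s / 2)" if e: "e = 1 \<or> e = - 1" for e
  proof -
    have "((\<lambda>x. (\<bar>p x * f x\<bar> + e * (p x * f x)) / 2) has_sum (s / 2)) A"
      using has_sum_divide_const[OF has_sum_add[OF s has_sum_cmult_right[OF f, of e]], of 2] by simp
    moreover have "(\<bar>p x * f x\<bar> + e * (p x * f x)) / 2 = p x * max 0 (e * f x)" if x: "x \<in> A" for x
    proof -
      have "(\<bar>f x\<bar> + e * f x) / 2 = max 0 (e * f x)" using e by auto
      then have "p x * ((\<bar>f x\<bar> + e * f x) / 2) = p x * max 0 (e * f x)" by simp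
      then show ?thesis using p[OF x] by (simp add: abs_mult algebra_simps)
    qed
    ultimately have "((\<lambda>x. p x * max 0 (e * f x)) has_sum (s / 2)) A"
      by (simp cong: has_sum_cong)
    then have "nsum A (\<lambda>x. ennreal (p x * max 0 (e * f x))) = ennreal (s / 2)"
      by (rule has_sum_imp_nsum[OF A, rotated]) (use p in simp)
    moreover have "nsum A (\<lambda>x. ennreal (p x * max 0 (e * f x))) = nsum A (\<lambda>x. ennreal (p x) * ennreal (e * f x))"
      by (rule nsum_cong) (use p in \<open>simp add: ennreal_mult max_def ennreal_neg\<close>)
    ultimately show ?thesis by simp
  qed
  show ?thesis using part[of 1] part[of "- 1"] by simp
qed

section \<open>The minimal resolvent\<close>

text \<open>Extended by zero, the resolvents of the corners increase with the corner, and their supremum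
  is the least nonnegative solution of the backward equation.  Values are taken in the extended
  reals so that the limits and exchanges of sums below need no summability.\<close>

definition truncated_resolvent ::
  "(nat \<Rightarrow> 'a set) \<Rightarrow> ('a \<Rightarrow> 'a \<Rightarrow> real) \<Rightarrow> real \<Rightarrow> nat \<Rightarrow> 'a \<Rightarrow> 'a \<Rightarrow> ennreal" where
  "truncated_resolvent F q \<beta> N x y
    = (if x \<in> F N \<and> y \<in> F N then ennreal (finite_resolvent (F N) q \<beta> x y) else 0)"

definition min_resolvent :: "(nat \<Rightarrow> 'a set) \<Rightarrow> ('a \<Rightarrow> 'a \<Rightarrow> real) \<Rightarrow> real \<Rightarrow> 'a \<Rightarrow> 'a \<Rightarrow> ennreal" where
  "min_resolvent F q \<beta> x y = (SUP N. truncated_resolvent F q \<beta> N x y)"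

context
  fixes F :: "nat \<Rightarrow> 'a set" and A :: "'a set" and q :: "'a \<Rightarrow> 'a \<Rightarrow> real" and \<beta> :: real
  assumes F: "incseq F" "\<And>N. finite (F N)" "(\<Union>N. F N) = A"
    and q: "conservative_q_matrix A q"
    and \<beta>: "0 < \<beta>"
begin

abbreviation (input) "R \<equiv> truncated_resolvent F q \<beta>"
abbreviation (input) "\<Phi> \<equiv> min_resolvent F q \<beta>"

lemmas F_subset = exhaustion_subset[OF F]
lemmas F_eventually = exhaustion_eventually[OF F]
lemmas off_diagonal = q_off_diagonal[OF q]

lemma countable_states: "countable A"
proof -
  have "countable (\<Union>N. F N)" by (intro countable_UN) (auto intro: countable_finite F(2))
  then show ?thesis by (simp only: F(3))
qed

lemma sub_q: "sub_q_matrix (F N) q"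
  by (rule conservative_imp_sub_q_matrix[OF q F(2) F_subset])

lemma truncated_resolvent_incseq: "incseq (\<lambda>N. R N x y)"
proof (rule incseq_SucI)
  fix N
  show "R N x y \<le> R (Suc N) x y"
    using finite_resolvent_mono[OF sub_q incseq_SucD[OF F(1)] \<beta>, of x N y] incseq_SucD[OF F(1), of N]
    by (auto simp: truncated_resolvent_def intro: ennreal_leI)
qed

lemma truncated_resolvent_tendsto: "(\<lambda>N. R N x y) \<longlonglongrightarrow> \<Phi> x y"
  unfolding min_resolvent_def by (rule LIMSEQ_SUP[OF truncated_resolvent_incseq])

lemma truncated_resolvent_le: "R N x y \<le> \<Phi> x y"
  unfolding min_resolvent_def by (rule SUP_upper) simp

lemma truncated_row_sum_tendsto:
  "(\<lambda>N. \<Sum>y\<in>F N. R N x y * f y) \<longlonglongrightarrow> nsum A (\<lambda>y. \<Phi> x y * f y)"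
  using exhaustion_sum_tendsto[OF F, where t = "\<lambda>N. R N x" and s = "\<Phi> x" and f = f]
    truncated_resolvent_incseq truncated_resolvent_tendsto
  by (simp add: truncated_resolvent_def mult.commute)

lemma truncated_column_sum_tendsto:
  "(\<lambda>N. \<Sum>x\<in>F N. f x * R N x y) \<longlonglongrightarrow> nsum A (\<lambda>x. f x * \<Phi> x y)"
  by (rule exhaustion_sum_tendsto[OF F truncated_resolvent_incseq truncated_resolvent_tendsto])
     (simp add: truncated_resolvent_def)

lemma truncated_eq: "x \<in> F N \<Longrightarrow> y \<in> F N \<Longrightarrow>
    R N x y = ennreal (finite_resolvent (F N) q \<beta> x y)"
  by (simp add: truncated_resolvent_def)

lemma resolvent_nonneg: "x \<in> F N \<Longrightarrow> y \<in> F N \<Longrightarrow> 0 \<le> finite_resolvent (F N) q \<beta> x y"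
  by (rule finite_resolvent_nonneg[OF sub_q \<beta>])

lemma truncated_row_sum:
  assumes "x \<in> F N" "\<And>y. y \<in> F N \<Longrightarrow> 0 \<le> f y"
  shows "(\<Sum>y\<in>F N. R N x y * ennreal (f y))
    = ennreal (\<Sum>y\<in>F N. finite_resolvent (F N) q \<beta> x y * f y)"
  using assms by (subst sum_ennreal[symmetric]) (auto simp: truncated_eq ennreal_mult resolvent_nonneg)

lemma min_resolvent_row_sum:
  assumes x: "x \<in> A"
    and honest: "(\<lambda>N. \<Sum>y\<in>F N. finite_resolvent (F N) q \<beta> x y) \<longlonglongrightarrow> 1"
  shows "nsum A (\<Phi> x) = 1"
proof -
  have "(\<lambda>N. ennreal (\<Sum>y\<in>F N. finite_resolvent (F N) q \<beta> x y)) \<longlonglongrightarrow> ennreal 1"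
    using honest by (rule tendsto_ennrealI)
  moreover have "\<forall>\<^sub>F N in sequentially. ennreal (\<Sum>y\<in>F N. finite_resolvent (F N) q \<beta> x y)
      = (\<Sum>y\<in>F N. R N x y * 1)"
    using F_eventually[OF x]
    by eventually_elim (use truncated_row_sum[of x _ "\<lambda>_. 1"] in simp)
  ultimately have "(\<lambda>N. \<Sum>y\<in>F N. R N x y * 1) \<longlonglongrightarrow> ennreal 1"
    by (rule Lim_transform_eventually)
  from LIMSEQ_unique[OF truncated_row_sum_tendsto this] show ?thesis by simp
qed

text \<open>The backward equation \<open>(\<beta> - Q) \<Phi> = \<beta> I\<close>, with the diagonal of \<open>Q\<close> on the left.\<close>

lemma min_resolvent_backward:
  assumes xy: "x \<in> A" "y \<in> A"
  shows "ennreal (\<beta> - q x x) * \<Phi> x y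
    = ennreal \<beta> * (if x = y then 1 else 0)
      + nsum A (\<lambda>z. (if z = x then 0 else ennreal (q x z)) * \<Phi> z y)"
proof (rule LIMSEQ_unique)
  let ?qo = "\<lambda>z. if z = x then 0 else ennreal (q x z)"
  show "(\<lambda>N. ennreal (\<beta> - q x x) * R N x y)
      \<longlonglongrightarrow> ennreal (\<beta> - q x x) * \<Phi> x y"
    by (intro ennreal_tendsto_cmult truncated_resolvent_tendsto) simp
  have "(\<lambda>N. ennreal \<beta> * (if x = y then 1 else 0) + (\<Sum>z\<in>F N. ?qo z * R N z y))
      \<longlonglongrightarrow> ennreal \<beta> * (if x = y then 1 else 0) + nsum A (\<lambda>z. ?qo z * \<Phi> z y)"
    by (intro tendsto_intros truncated_column_sum_tendsto)
  moreover have "\<forall>\<^sub>F N in sequentially. ennreal \<beta> * (if x = y then 1 else 0)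
        + (\<Sum>z\<in>F N. ?qo z * R N z y)
      = ennreal (\<beta> - q x x) * R N x y"
    using F_eventually[OF xy(1)] F_eventually[OF xy(2)]
  proof eventually_elim
    case (elim N)
    let ?R = "finite_resolvent (F N) q \<beta>"
    have off: "0 \<le> q x z" if "z \<in> F N - {x}" for z
      using that elim off_diagonal F_subset by blast
    have "(\<Sum>z\<in>F N. ?qo z * R N z y) = (\<Sum>z\<in>F N - {x}. ennreal (q x z * ?R z y))"
      using elim F(2) off
      by (subst sum.remove[OF F(2) elim(1)])
         (auto intro!: sum.cong simp: truncated_eq ennreal_mult resolvent_nonneg)
    also have "\<dots> = ennreal (\<Sum>z\<in>F N - {x}. q x z * ?R z y)"
      using off elim by (intro sum_ennreal) (auto intro!: mult_nonneg_nonneg resolvent_nonneg)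
    finally have *: "(\<Sum>z\<in>F N. ?qo z * R N z y) = \<dots>" .
    have "(\<Sum>z\<in>F N. q x z * ?R z y) = q x x * ?R x y + (\<Sum>z\<in>F N - {x}. q x z * ?R z y)"
      by (rule sum.remove[OF F(2) elim(1)])
    with finite_resolvent_backward[OF sub_q \<beta> elim]
    have "(\<beta> - q x x) * ?R x y = \<beta> * (if x = y then 1 else 0) + (\<Sum>z\<in>F N - {x}. q x z * ?R z y)"
      by (simp add: algebra_simps)
    moreover have "0 \<le> (\<Sum>z\<in>F N - {x}. q x z * ?R z y)"
      using off elim by (intro sum_nonneg mult_nonneg_nonneg resolvent_nonneg) auto
    moreover have "0 \<le> \<beta> - q x x" using \<beta> q_diagonal[OF q xy(1)] by linarith
    moreover have "ennreal (\<beta> - q x x) * R N x y = ennreal ((\<beta> - q x x) * ?R x y)"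
      using elim calculation(3) by (simp only: truncated_eq ennreal_mult resolvent_nonneg)
    ultimately show ?case
      unfolding * using \<beta> by (cases "x = y") auto
  qed
  ultimately show "(\<lambda>N. ennreal (\<beta> - q x x) * R N x y)
      \<longlonglongrightarrow> ennreal \<beta> * (if x = y then 1 else 0) + nsum A (\<lambda>z. ?qo z * \<Phi> z y)"
    by (rule Lim_transform_eventually)
qed

text \<open>Mass flows into a finite set from outside at a nonnegative rate, so a stationary vector restricted to
  that set is superinvariant for the corner.\<close>

lemma min_resolvent_invariant_le:
  assumes p: "\<And>x. x \<in> A \<Longrightarrow> 0 \<le> p x" "\<And>y. y \<in> A \<Longrightarrow> ((\<lambda>x. p x * q x y) has_sum 0) A"
    and y: "y \<in> A"
  shows "nsum A (\<lambda>x. ennreal (p x) * \<Phi> x y) \<le> ennreal (p y)"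
proof (rule LIMSEQ_le_const2[OF truncated_column_sum_tendsto])
  obtain N0 where N0: "\<And>N. N \<ge> N0 \<Longrightarrow> y \<in> F N"
    using F_eventually[OF y] by (auto simp: eventually_sequentially)
  have "(\<Sum>x\<in>F N. ennreal (p x) * R N x y) \<le> ennreal (p y)" if "N \<ge> N0" for N
  proof -
    have "(\<Sum>x\<in>F N. p x * finite_resolvent (F N) q \<beta> x y) \<le> p y"
    proof (rule finite_resolvent_le_superinvariant[OF sub_q \<beta> _ N0[OF that]])
      fix w assume w: "w \<in> F N"
      then have wA: "w \<in> A" using F_subset by auto
      have "((\<lambda>x. p x * q x w) has_sum (\<Sum>x\<in>F N. p x * q x w)) (F N)" using F(2) by simp
      then have "(\<Sum>x\<in>F N. p x * q x w) \<le> 0"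
      proof (rule has_sum_mono2[OF _ p(2)[OF wA] F_subset])
        fix x assume "x \<in> A - F N"
        then show "0 \<le> p x * q x w" using w wA p(1) off_diagonal[of x w] by (auto intro!: mult_nonneg_nonneg)
      qed
      then show "\<beta> * p w + (\<Sum>x\<in>F N. p x * q x w) \<le> \<beta> * p w" by simp
    qed
    moreover have "(\<Sum>x\<in>F N. ennreal (p x) * R N x y)
        = ennreal (\<Sum>x\<in>F N. p x * finite_resolvent (F N) q \<beta> x y)"
      using N0[OF that] p(1) F_subset
      by (subst sum_ennreal[symmetric])
         (auto simp: truncated_eq resolvent_nonneg ennreal_mult subset_iff intro!: mult_nonneg_nonneg sum.cong)
    ultimately show ?thesis by (simp add: ennreal_leI)
  qed
  then show "\<exists>N0. \<forall>N\<ge>N0. (\<Sum>x\<in>F N. ennreal (p x) * R N x y) \<le> ennreal (p y)"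
    by blast
qed

text \<open>Both sides of the preceding inequality have total mass 1 if the minimal resolvent is honest, and a
  pointwise inequality between vectors with the same finite sum is an equality.\<close>

lemma min_resolvent_invariant:
  assumes p: "\<And>x. x \<in> A \<Longrightarrow> 0 \<le> p x" "\<And>y. y \<in> A \<Longrightarrow> ((\<lambda>x. p x * q x y) has_sum 0) A"
    and total: "nsum A (\<lambda>x. ennreal (p x)) = 1"
    and honest: "\<And>x. x \<in> A \<Longrightarrow> nsum A (\<Phi> x) = 1"
    and y: "y \<in> A"
  shows "nsum A (\<lambda>x. ennreal (p x) * \<Phi> x y) = ennreal (p y)"
proof -
  let ?g = "\<lambda>y. nsum A (\<lambda>x. ennreal (p x) * \<Phi> x y)"
  have "nsum A ?g = nsum A (\<lambda>x. nsum A (\<lambda>y. ennreal (p x) * \<Phi> x y))"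
    by (rule nsum_swap[OF countable_states])
  also have "\<dots> = nsum A (\<lambda>x. ennreal (p x))"
    unfolding nsum_cmult by (rule nsum_cong) (simp add: honest)
  finally have g: "nsum A ?g = 1" by (simp add: total)
  have le: "?g y \<le> ennreal (p y)" if "y \<in> A" for y
    by (rule min_resolvent_invariant_le[OF p that])
  have "nsum A (\<lambda>y. ennreal (p y) - ?g y) = nsum A (\<lambda>y. ennreal (p y)) - nsum A ?g"
    by (rule nn_integral_diff) (use g le in \<open>auto simp: AE_count_space\<close>)
  then have "nsum A (\<lambda>y. ennreal (p y) - ?g y) = 0" by (simp add: g total)
  then have "ennreal (p y) - ?g y = 0"
    using y by (simp add: nn_integral_0_iff_AE AE_count_space)
  then have "ennreal (p y) \<le> ?g y"
    by (metis diff_eq_0_iff_ennreal)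
  with le[OF y] show ?thesis by (rule antisym)
qed

text \<open>Cutting \<open>v\<close> off outside a corner discards nonnegative terms of \<open>Q v\<close> only, so \<open>v\<close> remains a
  supersolution for the corner.\<close>

lemma min_resolvent_drift:
  assumes v: "\<And>x. x \<in> A \<Longrightarrow> 0 \<le> v x"
    and drift: "q_apply_le A q v (\<lambda>x. - c * v x + b * indicator K x)"
    and bc: "0 \<le> b" "0 \<le> c" and x: "x \<in> A"
  shows "ennreal (\<beta> + c) * nsum A (\<lambda>y. \<Phi> x y * ennreal (v y))
    \<le> ennreal (\<beta> * v x) + ennreal b * nsum A (\<lambda>y. \<Phi> x y * indicator K y)"
proof (rule LIMSEQ_le)
  show "(\<lambda>N. ennreal (\<beta> + c) * (\<Sum>y\<in>F N. R N x y * ennreal (v y)))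
     \<longlonglongrightarrow> ennreal (\<beta> + c) * nsum A (\<lambda>y. \<Phi> x y * ennreal (v y))"
    by (intro ennreal_tendsto_cmult truncated_row_sum_tendsto) simp
  show "(\<lambda>N. ennreal (\<beta> * v x) + ennreal b * (\<Sum>y\<in>F N. R N x y * indicator K y))
     \<longlonglongrightarrow> ennreal (\<beta> * v x) + ennreal b * nsum A (\<lambda>y. \<Phi> x y * indicator K y)"
    by (intro tendsto_intros ennreal_tendsto_cmult truncated_row_sum_tendsto) simp
  obtain N0 where N0: "\<And>N. N \<ge> N0 \<Longrightarrow> x \<in> F N"
    using F_eventually[OF x] by (auto simp: eventually_sequentially)
  have "ennreal (\<beta> + c) * (\<Sum>y\<in>F N. R N x y * ennreal (v y))
      \<le> ennreal (\<beta> * v x) + ennreal b * (\<Sum>y\<in>F N. R N x y * indicator K y)" if "N \<ge> N0" for N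
  proof -
    note xN = N0[OF that]
    let ?R = "finite_resolvent (F N) q \<beta>"
    have vF: "\<And>y. y \<in> F N \<Longrightarrow> 0 \<le> v y" using v F_subset by auto
    have "(\<Sum>y\<in>F N. ?R x y * (((\<beta> + c) * v y - b * indicator K y) / \<beta>)) \<le> v x"
    proof (rule finite_resolvent_le_supersolution[OF sub_q \<beta> _ xN])
      fix w assume w: "w \<in> F N"
      then have wA: "w \<in> A" using F_subset by auto
      have sums: "((\<lambda>z. q w z * v z) has_sum (\<Sum>\<^sub>\<infinity>z\<in>A. q w z * v z)) A"
        and le: "(\<Sum>\<^sub>\<infinity>z\<in>A. q w z * v z) \<le> - c * v w + b * indicator K w"
        using drift wA by (auto simp: q_apply_le_def)
      have "((\<lambda>z. q w z * v z) has_sum (\<Sum>z\<in>F N. q w z * v z)) (F N)" using F(2) by simp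
      then have "(\<Sum>z\<in>F N. q w z * v z) \<le> (\<Sum>\<^sub>\<infinity>z\<in>A. q w z * v z)"
      proof (rule has_sum_mono2[OF _ sums F_subset])
        fix z assume "z \<in> A - F N"
        then show "0 \<le> q w z * v z" using w wA v off_diagonal[of w z] by (auto intro!: mult_nonneg_nonneg)
      qed
      moreover have "\<beta> * (((\<beta> + c) * v w - b * indicator K w) / \<beta>) = (\<beta> + c) * v w - b * indicator K w"
        using \<beta> by simp
      ultimately show "\<beta> * (((\<beta> + c) * v w - b * indicator K w) / \<beta>) + (\<Sum>z\<in>F N. q w z * v z) \<le> \<beta> * v w"
        using le by (simp add: algebra_simps)
    qed
    also have "(\<Sum>y\<in>F N. ?R x y * (((\<beta> + c) * v y - b * indicator K y) / \<beta>))
        = ((\<beta> + c) * (\<Sum>y\<in>F N. ?R x y * v y) - b * (\<Sum>y\<in>F N. ?R x y * indicator K y)) / \<beta>"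
      by (simp add: sum_divide_distrib[symmetric] sum_distrib_left sum_subtractf[symmetric] algebra_simps)
    finally have "(\<beta> + c) * (\<Sum>y\<in>F N. ?R x y * v y) \<le> \<beta> * v x + b * (\<Sum>y\<in>F N. ?R x y * indicator K y)"
      using \<beta> by (simp add: field_simps)
    then have "ennreal ((\<beta> + c) * (\<Sum>y\<in>F N. ?R x y * v y)) \<le> ennreal (\<beta> * v x + b * (\<Sum>y\<in>F N. ?R x y * indicator K y))"
      by (rule ennreal_leI)
    moreover have "(\<Sum>y\<in>F N. R N x y * indicator K y) = ennreal (\<Sum>y\<in>F N. ?R x y * indicator K y)"
      using truncated_row_sum[OF xN, of "indicator K"] by (simp add: ennreal_indicator)
    moreover have "0 \<le> (\<Sum>y\<in>F N. ?R x y * indicator K y)" "0 \<le> (\<Sum>y\<in>F N. ?R x y * v y)"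
      using vF xN by (auto intro!: sum_nonneg mult_nonneg_nonneg resolvent_nonneg)
    ultimately show ?thesis
      using truncated_row_sum[OF xN vF] \<beta> bc v[OF x] by (simp add: ennreal_mult ennreal_plus)
  qed
  then show "\<exists>N0. \<forall>N\<ge>N0. ennreal (\<beta> + c) * (\<Sum>y\<in>F N. R N x y * ennreal (v y))
      \<le> ennreal (\<beta> * v x) + ennreal b * (\<Sum>y\<in>F N. R N x y * indicator K y)"
    by blast
qed

end

section \<open>The Poisson equation of an ergodic kernel\<close>

abbreviation kapply :: "'a set \<Rightarrow> ('a \<Rightarrow> 'a \<Rightarrow> ennreal) \<Rightarrow> ('a \<Rightarrow> ennreal) \<Rightarrow> 'a \<Rightarrow> ennreal" where
  "kapply A P f x \<equiv> nsum A (\<lambda>y. P x y * f y)"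

lemma kapply_mono: "(\<And>y. y \<in> A \<Longrightarrow> f y \<le> g y) \<Longrightarrow> kapply A P f x \<le> kapply A P g x"
  by (intro nsum_mono mult_left_mono) auto

lemma nsum_distrib_left: "nsum A (\<lambda>x. g x * (f x + h x)) = nsum A (\<lambda>x. g x * f x) + nsum A (\<lambda>x. g x * h x)"
  by (simp add: distrib_left nsum_add)

lemma nsum_pull: "nsum A (\<lambda>x. g x * (k * f x)) = k * nsum A (\<lambda>x. g x * f x)"
  by (simp add: mult.left_commute nsum_cmult)

text \<open>A discrete-time chain with invariant distribution \<open>p\<close> whose kernel \<open>P\<close> plays the role of the resolvent.
  The drift condition is the one that the resolvent inherits from the generator, and the minorization makes
  \<open>y0\<close> a regeneration state for the chain in \<open>K\<close>.\<close>

locale drift_kernel =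
  fixes A :: "'a set" and P :: "'a \<Rightarrow> 'a \<Rightarrow> ennreal" and p :: "'a \<Rightarrow> ennreal"
    and v :: "'a \<Rightarrow> real" and b c \<beta> \<phi> :: real and K :: "'a set" and y0 :: 'a
  assumes countable: "countable A"
    and stochastic: "\<And>x. x \<in> A \<Longrightarrow> nsum A (P x) = 1"
    and total: "nsum A p = 1"
    and invariant: "\<And>y. y \<in> A \<Longrightarrow> nsum A (\<lambda>x. p x * P x y) = p y"
    and v_nonneg: "\<And>x. x \<in> A \<Longrightarrow> 0 \<le> v x"
    and v_ge: "\<And>x. x \<in> A \<Longrightarrow> 1 \<le> c * v x"
    and pos: "0 < b" "0 < c" "0 < \<beta>" "0 < \<phi>"
    and drift: "\<And>x. x \<in> A \<Longrightarrow> ennreal (\<beta> + c) * kapply A P (\<lambda>y. ennreal (v y)) x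
      \<le> ennreal (\<beta> * v x) + ennreal b * kapply A P (indicator K) x"
    and y0: "y0 \<in> A"
    and minorization: "\<And>x. x \<in> A \<inter> K \<Longrightarrow> ennreal \<phi> \<le> P x y0"
begin

lemma kapply_one: "x \<in> A \<Longrightarrow> kapply A P (\<lambda>_. k) x = k"
  by (simp add: nsum_multc stochastic)

lemma invariant_apply: "nsum A (\<lambda>x. p x * kapply A P f x) = nsum A (\<lambda>y. p y * f y)"
proof -
  have "nsum A (\<lambda>x. p x * kapply A P f x) = nsum A (\<lambda>x. nsum A (\<lambda>y. p x * P x y * f y))"
    by (simp add: nsum_cmult[symmetric] mult.assoc)
  also have "\<dots> = nsum A (\<lambda>y. nsum A (\<lambda>x. p x * P x y * f y))"
    by (rule nsum_swap[OF countable])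
  also have "\<dots> = nsum A (\<lambda>y. p y * f y)"
    by (rule nsum_cong) (simp add: nsum_multc invariant)
  finally show ?thesis .
qed

text \<open>Integrating the drift inequality against \<open>p\<close> is legitimate only if \<open>p v\<close> is finite, so it is
  done for the truncations \<open>min v m\<close>, which inherit the inequality on the sublevel set of \<open>m\<close>.\<close>

lemma drift_integrated:
  "ennreal c * nsum A (\<lambda>x. p x * ennreal (v x)) \<le> ennreal b * nsum A (\<lambda>x. p x * indicator K x)"
proof -
  let ?v = "\<lambda>x. ennreal (v x)"
  let ?vm = "\<lambda>m x. ennreal (min (v x) (real m))"
  let ?L = "\<lambda>m x. indicator {x. v x \<le> real m} x * kapply A P ?v x"
  have step: "ennreal c * nsum A (\<lambda>x. p x * ?L m x) \<le> ennreal b * nsum A (\<lambda>x. p x * indicator K x)" for m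
  proof -
    have point: "ennreal \<beta> * kapply A P (?vm m) x + ennreal c * ?L m x
        \<le> ennreal \<beta> * ?vm m x + ennreal b * kapply A P (indicator K) x" if x: "x \<in> A" for x
    proof (cases "v x \<le> real m")
      case True
      have "ennreal \<beta> * kapply A P (?vm m) x + ennreal c * ?L m x
          \<le> ennreal \<beta> * kapply A P ?v x + ennreal c * kapply A P ?v x"
        using True by (intro add_mono mult_left_mono kapply_mono ennreal_leI) auto
      also have "\<dots> = ennreal (\<beta> + c) * kapply A P ?v x"
        using pos by (simp add: distrib_right)
      also have "\<dots> \<le> ennreal (\<beta> * v x) + ennreal b * kapply A P (indicator K) x"
        by (rule drift[OF x])
      also have "ennreal (\<beta> * v x) = ennreal \<beta> * ?vm m x"
        using True pos v_nonneg[OF x] by (simp add: ennreal_mult)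
      finally show ?thesis .
    next
      case False
      have "kapply A P (?vm m) x \<le> kapply A P (\<lambda>_. ennreal (real m)) x"
        by (intro kapply_mono ennreal_leI) auto
      then have "kapply A P (?vm m) x \<le> ?vm m x"
        using False by (simp only: kapply_one[OF x]) (simp add: min_def)
      then show ?thesis using False by (auto intro!: add_increasing2 mult_left_mono)
    qed
    have "ennreal \<beta> * nsum A (\<lambda>x. p x * ?vm m x) + ennreal c * nsum A (\<lambda>x. p x * ?L m x)
        = nsum A (\<lambda>x. p x * (ennreal \<beta> * kapply A P (?vm m) x + ennreal c * ?L m x))"
      by (simp add: distrib_left nsum_add nsum_cmult mult.left_commute invariant_apply)
    also have "\<dots> \<le> nsum A (\<lambda>x. p x * (ennreal \<beta> * ?vm m x + ennreal b * kapply A P (indicator K) x))"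
      by (intro nsum_mono mult_left_mono point) auto
    also have "\<dots> = ennreal \<beta> * nsum A (\<lambda>x. p x * ?vm m x) + ennreal b * nsum A (\<lambda>x. p x * indicator K x)"
      by (simp add: distrib_left nsum_add nsum_cmult mult.left_commute invariant_apply)
    finally have "ennreal \<beta> * nsum A (\<lambda>x. p x * ?vm m x) + ennreal c * nsum A (\<lambda>x. p x * ?L m x)
      \<le> ennreal \<beta> * nsum A (\<lambda>x. p x * ?vm m x) + ennreal b * nsum A (\<lambda>x. p x * indicator K x)" .
    moreover have "nsum A (\<lambda>x. p x * ?vm m x) \<le> nsum A (\<lambda>x. p x * ennreal (real m))"
      by (intro nsum_mono mult_left_mono ennreal_leI) auto
    then have "nsum A (\<lambda>x. p x * ?vm m x) \<noteq> \<top>"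
      by (auto simp: nsum_multc total top_unique)
    ultimately show ?thesis
      by (simp add: ennreal_add_left_cancel_le ennreal_mult_eq_top_iff)
  qed
  have "ennreal c * nsum A (\<lambda>x. p x * ?v x) = ennreal c * nsum A (\<lambda>x. p x * kapply A P ?v x)"
    by (simp add: invariant_apply)
  also have "nsum A (\<lambda>x. p x * kapply A P ?v x) = nsum A (\<lambda>x. SUP m. p x * ?L m x)"
  proof (rule nsum_cong)
    fix x assume "x \<in> A"
    obtain m where m: "v x \<le> real m" using real_arch_simple by blast
    show "p x * kapply A P ?v x = (SUP m. p x * ?L m x)"
    proof (rule antisym)
      show "p x * kapply A P ?v x \<le> (SUP m. p x * ?L m x)"
        using m by (intro SUP_upper2[of m]) auto
      show "(SUP m. p x * ?L m x) \<le> p x * kapply A P ?v x"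
        by (intro SUP_least mult_left_mono) (auto split: split_indicator)
    qed
  qed
  also have "nsum A (\<lambda>x. SUP m. p x * ?L m x) = (SUP m. nsum A (\<lambda>x. p x * ?L m x))"
  proof (rule nn_integral_monotone_convergence_SUP)
    show "incseq (\<lambda>m x. p x * ?L m x)"
      by (auto simp: incseq_def le_fun_def split: split_indicator intro!: mult_left_mono)
  qed auto
  also have "ennreal c * \<dots> = (SUP m. ennreal c * nsum A (\<lambda>x. p x * ?L m x))"
    by (simp add: SUP_mult_left_ennreal)
  also have "\<dots> \<le> ennreal b * nsum A (\<lambda>x. p x * indicator K x)"
    by (rule SUP_least) (rule step)
  finally show ?thesis .
qed

lemma invariant_K_le_1: "nsum A (\<lambda>x. p x * indicator K x) \<le> 1"
proof -
  have "nsum A (\<lambda>x. p x * indicator K x) \<le> nsum A p"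
    by (rule nsum_mono) (auto split: split_indicator)
  then show ?thesis by (simp add: total)
qed

lemma invariant_v_finite: "nsum A (\<lambda>x. p x * ennreal (v x)) \<noteq> \<top>"
proof
  assume "nsum A (\<lambda>x. p x * ennreal (v x)) = \<top>"
  with drift_integrated pos have "\<top> \<le> ennreal b * nsum A (\<lambda>x. p x * indicator K x)"
    by (simp add: ennreal_mult_eq_top_iff)
  also have "\<dots> \<le> ennreal b * 1" by (intro mult_left_mono invariant_K_le_1) simp
  finally show False by (simp add: top_unique)
qed

text \<open>The bound \<open>c p(v) \<le> b p(K)\<close> has a left-hand side of at least 1.\<close>

lemma invariant_K_pos: "nsum A (\<lambda>x. p x * indicator K x) \<noteq> 0"
proof
  assume K: "nsum A (\<lambda>x. p x * indicator K x) = 0"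
  have "1 = nsum A (\<lambda>x. p x * 1)" by (simp add: total)
  also have "\<dots> \<le> nsum A (\<lambda>x. p x * (ennreal c * ennreal (v x)))"
  proof (intro nsum_mono mult_left_mono)
    fix x assume "x \<in> A"
    then show "1 \<le> ennreal c * ennreal (v x)"
      using v_ge[of x] v_nonneg[of x] pos by (simp add: ennreal_mult[symmetric] ennreal_leI flip: ennreal_1)
  qed simp
  also have "\<dots> = ennreal c * nsum A (\<lambda>x. p x * ennreal (v x))"
    by (simp add: mult.left_commute nsum_cmult)
  also have "\<dots> \<le> 0" using drift_integrated by (simp add: K)
  finally show False by simp
qed

text \<open>The kernel that remains after the atom at \<open>y0\<close> has been removed from the rows in \<open>K\<close>:
  the process killed at its first regeneration.\<close>

definition G :: "'a \<Rightarrow> 'a \<Rightarrow> ennreal" where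
  "G x y = P x y - (if x \<in> K \<and> y = y0 then ennreal \<phi> else 0)"

lemma kapply_G:
  assumes "x \<in> A"
  shows "kapply A P f x = kapply A G f x + indicator K x * (ennreal \<phi> * f y0)"
proof -
  have "P x y * f y = G x y * f y + (if y = y0 then indicator K x * (ennreal \<phi> * f y) else 0)" if "y \<in> A" for y
  proof (cases "x \<in> K \<and> y = y0")
    case True
    then have "ennreal \<phi> \<le> P x y" using minorization assms by auto
    then have "G x y + ennreal \<phi> = P x y" using True by (simp add: G_def diff_add_cancel_ennreal)
    then have "P x y * f y = (G x y + ennreal \<phi>) * f y" by simp
    then show ?thesis using True by (simp add: distrib_right)
  next
    case False
    then show ?thesis by (auto simp: G_def)
  qed
  then have "kapply A P f x = nsum A (\<lambda>y. G x y * f y + (if y = y0 then indicator K x * (ennreal \<phi> * f y) else 0))"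
    by (rule nsum_cong)
  then show ?thesis by (simp add: nsum_add nsum_point[OF y0])
qed

lemma kapply_G_le: "x \<in> A \<Longrightarrow> kapply A G f x \<le> kapply A P f x"
  unfolding kapply_G by simp

text \<open>The summand \<open>v\<close> pays for the visits outside \<open>K\<close> and the bounded summand for those in \<open>K\<close>,
  each of which is followed by a regeneration with probability at least \<open>\<phi>\<close>.\<close>

definition u :: "'a \<Rightarrow> real" where
  "u x = v x + b / \<beta> * (1 / \<phi> + indicator (- K) x)"

lemma u_nonneg: "x \<in> A \<Longrightarrow> 0 \<le> u x"
  using v_nonneg pos by (auto simp: u_def intro!: add_nonneg_nonneg mult_nonneg_nonneg)

lemma u_le: "u x \<le> v x + b / \<beta> * (1 / \<phi> + 1)"
  unfolding u_def using pos by (intro add_left_mono mult_left_mono) (auto split: split_indicator)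

lemma supersolution:
  assumes x: "x \<in> A"
  shows "kapply A G (\<lambda>y. ennreal (u y)) x + ennreal (c / \<beta>) * kapply A P (\<lambda>y. ennreal (v y)) x \<le> ennreal (u x)"
proof -
  let ?v = "\<lambda>y. ennreal (v y)"
  have K: "kapply A P (indicator K) x + kapply A P (indicator (- K)) x = 1"
  proof -
    have "kapply A P (\<lambda>y. indicator K y + indicator (- K) y) x = kapply A P (\<lambda>_. 1) x"
      by (rule nsum_cong) (auto split: split_indicator)
    then show ?thesis by (simp only: nsum_distrib_left kapply_one[OF x])
  qed
  then have "kapply A P (indicator K) x \<noteq> \<top>" "kapply A P (indicator (- K)) x \<noteq> \<top>" by auto
  then obtain s r where s: "kapply A P (indicator K) x = ennreal s" "0 \<le> s"
    and r: "kapply A P (indicator (- K)) x = ennreal r" "0 \<le> r"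
    by (metis ennreal_cases)
  have sr: "s + r = 1" using K s r by (metis ennreal_1 ennreal_inj ennreal_plus add_nonneg_nonneg zero_le_one)
  have "kapply A P ?v x \<noteq> \<top>"
  proof
    assume "kapply A P ?v x = \<top>"
    then have "ennreal (\<beta> + c) * kapply A P ?v x = \<top>" using pos by (simp add: ennreal_mult_eq_top_iff)
    with drift[OF x] s show False by (simp add: top_unique ennreal_mult_eq_top_iff)
  qed
  then obtain w where w: "kapply A P ?v x = ennreal w" "0 \<le> w" by (metis ennreal_cases)
  have dr: "(\<beta> + c) * w \<le> \<beta> * v x + b * s"
  proof -
    have "ennreal ((\<beta> + c) * w) \<le> ennreal (\<beta> * v x + b * s)"
      using drift[OF x] s w pos v_nonneg[OF x] by (simp add: ennreal_mult ennreal_plus)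
    then show ?thesis using s w pos v_nonneg[OF x] by (subst (asm) ennreal_le_iff) auto
  qed
  have G1: "kapply A G (\<lambda>_. 1) x + indicator K x * ennreal \<phi> = 1"
    using kapply_G[OF x, of "\<lambda>_. 1"] kapply_one[OF x, of 1] by simp
  then have "kapply A G (\<lambda>_. 1) x \<noteq> \<top>" by auto
  then obtain g where g: "kapply A G (\<lambda>_. 1) x = ennreal g" "0 \<le> g" by (metis ennreal_cases)
  have g1: "g + indicator K x * \<phi> = 1"
  proof -
    have "ennreal (g + indicator K x * \<phi>) = ennreal 1"
      using G1 g pos by (simp add: ennreal_plus ennreal_mult ennreal_indicator)
    then show ?thesis using g pos by (subst (asm) ennreal_inj) auto
  qed
  have "kapply A G (\<lambda>y. ennreal (u y)) x
      = kapply A G (\<lambda>y. ?v y + ennreal (b / \<beta>) * (ennreal (1 / \<phi>) * 1 + indicator (- K) y)) x"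
  proof (rule nsum_cong)
    fix y assume "y \<in> A"
    let ?i = "indicator (- K) y :: real"
    have "0 \<le> b / \<beta>" "0 \<le> 1 / \<phi> + ?i" using pos by auto
    then have "ennreal (u y) = ?v y + ennreal (b / \<beta>) * ennreal (1 / \<phi> + ?i)"
      unfolding u_def using v_nonneg[OF \<open>y \<in> A\<close>]
      by (simp only: ennreal_plus ennreal_mult mult_nonneg_nonneg)
    also have "ennreal (1 / \<phi> + ?i) = ennreal (1 / \<phi>) * 1 + indicator (- K) y"
      using pos by (simp add: ennreal_indicator)
    finally have "ennreal (u y) = ?v y + ennreal (b / \<beta>) * (ennreal (1 / \<phi>) * 1 + indicator (- K) y)" .
    then show "G x y * ennreal (u y) = G x y * (?v y + ennreal (b / \<beta>) * (ennreal (1 / \<phi>) * 1 + indicator (- K) y))"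
      by simp
  qed
  also have "\<dots> = kapply A G ?v x + ennreal (b / \<beta>) * (ennreal (1 / \<phi>) * kapply A G (\<lambda>_. 1) x + kapply A G (indicator (- K)) x)"
    by (simp only: nsum_distrib_left nsum_pull)
  also have "\<dots> \<le> kapply A P ?v x + ennreal (b / \<beta>) * (ennreal (1 / \<phi>) * kapply A G (\<lambda>_. 1) x + kapply A P (indicator (- K)) x)"
    by (intro add_mono mult_left_mono kapply_G_le x order.refl) auto
  also have "\<dots> = ennreal (w + b / \<beta> * (1 / \<phi> * g + r))"
  proof -
    have "0 \<le> 1 / \<phi>" "0 \<le> b / \<beta>" using pos by auto
    then show ?thesis
      using w(2) r(2) g(2)
      by (simp only: w(1) r(1) g(1) ennreal_plus ennreal_mult mult_nonneg_nonneg add_nonneg_nonneg)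
  qed
  finally have Gu: "kapply A G (\<lambda>y. ennreal (u y)) x \<le> ennreal (w + b / \<beta> * (1 / \<phi> * g + r))" .
  have "kapply A G (\<lambda>y. ennreal (u y)) x + ennreal (c / \<beta>) * kapply A P ?v x
      \<le> ennreal (w + b / \<beta> * (1 / \<phi> * g + r)) + ennreal (c / \<beta> * w)"
  proof -
    have "0 \<le> c / \<beta>" using pos by simp
    then have "ennreal (c / \<beta>) * kapply A P ?v x = ennreal (c / \<beta> * w)"
      using w(2) by (simp only: w(1) ennreal_mult)
    with Gu show ?thesis by (simp only: add_right_mono)
  qed
  also have "\<dots> = ennreal (w + b / \<beta> * (1 / \<phi> * g + r) + c / \<beta> * w)"
    using pos w g r by (intro ennreal_plus[symmetric]) auto
  also have "\<dots> \<le> ennreal (u x)"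
  proof (rule ennreal_leI)
    have "(w + b / \<beta> * (1 / \<phi> * g + r) + c / \<beta> * w) = ((\<beta> + c) * w + b * (g / \<phi> + r)) / \<beta>"
      using pos by (simp add: field_simps)
    also have "\<dots> \<le> (\<beta> * v x + b * s + b * (g / \<phi> + r)) / \<beta>"
      using dr pos by (intro divide_right_mono) auto
    also have "g / \<phi> = 1 / \<phi> - indicator K x"
      using g1 pos by (simp add: field_simps)
    also have "(\<beta> * v x + b * s + b * (1 / \<phi> - indicator K x + r)) / \<beta>
        = v x + b / \<beta> * (s + r + 1 / \<phi> - indicator K x)"
      using pos by (simp add: field_simps)
    also have "\<dots> = u x" by (simp add: sr u_def indicator_compl)
    finally show "w + b / \<beta> * (1 / \<phi> * g + r) + c / \<beta> * w \<le> u x" .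
  qed
  finally show ?thesis .
qed

text \<open>The minimal nonnegative solution of \<open>H = G H + P f / \<beta>\<close>: the expected accumulated reward until
  the first regeneration.\<close>

primrec reward_iter :: "('a \<Rightarrow> ennreal) \<Rightarrow> nat \<Rightarrow> 'a \<Rightarrow> ennreal" where
  "reward_iter f 0 x = 0"
| "reward_iter f (Suc n) x = kapply A G (reward_iter f n) x + ennreal (1 / \<beta>) * kapply A P f x"

definition reward :: "('a \<Rightarrow> ennreal) \<Rightarrow> 'a \<Rightarrow> ennreal" where
  "reward f x = (SUP n. reward_iter f n x)"

lemma reward_iter_mono: "reward_iter f n x \<le> reward_iter f (Suc n) x"
proof (induction n arbitrary: x)
  case (Suc n)
  show ?case
    unfolding reward_iter.simps(2)[of f "Suc n"] reward_iter.simps(2)[of f n x]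
    by (intro add_right_mono kapply_mono Suc.IH)
qed simp

lemma reward_fixed_point:
  "reward f x = kapply A G (reward f) x + ennreal (1 / \<beta>) * kapply A P f x"
proof -
  have inc: "incseq (\<lambda>n. reward_iter f n y)" for y
    by (rule incseq_SucI) (rule reward_iter_mono)
  have "kapply A G (reward f) x = nsum A (\<lambda>y. SUP n. G x y * reward_iter f n y)"
    by (simp add: reward_def SUP_mult_left_ennreal)
  also have "\<dots> = (SUP n. kapply A G (reward_iter f n) x)"
  proof (rule nn_integral_monotone_convergence_SUP)
    show "incseq (\<lambda>n y. G x y * reward_iter f n y)"
      using inc by (auto simp: incseq_def le_fun_def intro!: mult_left_mono)
  qed auto
  finally have "kapply A G (reward f) x + ennreal (1 / \<beta>) * kapply A P f x = (SUP n. reward_iter f (Suc n) x)"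
    by (simp add: ennreal_SUP_add_left)
  also have "\<dots> = reward f x"
    unfolding reward_def
  proof (rule antisym)
    show "(SUP n. reward_iter f (Suc n) x) \<le> (SUP n. reward_iter f n x)"
      by (intro SUP_least SUP_upper) simp
    show "(SUP n. reward_iter f n x) \<le> (SUP n. reward_iter f (Suc n) x)"
      by (rule SUP_mono) (use reward_iter_mono in blast)
  qed
  finally show ?thesis ..
qed

lemma reward_le:
  assumes f: "\<And>x. x \<in> A \<Longrightarrow> f x \<le> ennreal (C * (c * v x))" and C: "0 \<le> C" and x: "x \<in> A"
  shows "reward f x \<le> ennreal (C * u x)"
proof -
  have "reward_iter f n x \<le> ennreal (C * u x)" for n
    using x
  proof (induction n arbitrary: x)
    case (Suc n)
    have "kapply A G (reward_iter f n) x \<le> ennreal C * kapply A G (\<lambda>y. ennreal (u y)) x"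
      unfolding nsum_pull[where k = "ennreal C", symmetric]
      using Suc.IH C u_nonneg by (intro kapply_mono) (auto simp: ennreal_mult[symmetric])
    moreover have "kapply A P f x \<le> ennreal (C * c) * kapply A P (\<lambda>y. ennreal (v y)) x"
      unfolding nsum_pull[where k = "ennreal (C * c)", symmetric]
      using f C pos v_nonneg by (intro kapply_mono) (auto simp: ennreal_mult[symmetric] mult.assoc)
    ultimately have "reward_iter f (Suc n) x
        \<le> ennreal C * kapply A G (\<lambda>y. ennreal (u y)) x + ennreal (1 / \<beta>) * (ennreal (C * c) * kapply A P (\<lambda>y. ennreal (v y)) x)"
      unfolding reward_iter.simps by (intro add_mono mult_left_mono) auto
    also have "ennreal (1 / \<beta>) * (ennreal (C * c) * kapply A P (\<lambda>y. ennreal (v y)) x)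
        = ennreal C * (ennreal (c / \<beta>) * kapply A P (\<lambda>y. ennreal (v y)) x)"
      using pos C by (simp add: mult.assoc[symmetric] ennreal_mult[symmetric])
    also have "ennreal C * kapply A G (\<lambda>y. ennreal (u y)) x + \<dots>
        = ennreal C * (kapply A G (\<lambda>y. ennreal (u y)) x + ennreal (c / \<beta>) * kapply A P (\<lambda>y. ennreal (v y)) x)"
      by (simp add: distrib_left)
    also have "\<dots> \<le> ennreal C * ennreal (u x)"
      by (intro mult_left_mono supersolution Suc.prems) simp
    finally show ?case using C u_nonneg[OF Suc.prems] by (simp add: ennreal_mult)
  qed simp
  then show ?thesis unfolding reward_def by (intro SUP_least)
qed

lemma invariant_u_finite: "nsum A (\<lambda>x. p x * ennreal (C * u x)) \<noteq> \<top>" if "0 \<le> C"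
proof -
  let ?k = "b / \<beta> * (1 / \<phi> + 1)"
  have "nsum A (\<lambda>x. p x * ennreal (C * u x)) \<le> nsum A (\<lambda>x. ennreal C * (p x * ennreal (v x)) + ennreal (C * ?k) * p x)"
  proof (rule nsum_mono)
    fix x assume x: "x \<in> A"
    have "ennreal (C * u x) \<le> ennreal (C * (v x + ?k))"
      by (intro ennreal_leI mult_left_mono u_le that)
    also have "\<dots> = ennreal C * ennreal (v x) + ennreal (C * ?k)"
      using that v_nonneg[OF x] pos by (simp add: distrib_left ennreal_mult ennreal_plus)
    finally have "p x * ennreal (C * u x) \<le> p x * (ennreal C * ennreal (v x) + ennreal (C * ?k))"
      by (rule mult_left_mono) simp
    then show "p x * ennreal (C * u x) \<le> ennreal C * (p x * ennreal (v x)) + ennreal (C * ?k) * p x"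
      by (simp add: distrib_left mult_ac)
  qed
  also have "\<dots> = ennreal C * nsum A (\<lambda>x. p x * ennreal (v x)) + ennreal (C * ?k)"
    by (simp add: nsum_add nsum_cmult total)
  also have "\<dots> < \<top>"
    using invariant_v_finite by (simp add: ennreal_mult_less_top less_top)
  finally show ?thesis by simp
qed

text \<open>The cycle formula: the mean reward is the reward per cycle divided by the mean cycle length.\<close>

lemma reward_regeneration:
  assumes f: "\<And>x. x \<in> A \<Longrightarrow> f x \<le> ennreal (C * (c * v x))" and C: "0 \<le> C"
  shows "ennreal \<phi> * nsum A (\<lambda>x. p x * indicator K x) * reward f y0
    = ennreal (1 / \<beta>) * nsum A (\<lambda>x. p x * f x)"
proof -
  let ?H = "reward f"
  have H: "kapply A P ?H x + ennreal (1 / \<beta>) * kapply A P f x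
      = ?H x + indicator K x * (ennreal \<phi> * ?H y0)" if "x \<in> A" for x
    using reward_fixed_point[of f x] kapply_G[OF that, of ?H] by (simp add: ac_simps)
  have "nsum A (\<lambda>x. p x * ?H x) + ennreal (1 / \<beta>) * nsum A (\<lambda>x. p x * f x)
      = nsum A (\<lambda>x. p x * (kapply A P ?H x + ennreal (1 / \<beta>) * kapply A P f x))"
    by (simp only: distrib_left nsum_add nsum_pull invariant_apply)
  also have "\<dots> = nsum A (\<lambda>x. p x * (?H x + indicator K x * (ennreal \<phi> * ?H y0)))"
    by (rule nsum_cong) (simp only: H)
  also have "\<dots> = nsum A (\<lambda>x. p x * ?H x) + nsum A (\<lambda>x. p x * indicator K x) * (ennreal \<phi> * ?H y0)"
    by (simp add: distrib_left nsum_add nsum_multc mult.assoc[symmetric])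
  finally have "nsum A (\<lambda>x. p x * ?H x) + ennreal (1 / \<beta>) * nsum A (\<lambda>x. p x * f x) = \<dots>" .
  moreover have "nsum A (\<lambda>x. p x * ?H x) \<le> nsum A (\<lambda>x. p x * ennreal (C * u x))"
    using reward_le[OF f C] by (intro nsum_mono mult_left_mono) auto
  then have "nsum A (\<lambda>x. p x * ?H x) \<noteq> \<top>"
    using invariant_u_finite[OF C] by (auto simp: top_unique)
  ultimately show ?thesis by (simp add: ennreal_add_left_cancel mult_ac)
qed

lemma reward_atom_eq:
  assumes f: "\<And>x. x \<in> A \<Longrightarrow> f x \<le> ennreal (C * (c * v x))" "\<And>x. x \<in> A \<Longrightarrow> g x \<le> ennreal (C * (c * v x))"
    and C: "0 \<le> C" and eq: "nsum A (\<lambda>x. p x * f x) = nsum A (\<lambda>x. p x * g x)"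
  shows "reward f y0 = reward g y0"
proof -
  have "ennreal \<phi> * nsum A (\<lambda>x. p x * indicator K x) * reward f y0
      = ennreal \<phi> * nsum A (\<lambda>x. p x * indicator K x) * reward g y0"
    by (simp only: reward_regeneration[OF f(1) C] reward_regeneration[OF f(2) C] eq)
  moreover have "ennreal \<phi> * nsum A (\<lambda>x. p x * indicator K x) \<noteq> 0"
    using pos invariant_K_pos by simp
  moreover have "ennreal \<phi> * nsum A (\<lambda>x. p x * indicator K x) \<noteq> \<top>"
    using invariant_K_le_1 by (auto simp: ennreal_mult_eq_top_iff top_unique)
  ultimately show ?thesis by (simp add: ennreal_mult_cancel_left)
qed

text \<open>The regenerated reward \<open>J = H + \<phi> H(y0) 1\<^sub>K\<close> equals \<open>P (H + f / \<beta>)\<close>.  It lies in the range of the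
  resolvent, and therefore the generator can be applied to it: the backward equation gives
  \<open>(\<beta> - Q) J = \<beta> H + f\<close>.\<close>

lemma reward_generator:
  fixes q :: "'a \<Rightarrow> 'a \<Rightarrow> real"
  assumes q: "\<And>x y. x \<in> A \<Longrightarrow> y \<in> A \<Longrightarrow> y \<noteq> x \<Longrightarrow> 0 \<le> q x y" "\<And>x. x \<in> A \<Longrightarrow> q x x \<le> 0"
    and backward: "\<And>x y. x \<in> A \<Longrightarrow> y \<in> A \<Longrightarrow> ennreal (\<beta> - q x x) * P x y
      = ennreal \<beta> * (if x = y then 1 else 0) + nsum A (\<lambda>z. (if z = x then 0 else ennreal (q x z)) * P z y)"
    and f: "\<And>x. x \<in> A \<Longrightarrow> 0 \<le> f x" "\<And>x. x \<in> A \<Longrightarrow> f x \<le> C * (c * v x)" and C: "0 \<le> C"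
    and x: "x \<in> A"
  defines "H \<equiv> \<lambda>x. enn2real (reward (\<lambda>y. ennreal (f y)) x)"
  shows "((\<lambda>z. q x z * (H z + indicator K z * (\<phi> * H y0))) has_sum (\<beta> * (indicator K x * (\<phi> * H y0)) - f x)) A"
proof -
  let ?f = "\<lambda>y. ennreal (f y)"
  let ?qo = "\<lambda>z. if z = x then 0 else ennreal (q x z)"
  let ?J = "\<lambda>z. H z + indicator K z * (\<phi> * H y0)"
  have f': "?f y \<le> ennreal (C * (c * v y))" if "y \<in> A" for y
    by (intro ennreal_leI f that)
  have H: "reward ?f y = ennreal (H y)" "0 \<le> H y" if "y \<in> A" for y
  proof -
    have "reward ?f y < \<top>" using reward_le[OF f' C that] by (rule le_less_trans) simp_all
    then show "reward ?f y = ennreal (H y)" by (simp add: H_def)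
    show "0 \<le> H y" by (simp add: H_def)
  qed
  have J0: "0 \<le> ?J y" if "y \<in> A" for y
    using H(2)[OF that] H(2)[OF y0] pos by (auto intro!: add_nonneg_nonneg mult_nonneg_nonneg)
  let ?g = "\<lambda>y. reward ?f y + ennreal (1 / \<beta>) * ?f y"
  have Pg: "kapply A P ?g y = ennreal (?J y)" if y: "y \<in> A" for y
  proof -
    have "kapply A P ?g y = kapply A P (reward ?f) y + ennreal (1 / \<beta>) * kapply A P ?f y"
      by (simp only: nsum_distrib_left nsum_pull)
    also have "\<dots> = reward ?f y + indicator K y * (ennreal \<phi> * reward ?f y0)"
      using reward_fixed_point[of ?f y] kapply_G[OF y, of "reward ?f"] by (simp add: ac_simps)
    also have "\<dots> = ennreal (?J y)"
      using H[OF y] H[OF y0] pos by (auto simp: ennreal_mult split: split_indicator)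
    finally show ?thesis .
  qed
  have "ennreal (\<beta> - q x x) * kapply A P ?g x = nsum A (\<lambda>y. (ennreal (\<beta> - q x x) * P x y) * ?g y)"
    by (simp add: nsum_cmult[symmetric] mult.assoc)
  also have "\<dots> = nsum A (\<lambda>y. (if y = x then ennreal \<beta> * ?g y else 0) + nsum A (\<lambda>z. ?qo z * P z y * ?g y))"
    by (rule nsum_cong) (simp add: backward[OF x] distrib_right nsum_multc)
  also have "\<dots> = ennreal \<beta> * ?g x + nsum A (\<lambda>y. nsum A (\<lambda>z. ?qo z * P z y * ?g y))"
    by (subst nsum_add) (simp only: nsum_point[OF x])
  also have "nsum A (\<lambda>y. nsum A (\<lambda>z. ?qo z * P z y * ?g y)) = nsum A (\<lambda>z. nsum A (\<lambda>y. ?qo z * P z y * ?g y))"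
    by (rule nsum_swap[OF countable])
  also have "\<dots> = nsum A (\<lambda>z. ?qo z * kapply A P ?g z)"
    by (rule nsum_cong) (simp only: mult.assoc nsum_cmult)
  also have "\<dots> = nsum A (\<lambda>z. ennreal ((if z = x then 0 else q x z) * ?J z))"
    using q(1)[OF x] J0 by (intro nsum_cong) (auto simp: Pg ennreal_mult)
  finally have eq: "ennreal (\<beta> - q x x) * ennreal (?J x)
      = ennreal \<beta> * ?g x + nsum A (\<lambda>z. ennreal ((if z = x then 0 else q x z) * ?J z))"
    by (simp only: Pg[OF x])
  \<comment> \<open>The sum of the off-diagonal terms, to be identified by cancelling \<open>\<beta> H x + f x\<close> in the equation above.\<close>
  define s where "s = (\<beta> - q x x) * ?J x - (\<beta> * H x + f x)"
  have lhs: "ennreal (\<beta> - q x x) * ennreal (?J x) = ennreal ((\<beta> - q x x) * ?J x)"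
    using q(2)[OF x] pos J0[OF x] by (intro ennreal_mult[symmetric]) auto
  have g: "ennreal \<beta> * ?g x = ennreal (\<beta> * H x + f x)"
    using H[OF x] f(1)[OF x] pos by (simp add: distrib_left ennreal_mult[symmetric])
  have nn: "0 \<le> \<beta> * H x + f x" using H[OF x] f(1)[OF x] pos by simp
  note eq = eq[unfolded lhs g]
  have "ennreal (\<beta> * H x + f x) \<le> ennreal ((\<beta> - q x x) * ?J x)"
    unfolding eq by (rule add_increasing2) simp_all
  then have s0: "0 \<le> s"
    using q(2)[OF x] pos J0[OF x] nn unfolding s_def by (subst (asm) ennreal_le_iff) auto
  have "ennreal (\<beta> * H x + f x) + ennreal s = ennreal ((\<beta> * H x + f x) + s)"
    using s0 nn by (rule ennreal_plus[symmetric, rotated])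
  also have "(\<beta> * H x + f x) + s = (\<beta> - q x x) * ?J x"
    by (simp add: s_def)
  finally have "ennreal (\<beta> * H x + f x) + ennreal s
      = ennreal (\<beta> * H x + f x) + nsum A (\<lambda>z. ennreal ((if z = x then 0 else q x z) * ?J z))"
    unfolding eq .
  then have "nsum A (\<lambda>z. ennreal ((if z = x then 0 else q x z) * ?J z)) = ennreal s"
    by (simp only: ennreal_add_left_cancel) simp
  then have "((\<lambda>z. (if z = x then 0 else q x z) * ?J z) has_sum s) A"
    by (intro nsum_imp_has_sum countable s0) (use q(1)[OF x] J0 in auto)
  moreover have "((\<lambda>z. if z = x then q x x * ?J x else 0) has_sum (q x x * ?J x)) A"
    using x by (intro has_sum_finite_neutralI[of "{x}"]) auto
  ultimately have "((\<lambda>z. (if z = x then 0 else q x z) * ?J z + (if z = x then q x x * ?J x else 0))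
      has_sum (s + q x x * ?J x)) A"
    by (rule has_sum_add)
  moreover have "(if z = x then 0 else q x z) * ?J z + (if z = x then q x x * ?J x else 0) = q x z * ?J z" for z
    by simp
  moreover have "s + q x x * ?J x = \<beta> * (indicator K x * (\<phi> * H y0)) - f x"
    by (simp add: s_def algebra_simps)
  ultimately show ?thesis by simp
qed

text \<open>The rewards of the positive and of the negative part of \<open>f\<close> have the same value at \<open>y0\<close> by the cycle
  formula.  Hence the two regenerated rewards differ from the rewards by the same function, and their
  difference \<open>h\<close> satisfies \<open>(\<beta> - Q) h = \<beta> h + f\<close>.\<close>

theorem poisson_equation:
  fixes q :: "'a \<Rightarrow> 'a \<Rightarrow> real"
  assumes q: "\<And>x y. x \<in> A \<Longrightarrow> y \<in> A \<Longrightarrow> y \<noteq> x \<Longrightarrow> 0 \<le> q x y" "\<And>x. x \<in> A \<Longrightarrow> q x x \<le> 0"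
    and backward: "\<And>x y. x \<in> A \<Longrightarrow> y \<in> A \<Longrightarrow> ennreal (\<beta> - q x x) * P x y
      = ennreal \<beta> * (if x = y then 1 else 0) + nsum A (\<lambda>z. (if z = x then 0 else ennreal (q x z)) * P z y)"
    and f: "\<And>x. x \<in> A \<Longrightarrow> \<bar>f x\<bar> \<le> C * (c * v x)" and C: "0 \<le> C"
    and centred: "nsum A (\<lambda>x. p x * ennreal (f x)) = nsum A (\<lambda>x. p x * ennreal (- f x))"
  obtains h where "\<And>x. x \<in> A \<Longrightarrow> \<bar>h x\<bar> \<le> C * u x"
    and "\<And>x. x \<in> A \<Longrightarrow> ((\<lambda>z. q x z * h z) has_sum (- f x)) A"
proof
  let ?f1 = "\<lambda>x. max 0 (f x)" and ?f2 = "\<lambda>x. max 0 (- f x)"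
  let ?H1 = "\<lambda>x. enn2real (reward (\<lambda>y. ennreal (?f1 y)) x)"
  let ?H2 = "\<lambda>x. enn2real (reward (\<lambda>y. ennreal (?f2 y)) x)"
  have pos_neg: "ennreal (max 0 r) = ennreal r" for r by (simp add: max_def ennreal_neg)
  have bound: "?f1 x \<le> C * (c * v x)" "?f2 x \<le> C * (c * v x)" if "x \<in> A" for x
    using f[OF that] by auto
  have bound': "ennreal (?f1 x) \<le> ennreal (C * (c * v x))" "ennreal (?f2 x) \<le> ennreal (C * (c * v x))" if "x \<in> A" for x
    using bound[OF that] by (auto intro: ennreal_leI)
  have atom: "?H1 y0 = ?H2 y0"
    by (subst reward_atom_eq[OF bound' C]) (simp_all add: pos_neg centred)
  show "\<bar>?H1 x - ?H2 x\<bar> \<le> C * u x" if x: "x \<in> A" for x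
  proof -
    have Cu: "0 \<le> C * u x" using C u_nonneg[OF x] by simp
    have "0 \<le> ?H1 x" "0 \<le> ?H2 x" by simp_all
    moreover have "?H1 x \<le> C * u x" "?H2 x \<le> C * u x"
      using reward_le[OF bound'(1) C x] reward_le[OF bound'(2) C x] Cu by (auto intro: enn2real_leI)
    ultimately show ?thesis by linarith
  qed
  show "((\<lambda>z. q x z * (?H1 z - ?H2 z)) has_sum (- f x)) A" if x: "x \<in> A" for x
  proof -
    let ?J1 = "\<lambda>z. ?H1 z + indicator K z * (\<phi> * ?H1 y0)"
    let ?J2 = "\<lambda>z. ?H2 z + indicator K z * (\<phi> * ?H2 y0)"
    have "((\<lambda>z. q x z * ?J1 z) has_sum (\<beta> * (indicator K x * (\<phi> * ?H1 y0)) - ?f1 x)) A"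
      by (rule reward_generator[OF q backward _ bound(1) C x]) auto
    moreover have "((\<lambda>z. q x z * ?J2 z) has_sum (\<beta> * (indicator K x * (\<phi> * ?H2 y0)) - ?f2 x)) A"
      by (rule reward_generator[OF q backward _ bound(2) C x]) auto
    ultimately have "((\<lambda>z. q x z * ?J1 z + - (q x z * ?J2 z)) has_sum
        ((\<beta> * (indicator K x * (\<phi> * ?H1 y0)) - ?f1 x) + - (\<beta> * (indicator K x * (\<phi> * ?H2 y0)) - ?f2 x))) A"
      by (intro has_sum_add has_sum_uminusI)
    moreover have "q x z * ?J1 z + - (q x z * ?J2 z) = q x z * (?H1 z - ?H2 z)" for z
      unfolding atom by (simp add: algebra_simps)
    moreover have "(\<beta> * (indicator K x * (\<phi> * ?H1 y0)) - ?f1 x) + - (\<beta> * (indicator K x * (\<phi> * ?H2 y0)) - ?f2 x) = - f x"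
      unfolding atom by simp
    ultimately show ?thesis by simp
  qed
qed

end

section \<open>The block-augmented truncation\<close>

lemma states_upto_incseq: "incseq (states_upto S)"
  by (auto simp: incseq_def states_upto_def)

lemma finite_states_upto: "finite (states_upto S n)"
proof -
  have "states_upto S n \<subseteq> (SIGMA k:{..n}. {..S k})" by (auto simp: states_upto_def)
  then show ?thesis by (rule finite_subset) auto
qed

lemma UN_states_upto: "(\<Union>n. states_upto S n) = states S"
  by (auto simp: states_upto_def states_def)

lemma states_upto_subset: "states_upto S n \<subseteq> states S"
  by (auto simp: states_upto_def states_def)

lemma states_upto_mono: "k \<le> n \<Longrightarrow> states_upto S k \<subseteq> states_upto S n"
  by (auto simp: states_upto_def)

lemma phases_eq: "\<forall>k\<ge>1. S k = S 1 \<Longrightarrow> 1 \<le> m \<Longrightarrow> S m = S (1::nat)"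
  by blast

lemma upper_states_eq:
  assumes "\<forall>k\<ge>1. S k = S 1" "n \<ge> 1"
  shows "states S - states_upto S n = {n<..} \<times> {..S 1}"
proof -
  have S: "S m = S 1" if "n < m" for m
  proof -
    have "m \<ge> 1" using that assms(2) by simp
    then show ?thesis by (rule phases_eq[OF assms(1)])
  qed
  show ?thesis
  proof (intro set_eqI iffI)
    fix y assume "y \<in> states S - states_upto S n"
    moreover obtain m j where "y = (m, j)" by (cases y)
    ultimately have "y = (m, j)" "n < m" "j \<le> S m" by (auto simp: states_def states_upto_def)
    then show "y \<in> {n<..} \<times> {..S 1}" using S[of m] by simp
  next
    fix y assume "y \<in> {n<..} \<times> {..S 1}"
    then obtain m j where "y = (m, j)" "n < m" "j \<le> S 1" by auto
    then show "y \<in> states S - states_upto S n" using S[of m] by (simp add: states_def states_upto_def)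
  qed
qed

lemma upward_rate_nonneg:
  assumes Q: "conservative_q_matrix (states S) Q"
    and x: "x \<in> states_upto S n" and y: "y \<in> states S - states_upto S n"
  shows "0 \<le> Q x y"
proof -
  have "x \<in> states S" "y \<in> states S" "y \<noteq> x" using x y states_upto_subset by auto
  then show ?thesis using Q unfolding conservative_q_matrix_def by blast
qed

text \<open>The truncation sends every transition into a level above \<open>n\<close> to the same phase of level \<open>n\<close>.\<close>

definition level_cap :: "nat \<Rightarrow> state \<Rightarrow> state" where
  "level_cap n = (\<lambda>(m, j). (min m n, j))"

lemma level_cap_id: "y \<in> states_upto S n \<Longrightarrow> level_cap n y = y"
  by (auto simp: level_cap_def states_upto_def)

lemma level_cap_in:
  assumes "\<forall>k\<ge>1. S k = S 1" "n \<ge> 1" "y \<in> states S"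
  shows "level_cap n y \<in> states_upto S n"
proof (cases y)
  case (Pair m j)
  have y: "j \<le> S m" using assms(3) by (simp add: Pair states_def)
  show ?thesis
  proof (cases "m \<le> n")
    case True
    then show ?thesis using y by (simp add: Pair level_cap_def states_upto_def)
  next
    case False
    then have "m \<ge> 1" using assms(2) by simp
    then have "S m = S n" using phases_eq[OF assms(1)] assms(2) by metis
    then show ?thesis using False y by (simp add: Pair level_cap_def states_upto_def)
  qed
qed

text \<open>An entry of the truncation collects the rates into all states that are capped to its column.\<close>

lemma LC_truncation_fiber:
  assumes phases: "\<forall>k\<ge>1. S k = S 1" and n: "n \<ge> 1"
    and Q: "conservative_q_matrix (states S) Q"
    and x: "x \<in> states_upto S n" and y: "y \<in> states_upto S n"
  shows "(Q x has_sum LC_truncation n Q x y) {z \<in> states S. level_cap n z = y}"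
proof -
  obtain k i l j where xy: "x = (k, i)" "y = (l, j)" by (metis surj_pair)
  have k: "k \<le> n" and l: "l \<le> n" "j \<le> S l" using x y by (auto simp: xy states_upto_def)
  show ?thesis
  proof (cases "l < n")
    case True
    then have "{z \<in> states S. level_cap n z = y} = {y}"
      using l by (auto simp: xy level_cap_def states_def min_def split: if_splits)
    moreover have "(Q x has_sum Q x y) {y}"
      by (rule has_sum_finiteI) simp_all
    ultimately show ?thesis using True by (simp add: xy LC_truncation_def)
  next
    case False
    then have ln: "l = n" using l by simp
    have S: "S m = S n" if "m \<ge> n" for m
      using phases_eq[OF phases n] phases_eq[OF phases order.trans[OF n that]] by simp
    have fib: "{z \<in> states S. level_cap n z = y} = insert (n, j) ((\<lambda>m. (m, j)) ` {n<..})"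
    proof (intro set_eqI iffI)
      fix z assume "z \<in> {z \<in> states S. level_cap n z = y}"
      then show "z \<in> insert (n, j) ((\<lambda>m. (m, j)) ` {n<..})"
        by (cases z) (auto simp: xy ln level_cap_def min_def split: if_splits)
    next
      fix z assume "z \<in> insert (n, j) ((\<lambda>m. (m, j)) ` {n<..})"
      then obtain m where "z = (m, j)" "m \<ge> n" by auto
      then show "z \<in> {z \<in> states S. level_cap n z = y}"
        using l S[of m] by (simp add: xy ln level_cap_def states_def)
    qed
    have "Q x summable_on states S"
      using Q x states_upto_subset by (fastforce simp: conservative_q_matrix_def summable_on_def)
    moreover have "(\<lambda>m. (m, j)) ` {n<..} \<subseteq> states S"
      using fib by blast
    ultimately have "Q x summable_on ((\<lambda>m. (m, j)) ` {n<..})"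
      by (rule summable_on_subset_banach)
    then have "(\<lambda>m. Q x (m, j)) summable_on {n<..}"
      by (subst (asm) summable_on_reindex) (auto simp: inj_on_def o_def)
    then have "((\<lambda>m. Q x (m, j)) has_sum (\<Sum>\<^sub>\<infinity>m\<in>{n<..}. Q x (m, j))) {n<..}" by simp
    then have "(Q x has_sum (\<Sum>\<^sub>\<infinity>m\<in>{n<..}. Q x (m, j))) ((\<lambda>m. (m, j)) ` {n<..})"
      by (subst has_sum_reindex) (auto simp: inj_on_def o_def)
    then have "(Q x has_sum (Q x (n, j) + (\<Sum>\<^sub>\<infinity>m\<in>{n<..}. Q x (m, j)))) (insert (n, j) ((\<lambda>m. (m, j)) ` {n<..}))"
      by (intro has_sum_insert) auto
    moreover have "{n<..} - {k} = {n<..}" using k by auto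
    ultimately show ?thesis unfolding fib by (simp add: xy ln LC_truncation_def)
  qed
qed

lemma LC_truncation_apply:
  assumes phases: "\<forall>k\<ge>1. S k = S 1" and n: "n \<ge> 1"
    and Q: "conservative_q_matrix (states S) Q"
    and x: "x \<in> states_upto S n"
  shows "((\<lambda>z. Q x z * h (level_cap n z)) has_sum (\<Sum>y\<in>states_upto S n. LC_truncation n Q x y * h y)) (states S)"
proof -
  let ?B = "\<lambda>y. {z \<in> states S. level_cap n z = y}"
  have "((\<lambda>z. Q x z * h (level_cap n z)) has_sum (\<Sum>y\<in>states_upto S n. LC_truncation n Q x y * h y))
      (\<Union>y\<in>states_upto S n. ?B y)"
  proof (rule sum_has_sum[OF finite_states_upto])
    fix y assume y: "y \<in> states_upto S n"
    have "((\<lambda>z. Q x z * h y) has_sum (LC_truncation n Q x y * h y)) (?B y)"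
      by (intro has_sum_cmult_left LC_truncation_fiber[OF phases n Q x y])
    then show "((\<lambda>z. Q x z * h (level_cap n z)) has_sum (LC_truncation n Q x y * h y)) (?B y)"
      by (rule has_sum_cong[THEN iffD1, rotated]) auto
  qed auto
  moreover have "(\<Union>y\<in>states_upto S n. ?B y) = states S"
    using level_cap_in[OF phases n] by auto
  ultimately show ?thesis by simp
qed

text \<open>Above level \<open>n\<close> the truncation is block diagonal, so the phases of such a level that are charged
  by a stationary distribution form a closed class of \<open>Q\<close> itself.\<close>

lemma truncation_stationary_support:
  assumes chain: "regular_jump_markov_chain (states S) M X"
    and gen: "is_generator (states S) M X Q"
    and Q: "conservative_q_matrix (states S) Q"
    and irred: "irreducible_chain (states S) M X"
    and stat: "stationary_distribution (states S) (LC_truncation n Q) p"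
    and x: "x \<in> states S - states_upto S n"
  shows "p x = 0"
proof (rule ccontr)
  assume px: "p x \<noteq> 0"
  obtain l i0 where x_eq: "x = (l, i0)" by (metis surj_pair)
  define B where "B = {l} \<times> {..S l}"
  define C where "C = {y \<in> B. p y > 0}"
  have B: "finite B" "B \<subseteq> states S" by (auto simp: B_def states_def)
  have l: "n < l" and xB: "x \<in> B" using x by (auto simp: x_eq B_def states_def states_upto_def)
  have p: "\<And>y. y \<in> states S \<Longrightarrow> 0 \<le> p y" using stat by (auto simp: stationary_distribution_def)
  have xC: "x \<in> C" using p[of x] px x xB by (auto simp: C_def)
  have off: "\<And>y z. y \<in> states S \<Longrightarrow> z \<in> states S \<Longrightarrow> z \<noteq> y \<Longrightarrow> 0 \<le> Q y z"
    using Q by (auto simp: conservative_q_matrix_def)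
  have col: "(\<Sum>z\<in>B. p z * Q z y) = 0" if y: "y \<in> B" for y
  proof -
    have "((\<lambda>z. p z * LC_truncation n Q z y) has_sum 0) (states S)"
      using stat y B by (auto simp: stationary_distribution_def)
    moreover have "((\<lambda>z. p z * LC_truncation n Q z y) has_sum (\<Sum>z\<in>B. p z * Q z y)) (states S)"
    proof (rule has_sum_finite_neutralI[OF B])
      show "(\<Sum>z\<in>B. p z * Q z y) = (\<Sum>z\<in>B. p z * LC_truncation n Q z y)"
        using y l by (intro sum.cong) (auto simp: B_def LC_truncation_def)
      show "p z * LC_truncation n Q z y = 0" if "z \<in> states S - B" for z
        using that y l by (cases z) (auto simp: B_def LC_truncation_def states_def split: if_splits)
    qed
    ultimately show ?thesis by (metis has_sum_unique)
  qed
  have closed: "Q w z = 0" if w: "w \<in> C" and z: "z \<in> states S - C" for w z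
  proof (cases "z \<in> B")
    case True
    then have "\<not> p z > 0" using z by (simp add: C_def)
    then have pz: "p z = 0" using p[of z] z by simp
    have "p w * Q w z = 0"
    proof (rule sum_nonneg_0[OF B(1) _ col[OF True]])
      show "0 \<le> p y * Q y z" if "y \<in> B" for y
        using that off[of y z] p[of y] B z pz by (cases "y = z") auto
    qed (use w in \<open>auto simp: C_def\<close>)
    then show ?thesis using w by (auto simp: C_def)
  next
    case False
    have row: "(\<Sum>z\<in>B. Q y z) \<le> 0" if "y \<in> B" for y
      using conservative_imp_sub_q_matrix[OF Q B] that by (auto simp: sub_q_matrix_def)
    have "(\<Sum>y\<in>B. p y * (\<Sum>z\<in>B. Q y z)) = (\<Sum>z\<in>B. \<Sum>y\<in>B. p y * Q y z)"
      unfolding sum_distrib_left by (rule sum.swap)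
    then have tot: "(\<Sum>y\<in>B. - (p y * (\<Sum>z\<in>B. Q y z))) = 0" using col by (simp add: sum_negf)
    have "- (p w * (\<Sum>z\<in>B. Q w z)) = 0"
    proof (rule sum_nonneg_0[OF B(1) _ tot])
      show "0 \<le> - (p y * (\<Sum>z\<in>B. Q y z))" if "y \<in> B" for y
        using row[OF that] p[of y] that B by (auto simp: mult_nonneg_nonpos)
    qed (use w in \<open>auto simp: C_def\<close>)
    then have row0: "(\<Sum>z\<in>B. Q w z) = 0" using w by (auto simp: C_def)
    have wA: "w \<in> states S" and wB: "w \<in> B" using w B by (auto simp: C_def)
    have "(Q w has_sum 0) (states S)" using Q wA by (auto simp: conservative_q_matrix_def)
    moreover have "(Q w has_sum (\<Sum>z\<in>B. Q w z)) B" using B by simp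
    ultimately have "(Q w has_sum (0 - 0)) (states S - B)"
      using B(2) row0 by (intro has_sum_Diff) auto
    then show ?thesis
      using nonneg_has_sum_le_0D[of "Q w" "states S - B" 0 z] off[OF wA] wB z False by auto
  qed
  \<comment> \<open>Level 0 lies below the level of \<open>C\<close>, so the closed class is not everything.\<close>
  have y: "(0, 0) \<in> states S - C" using l by (auto simp: states_def C_def B_def)
  obtain t where "t > 0" "transition M X t x (0, 0) > 0"
    using irred x y by (auto simp: irreducible_chain_def)
  moreover have "transition M X t x (0, 0) = 0" if "t > 0" for t
    by (rule transition_eq_0_of_closed[OF chain gen states_upto_incseq finite_states_upto UN_states_upto closed xC _ y that])
       (use x in auto)
  ultimately show False by force
qed

text \<open>A stationary vector with finite support, so that all sums over it are finite and can be exchanged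
  with any function \<open>h\<close>.\<close>

lemma truncation_stationary_sums:
  assumes stat: "stationary_distribution (states S) (LC_truncation n Q) p"
    and supp: "\<And>x. x \<in> states S - states_upto S n \<Longrightarrow> p x = 0"
  shows "(\<Sum>x\<in>states_upto S n. p x) = 1"
    and "(\<Sum>x\<in>states_upto S n. p x * (\<Sum>y\<in>states_upto S n. LC_truncation n Q x y * h y)) = 0"
proof -
  let ?F = "states_upto S n"
  have sum: "(\<Sum>x\<in>?F. p x * g x) = r" if "((\<lambda>x. p x * g x) has_sum r) (states S)" for g r
  proof -
    have "((\<lambda>x. p x * g x) has_sum (\<Sum>x\<in>?F. p x * g x)) (states S)"
      by (rule has_sum_finite_neutralI[OF finite_states_upto states_upto_subset]) (use supp in auto)
    with that show ?thesis by (metis has_sum_unique)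
  qed
  show "(\<Sum>x\<in>?F. p x) = 1"
    using sum[of "\<lambda>_. 1" 1] stat by (simp add: stationary_distribution_def)
  have col: "(\<Sum>x\<in>?F. p x * LC_truncation n Q x y) = 0" if "y \<in> ?F" for y
  proof (rule sum)
    have "y \<in> states S" using that states_upto_subset by blast
    then show "((\<lambda>x. p x * LC_truncation n Q x y) has_sum 0) (states S)"
      using stat unfolding stationary_distribution_def by blast
  qed
  have "(\<Sum>x\<in>?F. p x * (\<Sum>y\<in>?F. LC_truncation n Q x y * h y))
      = (\<Sum>y\<in>?F. (\<Sum>x\<in>?F. p x * LC_truncation n Q x y) * h y)"
    unfolding sum_distrib_left sum_distrib_right mult.assoc by (rule sum.swap)
  also have "\<dots> = 0" by (simp add: col)
  finally show "(\<Sum>x\<in>?F. p x * (\<Sum>y\<in>?F. LC_truncation n Q x y * h y)) = 0" .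
qed

text \<open>If the right-hand side is finite, the family is absolutely summable and this is the triangle
  inequality.\<close>

lemma ennreal_abs_has_sum_le:
  fixes f :: "'a \<Rightarrow> real"
  assumes "countable B" "(f has_sum s) B"
  shows "ennreal \<bar>s\<bar> \<le> nsum B (\<lambda>y. ennreal \<bar>f y\<bar>)"
proof (cases "nsum B (\<lambda>y. ennreal \<bar>f y\<bar>)")
  case (real r)
  have "((\<lambda>y. \<bar>f y\<bar>) has_sum r) B"
    by (rule nsum_imp_has_sum) (use assms(1) real in auto)
  then have "\<bar>s\<bar> \<le> r"
    using norm_has_sum_bound[of f B r s] assms(2) by simp
  then show ?thesis using real by (simp add: ennreal_leI)
qed simp

text \<open>For a stationary vector of the truncation, the mean of \<open>Q h\<close> is the mean of \<open>(Q - Q\<^sub>n) h\<close>, in which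
  only the redirected transitions survive.\<close>

lemma truncation_mean_generator:
  assumes phases: "\<forall>k\<ge>1. S k = S 1" and n: "n \<ge> 1"
    and Q: "conservative_q_matrix (states S) Q"
    and stat: "stationary_distribution (states S) (LC_truncation n Q) p"
    and supp: "\<And>x. x \<in> states S - states_upto S n \<Longrightarrow> p x = 0"
    and h: "\<And>x. x \<in> states_upto S n \<Longrightarrow> ((\<lambda>z. Q x z * h z) has_sum g x) (states S)"
  shows "ennreal \<bar>\<Sum>x\<in>states_upto S n. p x * g x\<bar>
    \<le> (\<Sum>x\<in>states_upto S n. ennreal (p x) *
        nsum (states S - states_upto S n) (\<lambda>y. ennreal (Q x y * (\<bar>h y\<bar> + \<bar>h (level_cap n y)\<bar>))))"
proof -
  let ?F = "states_upto S n" and ?A = "states S"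
  define d where "d x = g x - (\<Sum>y\<in>?F. LC_truncation n Q x y * h y)" for x
  have p: "0 \<le> p x" if "x \<in> ?F" for x
    using stat that states_upto_subset by (auto simp: stationary_distribution_def)
  have d: "((\<lambda>z. Q x z * (h z - h (level_cap n z))) has_sum d x) (?A - ?F)" if x: "x \<in> ?F" for x
  proof -
    have "((\<lambda>z. Q x z * h z - Q x z * h (level_cap n z)) has_sum d x) ?A"
      unfolding d_def diff_conv_add_uminus
      by (intro has_sum_add has_sum_uminusI h x LC_truncation_apply[OF phases n Q])
    then show ?thesis
    proof (rule has_sum_cong_neutral[THEN iffD1, rotated -1])
    qed (use level_cap_id states_upto_subset in \<open>auto simp: algebra_simps\<close>)
  qed
  have "(\<Sum>x\<in>?F. p x * g x) = (\<Sum>x\<in>?F. p x * d x)"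
    using truncation_stationary_sums(2)[OF stat supp, of h]
    by (simp add: d_def right_diff_distrib sum_subtractf)
  then have "\<bar>\<Sum>x\<in>?F. p x * g x\<bar> \<le> (\<Sum>x\<in>?F. p x * \<bar>d x\<bar>)"
    using sum_abs[of "\<lambda>x. p x * d x" ?F] p by (simp add: abs_mult)
  then have "ennreal \<bar>\<Sum>x\<in>?F. p x * g x\<bar> \<le> ennreal (\<Sum>x\<in>?F. p x * \<bar>d x\<bar>)"
    by (rule ennreal_leI)
  also have "\<dots> = (\<Sum>x\<in>?F. ennreal (p x) * ennreal \<bar>d x\<bar>)"
    using p by (simp add: sum_ennreal[symmetric] ennreal_mult)
  also have "\<dots> \<le> (\<Sum>x\<in>?F. ennreal (p x) *
        nsum (?A - ?F) (\<lambda>y. ennreal (Q x y * (\<bar>h y\<bar> + \<bar>h (level_cap n y)\<bar>))))"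
  proof (intro sum_mono mult_left_mono)
    fix x assume x: "x \<in> ?F"
    have "ennreal \<bar>d x\<bar> \<le> nsum (?A - ?F) (\<lambda>z. ennreal \<bar>Q x z * (h z - h (level_cap n z))\<bar>)"
      by (rule ennreal_abs_has_sum_le[OF _ d[OF x]]) simp
    also have "\<dots> \<le> nsum (?A - ?F) (\<lambda>y. ennreal (Q x y * (\<bar>h y\<bar> + \<bar>h (level_cap n y)\<bar>)))"
    proof (intro nsum_mono ennreal_leI)
      fix y assume y: "y \<in> ?A - ?F"
      have "0 \<le> Q x y" by (rule upward_rate_nonneg[OF Q x y])
      then show "\<bar>Q x y * (h y - h (level_cap n y))\<bar> \<le> Q x y * (\<bar>h y\<bar> + \<bar>h (level_cap n y)\<bar>)"
        unfolding abs_mult by (intro mult_mono) auto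
    qed
    finally show "ennreal \<bar>d x\<bar> \<le> nsum (?A - ?F) (\<lambda>y. ennreal (Q x y * (\<bar>h y\<bar> + \<bar>h (level_cap n y)\<bar>)))" .
  qed simp
  finally show ?thesis .
qed

lemma levelwise_nondecreasing_le:
  assumes phases: "\<forall>k\<ge>1. S k = S 1" and v: "levelwise_nondecreasing S v"
    and "1 \<le> n" "n \<le> m" "j \<le> S 1"
  shows "v (n, j) \<le> v (m, j)"
  using assms(4)
proof (induction m rule: dec_induct)
  case (step m)
  have m: "1 \<le> m" using assms(3) step(1) by (rule order.trans)
  then have "j \<le> S m" using assms(5) phases_eq[OF phases] by metis
  then have "v (m, j) \<le> v (Suc m, j)"
    using v m unfolding levelwise_nondecreasing_def by blast
  with step(3) show ?case by (rule order.trans)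
qed simp

lemma levelwise_nondecreasing_cap_le:
  assumes phases: "\<forall>k\<ge>1. S k = S 1" and v: "levelwise_nondecreasing S v" and n: "n \<ge> 1"
    and y: "y \<in> states S"
  shows "v (level_cap n y) \<le> v y"
proof (cases y)
  case (Pair m j)
  show ?thesis
  proof (cases "m \<le> n")
    case False
    then have m: "n \<le> m" "1 \<le> m" using n by auto
    have "j \<le> S m" using y by (simp add: Pair states_def)
    then have "j \<le> S 1" by (simp only: phases_eq[OF phases m(2)])
    then show ?thesis
      using levelwise_nondecreasing_le[OF phases v n m(1)] m(1)
      by (simp add: Pair level_cap_def)
  qed (simp add: Pair level_cap_def)
qed

text \<open>Redirecting transitions downwards decreases the mean drift of a level-wise nondecreasing function,
  so the drift condition passes from \<open>Q\<close> to the truncation.\<close>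

lemma truncation_mean_drift_le:
  assumes phases: "\<forall>k\<ge>1. S k = S 1" and n: "n \<ge> 1"
    and Q: "conservative_q_matrix (states S) Q"
    and stat: "stationary_distribution (states S) (LC_truncation n Q) p"
    and supp: "\<And>x. x \<in> states S - states_upto S n \<Longrightarrow> p x = 0"
    and v: "levelwise_nondecreasing S v"
    and drift: "q_apply_le (states S) Q v (\<lambda>x. - f x + b * indicator B x)" and b: "0 \<le> b"
  shows "(\<Sum>x\<in>states_upto S n. p x * f x) \<le> b"
proof -
  let ?F = "states_upto S n"
  have p: "0 \<le> p x" if "x \<in> ?F" for x
    using stat that states_upto_subset by (auto simp: stationary_distribution_def)
  have le: "(\<Sum>y\<in>?F. LC_truncation n Q x y * v y) \<le> b - f x" if x: "x \<in> ?F" for x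
  proof -
    have xA: "x \<in> states S" using x states_upto_subset by auto
    have "((\<lambda>z. Q x z * v z) has_sum (\<Sum>\<^sub>\<infinity>z\<in>states S. Q x z * v z)) (states S)"
      using drift xA by (auto simp: q_apply_le_def)
    with LC_truncation_apply[OF phases n Q x]
    have "(\<Sum>y\<in>?F. LC_truncation n Q x y * v y) \<le> (\<Sum>\<^sub>\<infinity>z\<in>states S. Q x z * v z)"
    proof (rule has_sum_mono)
      fix z assume z: "z \<in> states S"
      show "Q x z * v (level_cap n z) \<le> Q x z * v z"
      proof (cases "z = x")
        case True
        then show ?thesis using level_cap_id[OF x] by simp
      next
        case False
        then have "0 \<le> Q x z" using Q xA z by (auto simp: conservative_q_matrix_def)
        then show ?thesis by (intro mult_left_mono levelwise_nondecreasing_cap_le[OF phases v n z])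
      qed
    qed
    also have "\<dots> \<le> - f x + b * indicator B x" using drift xA by (auto simp: q_apply_le_def)
    also have "\<dots> \<le> b - f x" using b by (simp split: split_indicator)
    finally show ?thesis .
  qed
  have "0 = (\<Sum>x\<in>?F. p x * (\<Sum>y\<in>?F. LC_truncation n Q x y * v y))"
    using truncation_stationary_sums(2)[OF stat supp] by simp
  also have "\<dots> \<le> (\<Sum>x\<in>?F. p x * (b - f x))"
    by (intro sum_mono mult_left_mono le p)
  also have "\<dots> = b * (\<Sum>x\<in>?F. p x) - (\<Sum>x\<in>?F. p x * f x)"
    by (simp add: right_diff_distrib sum_subtractf sum_distrib_left mult.commute)
  finally show ?thesis using truncation_stationary_sums(1)[OF stat supp] by simp
qed

section \<open>The error bound\<close>

lemma nsum_uncurried: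
  assumes "countable B"
  shows "(\<Sum>\<^sub>\<infinity>(m, j)\<in>B. f m j) = nsum B (\<lambda>y. f (fst y) (snd y))"
  by (simp add: nsum_eq_infsum[OF assms] case_prod_unfold)

text \<open>In column \<open>(m, j)\<close> above level \<open>n\<close>, the state \<open>(n, j)\<close> is the one to which the jump is redirected.\<close>

lemma E_bound_eq:
  assumes "n \<ge> 1"
  shows "E_bound S Q p v b c \<beta> \<phi> n = 2 * (\<Sum>x\<in>states_upto S n. ennreal (p x) *
    nsum (states S - states_upto S n)
      (\<lambda>y. ennreal (Q x y * (v y + v (level_cap n y) + 2 * b * (1 / c + 2 / (\<beta> * \<phi>))))))"
proof -
  have "nsum (states S - states_upto S n)
      (\<lambda>y. ennreal (Q x (fst y, snd y) * (v (fst y, snd y) + v (n, snd y) + 2 * b * (1 / c + 2 / (\<beta> * \<phi>)))))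
    = nsum (states S - states_upto S n)
      (\<lambda>y. ennreal (Q x y * (v y + v (level_cap n y) + 2 * b * (1 / c + 2 / (\<beta> * \<phi>)))))" for x
  proof (rule nsum_cong)
    fix y assume y: "y \<in> states S - states_upto S n"
    obtain m j where mj: "y = (m, j)" by (cases y)
    then have "level_cap n y = (n, j)" using y by (auto simp: level_cap_def states_def states_upto_def)
    then show "ennreal (Q x (fst y, snd y) * (v (fst y, snd y) + v (n, snd y) + 2 * b * (1 / c + 2 / (\<beta> * \<phi>))))
        = ennreal (Q x y * (v y + v (level_cap n y) + 2 * b * (1 / c + 2 / (\<beta> * \<phi>))))"
      by (simp add: mj)
  qed
  then show ?thesis unfolding E_bound_def by (subst nsum_uncurried) simp_all
qed

lemma E_bound_plus_eq:
  "E_bound_plus S Q p v b c \<beta> \<phi> n = 4 * (\<Sum>x\<in>states_upto S n. ennreal (p x) *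
    nsum (states S - states_upto S n) (\<lambda>y. ennreal (Q x y * (v y + b * (1 / c + 2 / (\<beta> * \<phi>))))))"
  unfolding E_bound_plus_def by (subst nsum_uncurried) simp_all

lemma nn_pairing_eq: "nn_pairing (states S) p g = nsum (states S) (\<lambda>x. ennreal (p x * g x))"
  by (simp add: nn_pairing_def nsum_eq_infsum)

lemma E_bound_le_E_bound_plus:
  assumes phases: "\<forall>k\<ge>1. S k = S 1" and n: "n \<ge> 1"
    and Q: "conservative_q_matrix (states S) Q"
    and v: "levelwise_nondecreasing S v"
  shows "E_bound S Q p v b c \<beta> \<phi> n \<le> E_bound_plus S Q p v b c \<beta> \<phi> n"
proof -
  let ?F = "states_upto S n" and ?U = "states S - states_upto S n"
  let ?B = "b * (1 / c + 2 / (\<beta> * \<phi>))"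
  let ?W = "\<lambda>y. v y + v (level_cap n y) + 2 * b * (1 / c + 2 / (\<beta> * \<phi>))"
  let ?Y = "\<lambda>x. nsum ?U (\<lambda>y. ennreal (Q x y * (v y + ?B)))"
  have "nsum ?U (\<lambda>y. ennreal (Q x y * ?W y)) \<le> 2 * ?Y x" if x: "x \<in> ?F" for x
    unfolding nsum_cmult[symmetric]
  proof (rule nsum_mono)
    fix y assume y: "y \<in> ?U"
    have "Q x y * ?W y \<le> Q x y * (2 * (v y + ?B))"
      using levelwise_nondecreasing_cap_le[OF phases v n, of y] y
      by (intro mult_left_mono upward_rate_nonneg[OF Q x y]) (simp add: algebra_simps)
    also have "\<dots> = 2 * (Q x y * (v y + ?B))" by (rule mult.left_commute)
    finally have "ennreal (Q x y * ?W y) \<le> ennreal (2 * (Q x y * (v y + ?B)))"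
      by (rule ennreal_leI)
    then show "ennreal (Q x y * ?W y) \<le> 2 * ennreal (Q x y * (v y + ?B))"
      by (subst (asm) ennreal_mult') simp_all
  qed
  then have "E_bound S Q p v b c \<beta> \<phi> n \<le> 2 * (\<Sum>x\<in>?F. ennreal (p x) * (2 * ?Y x))"
    unfolding E_bound_eq[OF n] by (intro mult_left_mono sum_mono) simp_all
  also have "\<dots> = 2 * (2 * (\<Sum>x\<in>?F. ennreal (p x) * ?Y x))"
    by (simp add: sum_distrib_left mult.left_commute)
  also have "\<dots> = E_bound_plus S Q p v b c \<beta> \<phi> n"
    unfolding E_bound_plus_eq by (simp add: mult.assoc[symmetric])
  finally show ?thesis .
qed

lemma Phi_trunc_eq: "Phi_trunc S Q \<beta> N x y = finite_resolvent (states_upto S N) Q \<beta> x y"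
  by (simp add: Phi_trunc_def finite_resolvent_def)

text \<open>The supremum defining \<open>phi_bar\<close> runs over finitely many states and is attained; the maximizer will
  be the regeneration state.\<close>

lemma phi_bar_attained:
  assumes Q: "conservative_q_matrix (states S) Q" and \<beta>: "0 < \<beta>" and N: "K \<le> N"
    and pos: "\<forall>x\<in>states_upto S K. \<forall>y\<in>states_upto S K. 0 < Phi_trunc S Q \<beta> N x y"
  obtains y0 where "y0 \<in> states_upto S N"
    and "\<And>x. x \<in> states_upto S K \<Longrightarrow> phi_bar S Q \<beta> K N \<le> Phi_trunc S Q \<beta> N x y0"
    and "0 < phi_bar S Q \<beta> K N" "phi_bar S Q \<beta> K N \<le> 1"
proof -
  let ?FK = "states_upto S K" and ?FN = "states_upto S N"
  let ?m = "\<lambda>y. Min ((\<lambda>x. Phi_trunc S Q \<beta> N x y) ` ?FK)"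
  have o: "(0, 0) \<in> ?FK" by (simp add: states_upto_def)
  have KN: "?FK \<subseteq> ?FN" by (rule states_upto_mono[OF N])
  have fin: "finite (?m ` ?FN)" "?m ` ?FN \<noteq> {}"
    using o KN finite_states_upto by auto
  have "phi_bar S Q \<beta> K N = Max (?m ` ?FN)"
    unfolding phi_bar_def by (rule cSup_eq_Max[OF fin])
  moreover have "Max (?m ` ?FN) \<in> ?m ` ?FN" by (rule Max_in[OF fin])
  ultimately obtain y0 where y0: "y0 \<in> ?FN" "phi_bar S Q \<beta> K N = ?m y0" by auto
  have le: "phi_bar S Q \<beta> K N \<le> Phi_trunc S Q \<beta> N x y0" if "x \<in> ?FK" for x
    unfolding y0(2) using that finite_states_upto by (intro Min_le) auto
  have sub: "sub_q_matrix ?FN Q"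
    by (rule conservative_imp_sub_q_matrix[OF Q finite_states_upto states_upto_subset])
  have oN: "(0, 0) \<in> ?FN" using o KN by blast
  have "Phi_trunc S Q \<beta> N (0, 0) y0 \<le> (\<Sum>y\<in>?FN. finite_resolvent ?FN Q \<beta> (0, 0) y)"
    unfolding Phi_trunc_eq
    using y0(1) finite_states_upto finite_resolvent_nonneg[OF sub \<beta> oN] by (intro member_le_sum) auto
  also have "\<dots> \<le> 1" by (rule finite_resolvent_row_sum_le[OF sub \<beta> oN])
  finally have le1: "phi_bar S Q \<beta> K N \<le> 1" using le[OF o] by simp
  have "0 < ?m (0, 0)" using pos o finite_states_upto by (subst Min_gr_iff) auto
  also have "\<dots> \<le> Max (?m ` ?FN)" using fin(1) oN by (intro Max_ge) auto
  finally have "0 < phi_bar S Q \<beta> K N" using \<open>phi_bar S Q \<beta> K N = Max (?m ` ?FN)\<close> by simp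
  with y0(1) le le1 that show thesis by blast
qed

text \<open>The test function \<open>f\<close> is \<open>g\<close> times the sign of \<open>\<pi> - p\<close>, so that the weighted total variation is the
  difference of the two means of \<open>f\<close>; that difference is the mean under \<open>p\<close> of \<open>Q h\<close>, where \<open>h\<close> solves
  the Poisson equation for the centred \<open>f\<close>.\<close>

lemma truncation_error_bound:
  fixes \<pi> p g v :: "state \<Rightarrow> real"
  assumes kernel: "drift_kernel (states S) P (\<lambda>x. ennreal (\<pi> x)) v b c \<beta> \<phi> K y0"
    and backward: "\<And>x y. x \<in> states S \<Longrightarrow> y \<in> states S \<Longrightarrow> ennreal (\<beta> - Q x x) * P x y
      = ennreal \<beta> * (if x = y then 1 else 0)
        + nsum (states S) (\<lambda>z. (if z = x then 0 else ennreal (Q x z)) * P z y)"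
    and Q: "conservative_q_matrix (states S) Q"
    and phases: "\<forall>k\<ge>1. S k = S 1" and n: "n \<ge> 1" and \<phi>1: "\<phi> \<le> 1"
    and \<pi>: "\<And>x. x \<in> states S \<Longrightarrow> 0 \<le> \<pi> x"
    and stat: "stationary_distribution (states S) (LC_truncation n Q) p"
    and supp: "\<And>x. x \<in> states S - states_upto S n \<Longrightarrow> p x = 0"
    and g: "\<And>x. x \<in> states S \<Longrightarrow> 0 \<le> g x" "\<And>x. x \<in> states S \<Longrightarrow> g x \<le> c * v x"
  obtains G where "0 \<le> G" "nn_pairing (states S) \<pi> g = ennreal G"
    "nn_pairing (states S) (\<lambda>x. \<bar>\<pi> x - p x\<bar>) g \<le> ennreal ((G + 1) / 2) * E_bound S Q p v b c \<beta> \<phi> n"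
proof -
  let ?W = "\<lambda>y. v y + v (level_cap n y) + 2 * b * (1 / c + 2 / (\<beta> * \<phi>))"
  let ?A = "states S" and ?F = "states_upto S n"
  interpret D: drift_kernel ?A P "\<lambda>x. ennreal (\<pi> x)" v b c \<beta> \<phi> K y0 by (rule kernel)
  have pi1: "(\<pi> has_sum 1) ?A"
    using nsum_imp_has_sum[of ?A \<pi> 1] D.total \<pi> by simp
  have "nsum ?A (\<lambda>x. ennreal (\<pi> x * g x)) \<le> nsum ?A (\<lambda>x. ennreal c * (ennreal (\<pi> x) * ennreal (v x)))"
  proof (rule nsum_mono)
    fix x assume x: "x \<in> ?A"
    have "\<pi> x * g x \<le> \<pi> x * (c * v x)" by (intro mult_left_mono g \<pi> x)
    then have "ennreal (\<pi> x * g x) \<le> ennreal (c * (\<pi> x * v x))"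
      by (intro ennreal_leI) (simp add: mult.left_commute)
    also have "\<dots> = ennreal c * (ennreal (\<pi> x) * ennreal (v x))"
      using D.pos \<pi>[OF x] D.v_nonneg[OF x] by (simp add: ennreal_mult)
    finally show "ennreal (\<pi> x * g x) \<le> ennreal c * (ennreal (\<pi> x) * ennreal (v x))" .
  qed
  also have "\<dots> < \<top>"
    unfolding nsum_cmult using D.invariant_v_finite by (simp add: ennreal_mult_less_top less_top)
  finally obtain G where G: "0 \<le> G" "nsum ?A (\<lambda>x. ennreal (\<pi> x * g x)) = ennreal G"
    by (metis ennreal_cases less_irrefl)
  have Gsum: "((\<lambda>x. \<pi> x * g x) has_sum G) ?A"
    by (rule nsum_imp_has_sum) (use G g \<pi> in auto)

  define f where "f x = (if p x \<le> \<pi> x then g x else - g x)" for x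
  have f_abs: "\<bar>f x\<bar> = g x" if "x \<in> ?A" for x using g(1)[OF that] by (simp add: f_def)
  have abs_f: "\<bar>\<pi> x * f x\<bar> = \<pi> x * g x" if "x \<in> ?A" for x
    using f_abs[OF that] \<pi>[OF that] by (simp add: abs_mult)
  have "(\<lambda>x. norm (\<pi> x * f x)) summable_on ?A"
    using Gsum by (subst summable_on_cong[of _ _ "\<lambda>x. \<pi> x * g x"]) (auto simp: abs_f summable_on_def)
  then have "(\<lambda>x. \<pi> x * f x) summable_on ?A" by (rule abs_summable_summable)
  then obtain m where m: "((\<lambda>x. \<pi> x * f x) has_sum m) ?A" by (auto simp: summable_on_def)
  have mG: "\<bar>m\<bar> \<le> G"
  proof -
    have "((\<lambda>x. norm (\<pi> x * f x)) has_sum G) ?A"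
      using Gsum by (subst has_sum_cong[of _ _ "\<lambda>x. \<pi> x * g x"]) (auto simp: abs_f)
    from norm_has_sum_bound[OF this m] show ?thesis by simp
  qed
  define f0 where "f0 x = f x - m" for x
  have f0_le: "\<bar>f0 x\<bar> \<le> (G + 1) * (c * v x)" if x: "x \<in> ?A" for x
  proof -
    have "\<bar>f0 x\<bar> \<le> g x + G" using f_abs[OF x] mG by (simp add: f0_def)
    also have "\<dots> \<le> c * v x + G * (c * v x)"
      using g(2)[OF x] mult_left_mono[OF D.v_ge[OF x] G(1)] by simp
    finally show ?thesis by (simp add: algebra_simps)
  qed
  have f0_sum: "((\<lambda>x. \<pi> x * f0 x) has_sum 0) ?A"
  proof -
    have "((\<lambda>x. \<pi> x * f x + - (\<pi> x * m)) has_sum (m + - (1 * m))) ?A"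
      by (intro has_sum_add has_sum_uminusI has_sum_cmult_left m pi1)
    then show ?thesis by (simp add: f0_def right_diff_distrib)
  qed
  have centred: "nsum ?A (\<lambda>x. ennreal (\<pi> x) * ennreal (f0 x)) = nsum ?A (\<lambda>x. ennreal (\<pi> x) * ennreal (- f0 x))"
    by (rule nsum_pos_part_eq_neg_part[OF D.countable \<pi> f0_sum])
  have C0: "0 \<le> G + 1" using G(1) by simp
  obtain h where h: "\<And>x. x \<in> ?A \<Longrightarrow> \<bar>h x\<bar> \<le> (G + 1) * D.u x"
    "\<And>x. x \<in> ?A \<Longrightarrow> ((\<lambda>z. Q x z * h z) has_sum (- f0 x)) ?A"
    using D.poisson_equation[OF q_off_diagonal[OF Q] q_diagonal[OF Q] backward f0_le C0 centred] by blast
  let ?k = "b * (1 / c + 2 / (\<beta> * \<phi>))"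
  \<comment> \<open>Since \<open>\<phi> \<le> 1\<close>, the bounded summand of \<open>u\<close> is at most \<open>2 b / (\<beta> \<phi>) \<le> ?k\<close>.\<close>
  have u_le: "D.u x \<le> v x + ?k" for x
  proof -
    have "b / \<beta> * (1 / \<phi> + 1) \<le> b / \<beta> * (1 / \<phi> + 1 / \<phi>)"
      using D.pos \<phi>1 by (intro mult_left_mono add_left_mono) auto
    also have "\<dots> = b * (2 / (\<beta> * \<phi>))" by simp
    also have "\<dots> \<le> ?k" using D.pos by (intro mult_left_mono) auto
    finally show ?thesis using D.u_le[of x] by simp
  qed
  have h_le: "\<bar>h x\<bar> \<le> (G + 1) * (v x + ?k)" if "x \<in> ?A" for x
    using order.trans[OF h(1)[OF that] mult_left_mono[OF u_le C0]] .

  have "((\<lambda>x. \<bar>\<pi> x - p x\<bar> * g x) has_sum (m + - (\<Sum>x\<in>?F. p x * f x))) ?A"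
  proof -
    have "((\<lambda>x. p x * f x) has_sum (\<Sum>x\<in>?F. p x * f x)) ?A"
      by (rule has_sum_finite_neutralI[OF finite_states_upto states_upto_subset]) (use supp in auto)
    then have "((\<lambda>x. \<pi> x * f x + - (p x * f x)) has_sum (m + - (\<Sum>x\<in>?F. p x * f x))) ?A"
      by (intro has_sum_add has_sum_uminusI m)
    moreover have "\<pi> x * f x + - (p x * f x) = \<bar>\<pi> x - p x\<bar> * g x" for x
      by (auto simp: f_def algebra_simps)
    ultimately show ?thesis by simp
  qed
  then have "nn_pairing ?A (\<lambda>x. \<bar>\<pi> x - p x\<bar>) g = ennreal (m + - (\<Sum>x\<in>?F. p x * f x))"
    unfolding nn_pairing_eq by (intro has_sum_imp_nsum) (use g in auto)
  also have "m + - (\<Sum>x\<in>?F. p x * f x) = (\<Sum>x\<in>?F. p x * - f0 x)"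
    using truncation_stationary_sums(1)[OF stat supp]
    by (simp add: f0_def algebra_simps sum.distrib sum_subtractf sum_distrib_left[symmetric] sum_negf)
  also have "ennreal \<dots> \<le> ennreal \<bar>\<Sum>x\<in>?F. p x * - f0 x\<bar>" by (rule ennreal_leI) simp
  also have "\<dots> \<le> (\<Sum>x\<in>?F. ennreal (p x) *
        nsum (?A - ?F) (\<lambda>y. ennreal (Q x y * (\<bar>h y\<bar> + \<bar>h (level_cap n y)\<bar>))))"
    by (rule truncation_mean_generator[OF phases n Q stat supp h(2)]) (use states_upto_subset in auto)
  also have "\<dots> \<le> (\<Sum>x\<in>?F. ennreal (p x) * (ennreal (G + 1) *
        nsum (?A - ?F) (\<lambda>y. ennreal (Q x y * ?W y))))"
  proof (intro sum_mono mult_left_mono)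
    fix x assume x: "x \<in> ?F"
    show "nsum (?A - ?F) (\<lambda>y. ennreal (Q x y * (\<bar>h y\<bar> + \<bar>h (level_cap n y)\<bar>))) \<le> ennreal (G + 1) *
        nsum (?A - ?F) (\<lambda>y. ennreal (Q x y * ?W y))"
      unfolding nsum_cmult[symmetric]
    proof (rule nsum_mono)
      fix y assume y: "y \<in> ?A - ?F"
      have cap: "level_cap n y \<in> ?A" using level_cap_in[OF phases n, of y] y states_upto_subset by auto
      have "Q x y * (\<bar>h y\<bar> + \<bar>h (level_cap n y)\<bar>)
          \<le> Q x y * ((G + 1) * (v y + ?k) + (G + 1) * (v (level_cap n y) + ?k))"
        using y cap by (intro mult_left_mono add_mono h_le upward_rate_nonneg[OF Q x y]) auto
      also have "\<dots> = (G + 1) * (Q x y * ?W y)"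
        by (simp add: algebra_simps)
      finally show "ennreal (Q x y * (\<bar>h y\<bar> + \<bar>h (level_cap n y)\<bar>))
          \<le> ennreal (G + 1) * ennreal (Q x y * ?W y)"
        using C0 by (subst ennreal_mult'[symmetric]) (auto intro: ennreal_leI)
    qed
  qed simp
  also have "\<dots> = ennreal ((G + 1) / 2) * E_bound S Q p v b c \<beta> \<phi> n"
  proof -
    have "ennreal (G + 1) = ennreal ((G + 1) / 2) * 2"
      using C0 by (subst ennreal_numeral[symmetric], subst ennreal_mult[symmetric]) auto
    then show ?thesis
      unfolding E_bound_eq[OF n] by (simp add: sum_distrib_left mult_ac)
  qed
  finally show thesis using that G by (simp add: nn_pairing_eq)
qed

lemma nsum_times_finite:
  assumes "finite J"
  shows "nsum (I \<times> J) f = nsum I (\<lambda>m. \<Sum>j\<in>J. f (m, j))"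
proof -
  have "nsum (I \<times> J) f = nsum UNIV (\<lambda>y. f y * indicator (I \<times> J) y)"
    by (rule nn_integral_count_space_indicator) simp
  also have "\<dots> = nsum UNIV (\<lambda>m. nsum UNIV (\<lambda>j. f (m, j) * indicator (I \<times> J) (m, j)))"
    by (rule nn_integral_fst_count_space[symmetric])
  also have "\<dots> = nsum UNIV (\<lambda>m. (\<Sum>j\<in>J. f (m, j)) * indicator I m)"
  proof (rule nsum_cong)
    fix m
    have "nsum UNIV (\<lambda>j. f (m, j) * indicator (I \<times> J) (m, j)) = (\<Sum>j\<in>J. f (m, j) * indicator (I \<times> J) (m, j))"
      by (rule nn_integral_count_space'[OF assms]) auto
    also have "\<dots> = (\<Sum>j\<in>J. f (m, j)) * indicator I m"
      by (auto simp: sum_distrib_right indicator_times intro!: sum.cong)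
    finally show "nsum UNIV (\<lambda>j. f (m, j) * indicator (I \<times> J) (m, j)) = (\<Sum>j\<in>J. f (m, j)) * indicator I m" .
  qed
  also have "\<dots> = nsum I (\<lambda>m. \<Sum>j\<in>J. f (m, j))"
    by (rule nn_integral_count_space_indicator[symmetric]) simp
  finally show ?thesis .
qed

text \<open>A jump from level \<open>k\<close> above level \<open>n\<close> has a height \<open>m > n - k\<close>, and both \<open>V (k + m)\<close> and \<open>T n\<close> are
  split at \<open>k\<close> by log-subadditivity.\<close>

lemma upward_mass_le:
  assumes phases: "\<forall>k\<ge>1. S k = S 1" and n: "n \<ge> 1"
    and Q: "conservative_q_matrix (states S) Q"
    and a: "\<forall>i\<le>S 1. 0 < a i"
    and V: "\<forall>x\<ge>0. 1 \<le> V x" "log_subadditive V"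
    and T: "\<forall>x\<ge>0. 1 \<le> T x" "log_subadditive T"
    and r1: "r1 > 0" "sup1 S Q V T a \<le> ennreal r1"
    and x: "x \<in> states_upto S n"
  shows "nsum (states S - states_upto S n) (\<lambda>y. ennreal (Q x y * (V (real (fst y)) * a (snd y))))
    \<le> ennreal (r1 / T (real n) * (T (real (fst x)) * V (real (fst x))))"
proof -
  obtain k i where x_eq: "x = (k, i)" by (metis surj_pair)
  have k: "k \<le> n" and i: "i \<le> S k" using x by (auto simp: x_eq states_upto_def)
  let ?U = "states S - states_upto S n" and ?I = "{n<..}" and ?l = "n - k"
  have V1: "1 \<le> V (real m)" and T1: "1 \<le> T (real m)" for m using V(1) T(1) by auto
  let ?w = "nsum {?l<..} (\<lambda>m. \<Sum>j\<le>S 1. ennreal (Q (k, i) (k + m, j) * V (real m) * a j))"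
  have "nsum (?U) (\<lambda>y. ennreal (Q x y * (V (real (fst y)) * a (snd y))))
      \<le> nsum (?U)
          (\<lambda>y. ennreal (V (real k)) * ennreal (Q x y * V (real (fst y - k)) * a (snd y)))"
  proof (rule nsum_mono)
    fix y assume y: "y \<in> ?U"
    then have y': "n < fst y" "snd y \<le> S 1"
      unfolding upper_states_eq[OF phases n] by auto
    have Qxy: "0 \<le> Q x y" by (rule upward_rate_nonneg[OF Q x y])
    have "V (real k + real (fst y - k)) \<le> V (real k) * V (real (fst y - k))"
      using V(2) unfolding log_subadditive_def by simp
    also have "real k + real (fst y - k) = real (fst y)" using y' k by simp
    finally have "Q x y * (V (real (fst y)) * a (snd y)) \<le> Q x y * ((V (real k) * V (real (fst y - k))) * a (snd y))"
      using a y' Qxy by (intro mult_left_mono mult_right_mono) (auto simp: less_imp_le)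
    then have "ennreal (Q x y * (V (real (fst y)) * a (snd y)))
        \<le> ennreal (V (real k) * (Q x y * V (real (fst y - k)) * a (snd y)))"
      by (intro ennreal_leI) (simp add: mult_ac)
    then show "ennreal (Q x y * (V (real (fst y)) * a (snd y)))
        \<le> ennreal (V (real k)) * ennreal (Q x y * V (real (fst y - k)) * a (snd y))"
      using order.trans[OF zero_le_one V1[of k]] by (simp only: ennreal_mult')
  qed
  also have "\<dots> = ennreal (V (real k)) * nsum (?I \<times> {..S 1}) (\<lambda>y. ennreal (Q x y * V (real (fst y - k)) * a (snd y)))"
    by (simp only: nsum_cmult upper_states_eq[OF phases n])
  also have "nsum (?I \<times> {..S 1}) (\<lambda>y. ennreal (Q x y * V (real (fst y - k)) * a (snd y)))
      = nsum ?I (\<lambda>m. \<Sum>j\<le>S 1. ennreal (Q x (m, j) * V (real (m - k)) * a j))"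
    by (subst nsum_times_finite) simp_all
  also have "\<dots> = ?w"
  proof -
    have "bij_betw (\<lambda>m. k + m) {?l<..} ?I"
      by (rule bij_betwI[where g = "\<lambda>m. m - k"]) (use k in auto)
    from nn_integral_bij_count_space[OF this, symmetric] show ?thesis by (simp add: x_eq)
  qed
  also have "ennreal (V (real k)) * ?w \<le> ennreal (V (real k)) * ennreal (r1 / T (real ?l))"
  proof (rule mult_left_mono)
    have "ennreal (T (real ?l)) * ?w \<le> ennreal (T (real ?l)) *
        (SUP i\<in>{..S k}. \<Sum>\<^sub>\<infinity>m\<in>{?l<..}. \<Sum>j\<le>S 1. ennreal (Q (k, i) (k + m, j) * V (real m) * a j))"
      using i by (intro mult_left_mono SUP_upper2[of i]) (simp_all add: nsum_eq_infsum)
    also have "\<dots> \<le> sup1 S Q V T a"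
      unfolding sup1_def by (rule SUP_upper2[of "(k, ?l)"]) simp_all
    also have "\<dots> \<le> ennreal r1" by (rule r1)
    finally have le: "ennreal (T (real ?l)) * ?w \<le> ennreal r1" .
    have Tpos: "0 < T (real ?l)" using T1[of ?l] by linarith
    have "?w = ennreal (1 / T (real ?l)) * (ennreal (T (real ?l)) * ?w)"
      using Tpos by (simp add: mult.assoc[symmetric] ennreal_mult[symmetric])
    also have "\<dots> \<le> ennreal (1 / T (real ?l)) * ennreal r1" by (intro mult_left_mono le) simp
    also have "\<dots> = ennreal (r1 / T (real ?l))" using Tpos r1 by (simp add: ennreal_mult[symmetric])
    finally show "?w \<le> ennreal (r1 / T (real ?l))" .
  qed simp
  also have "\<dots> = ennreal (V (real k) * (r1 / T (real ?l)))"
    using V1[of k] T1[of ?l] r1 by (intro ennreal_mult[symmetric]) auto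
  also have "\<dots> \<le> ennreal (r1 / T (real n) * (T (real (fst x)) * V (real (fst x))))"
  proof (rule ennreal_leI)
    have "T (real k + real ?l) \<le> T (real k) * T (real ?l)"
      using T(2) unfolding log_subadditive_def by simp
    also have "real k + real ?l = real n" using k by simp
    finally have "r1 * T (real n) \<le> r1 * (T (real k) * T (real ?l))" using r1 by simp
    then have "r1 / T (real ?l) \<le> r1 / T (real n) * T (real k)"
      using T1[of ?l] T1[of n] by (simp add: field_simps)
    then have "V (real k) * (r1 / T (real ?l)) \<le> V (real k) * (r1 / T (real n) * T (real k))"
      using V1[of k] by (intro mult_left_mono) auto
    then show "V (real k) * (r1 / T (real ?l)) \<le> r1 / T (real n) * (T (real (fst x)) * V (real (fst x)))"
      by (simp add: x_eq mult_ac)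
  qed
  finally show ?thesis .
qed

text \<open>Above level \<open>n\<close> the function \<open>v = V a\<close> is at least \<open>min a * V (n + 1)\<close>, so the constant in the bound is at
  most a multiple of \<open>v\<close>.  The rate of \<open>v\<close>-weighted upward jumps is then compared with \<open>f\<close> state by state, and
  the mean of \<open>f\<close> is known.\<close>

lemma E_bound_plus_le:
  assumes phases: "\<forall>k\<ge>1. S k = S 1" and n: "n \<ge> 1"
    and Q: "conservative_q_matrix (states S) Q"
    and p: "\<And>x. x \<in> states S \<Longrightarrow> 0 \<le> p x"
    and mean: "(\<Sum>x\<in>states_upto S n. p x * f x) \<le> bs"
    and f: "\<forall>x\<in>states S. 1 \<le> f x"
    and a: "\<forall>i\<le>S 1. 0 < a i"
    and V: "\<forall>x\<ge>0. 1 \<le> V x" "mono_on {0..} V" "log_subadditive V"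
    and T: "\<forall>x\<ge>0. 1 \<le> T x" "log_subadditive T"
    and v: "\<forall>k\<ge>1. \<forall>i\<le>S 1. v (k, i) = V (real k) * a i"
    and r0: "r0 > 0" "sup0 S V T f \<le> ennreal r0"
    and r1: "r1 > 0" "sup1 S Q V T a \<le> ennreal r1"
    and pos: "0 < b" "0 < c" "0 < \<beta>" "0 < \<phi>"
  shows "E_bound_plus S Q p v b c \<beta> \<phi> n \<le> ennreal (4 * r0 * r1 * bs / T (real n) *
    (1 + b / (Min (a ` {..S 1}) * V (real (n + 1))) * (1 / c + 2 / (\<beta> * \<phi>))))"
proof -
  let ?F = "states_upto S n" and ?U = "states S - states_upto S n"
  let ?a = "Min (a ` {..S 1})" and ?B = "b * (1 / c + 2 / (\<beta> * \<phi>))"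
  let ?t = "1 + b / (?a * V (real (n + 1))) * (1 / c + 2 / (\<beta> * \<phi>))"
  have V1: "1 \<le> V (real m)" and T1: "1 \<le> T (real m)" for m using V(1) T(1) by auto
  have a0: "0 < ?a" using a by (subst Min_gr_iff) auto
  have B0: "0 \<le> ?B" using pos by simp
  have aV: "0 < ?a * V (real (n + 1))" using a0 V1[of "n + 1"] by (intro mult_pos_pos) auto
  have t_eq: "?t = 1 + ?B / (?a * V (real (n + 1)))" by simp
  have t0: "0 \<le> ?t" unfolding t_eq using B0 aV by simp
  \<comment> \<open>The factor \<open>?t\<close> absorbs the constant \<open>?B\<close> into \<open>v\<close>.\<close>
  have vt: "v y + ?B \<le> ?t * (V (real (fst y)) * a (snd y))" if y: "y \<in> ?U" for y
  proof -
    have y': "n < fst y" "snd y \<le> S 1" using y unfolding upper_states_eq[OF phases n] by auto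
    have vy: "v y = V (real (fst y)) * a (snd y)" using v y' by (cases y) auto
    have "V (real (n + 1)) \<le> V (real (fst y))"
      using y' by (intro mono_onD[OF V(2)]) auto
    moreover have "?a \<le> a (snd y)" using y' by (intro Min_le) auto
    ultimately have "?a * V (real (n + 1)) \<le> a (snd y) * V (real (fst y))"
      using a0 V1[of "n + 1"] by (intro mult_mono) linarith+
    then have "?a * V (real (n + 1)) \<le> v y" by (simp only: vy mult.commute)
    then have "?B * 1 \<le> ?B * (v y / (?a * V (real (n + 1))))"
      using aV B0 by (intro mult_left_mono) auto
    then have "v y + ?B \<le> v y + ?B / (?a * V (real (n + 1))) * v y" by simp
    also have "\<dots> = ?t * v y" unfolding t_eq by (simp add: algebra_simps)
    finally show ?thesis unfolding vy .
  qed
  have TVf: "T (real (fst x)) * V (real (fst x)) \<le> r0 * f x" if x: "x \<in> states S" for x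
  proof -
    obtain k i where x_eq: "x = (k, i)" by (metis surj_pair)
    have fx: "1 \<le> f x" using f x by blast
    have "ennreal (T (real k) * V (real k) / f (k, i)) \<le> sup0 S V T f"
      unfolding sup0_def using x by (intro SUP_upper2[of x]) (auto simp: x_eq)
    then have "ennreal (T (real k) * V (real k) / f (k, i)) \<le> ennreal r0" using r0(2) by (rule order.trans)
    then have "T (real k) * V (real k) / f x \<le> r0" using r0(1) by (simp add: ennreal_le_iff x_eq)
    then show ?thesis using fx by (simp add: x_eq field_simps)
  qed
  have "(\<Sum>x\<in>?F. ennreal (p x) * nsum ?U (\<lambda>y. ennreal (Q x y * (v y + ?B))))
      \<le> (\<Sum>x\<in>?F. ennreal (?t * (r1 / T (real n) * r0) * (p x * f x)))"
  proof (rule sum_mono)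
    fix x assume x: "x \<in> ?F"
    then have xA: "x \<in> states S" using states_upto_subset by auto
    have px: "0 \<le> p x" and fx: "1 \<le> f x" using p[OF xA] f xA by auto
    have rT: "0 \<le> r1 / T (real n)" using r1(1) T1[of n] by simp
    have "nsum ?U (\<lambda>y. ennreal (Q x y * (v y + ?B)))
        \<le> nsum ?U (\<lambda>y. ennreal ?t * ennreal (Q x y * (V (real (fst y)) * a (snd y))))"
    proof (rule nsum_mono)
      fix y assume y: "y \<in> ?U"
      have "Q x y * (v y + ?B) \<le> Q x y * (?t * (V (real (fst y)) * a (snd y)))"
        by (intro mult_left_mono vt y upward_rate_nonneg[OF Q x y])
      also have "\<dots> = ?t * (Q x y * (V (real (fst y)) * a (snd y)))" by (rule mult.left_commute)
      finally show "ennreal (Q x y * (v y + ?B)) \<le> ennreal ?t * ennreal (Q x y * (V (real (fst y)) * a (snd y)))"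
        by (subst ennreal_mult'[OF t0, symmetric]) (rule ennreal_leI)
    qed
    also have "\<dots> \<le> ennreal ?t * ennreal (r1 / T (real n) * (T (real (fst x)) * V (real (fst x))))"
      unfolding nsum_cmult
      by (intro mult_left_mono upward_mass_le[OF phases n Q a V(1,3) T r1 x]) simp
    also have "\<dots> \<le> ennreal ?t * ennreal (r1 / T (real n) * (r0 * f x))"
      by (intro mult_left_mono ennreal_leI TVf xA rT) simp
    also have "\<dots> = ennreal (?t * (r1 / T (real n) * r0) * f x)"
      using t0 rT r0(1) fx by (simp only: ennreal_mult'[OF t0, symmetric] mult.assoc)
    finally have "ennreal (p x) * nsum ?U (\<lambda>y. ennreal (Q x y * (v y + ?B)))
        \<le> ennreal (p x) * ennreal (?t * (r1 / T (real n) * r0) * f x)"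
      by (rule mult_left_mono) simp
    also have "\<dots> = ennreal (?t * (r1 / T (real n) * r0) * (p x * f x))"
      by (simp only: ennreal_mult'[OF px, symmetric] mult.left_commute)
    finally show "ennreal (p x) * nsum ?U (\<lambda>y. ennreal (Q x y * (v y + ?B)))
        \<le> ennreal (?t * (r1 / T (real n) * r0) * (p x * f x))" .
  qed
  also have "\<dots> = ennreal (?t * (r1 / T (real n) * r0) * (\<Sum>x\<in>?F. p x * f x))"
  proof -
    have "0 \<le> ?t * (r1 / T (real n) * r0) * (p x * f x)" if "x \<in> ?F" for x
    proof -
      have "x \<in> states S" using that states_upto_subset by auto
      then have "0 \<le> p x" "0 \<le> f x" using p f by (auto intro: order.trans[OF zero_le_one])
      then show ?thesis using t0 r1(1) r0(1) T1[of n] by (intro mult_nonneg_nonneg) auto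
    qed
    then show ?thesis by (subst sum_ennreal) (simp_all only: sum_distrib_left)
  qed
  also have "\<dots> \<le> ennreal (?t * (r1 / T (real n) * r0) * bs)"
    using t0 r1(1) r0(1) T1[of n] by (intro ennreal_leI mult_left_mono mean mult_nonneg_nonneg) auto
  finally have "E_bound_plus S Q p v b c \<beta> \<phi> n \<le> 4 * ennreal (?t * (r1 / T (real n) * r0) * bs)"
    unfolding E_bound_plus_eq by (rule mult_left_mono) simp
  also have "\<dots> = ennreal (4 * (?t * (r1 / T (real n) * r0) * bs))"
    by (subst ennreal_mult') simp_all
  also have "4 * (?t * (r1 / T (real n) * r0) * bs) = 4 * r0 * r1 * bs / T (real n) * ?t"
    by (simp only: mult_ac times_divide_eq_right times_divide_eq_left)
  finally show ?thesis .
qed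


theorem corollary2p2:
  fixes S :: "nat \<Rightarrow> nat"
    and M :: "state \<Rightarrow> 'w measure"
    and X :: "real \<Rightarrow> 'w \<Rightarrow> state"
    and Q :: "state \<Rightarrow> state \<Rightarrow> real"
    and \<pi> :: "state \<Rightarrow> real"
    and \<pi>n :: "nat \<Rightarrow> state \<Rightarrow> real"
    and v v\<^sub>s f\<^sub>s :: "state \<Rightarrow> real"
    and a :: "nat \<Rightarrow> real"
    and V T :: "real \<Rightarrow> real"
    and b c b\<^sub>s \<beta> r\<^sub>0 r\<^sub>1 :: real
    and K K\<^sub>s N :: nat
  assumes phases: "\<forall>k\<ge>1. S k = S 1"
    and chain: "regular_jump_markov_chain (states S) M X"
    and generator: "is_generator (states S) M X Q"
    and conservative: "conservative_q_matrix (states S) Q"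
    and ergodic: "ergodic_chain (states S) M X"
    and stationary: "stationary_distribution (states S) Q \<pi>"
    and closed_class: "\<forall>n\<ge>1. \<exists>!C. C \<subseteq> states_upto S n \<and>
          closed_communicating_class (states S) (LC_truncation n Q) C"
    and stationary_trunc: "\<forall>n\<ge>1. stationary_distribution (states S) (LC_truncation n Q) (\<pi>n n)"
    and bc: "b > 0" "c > 0"
    and v_nonneg: "\<forall>x\<in>states S. 0 \<le> v x"
    and v_ge: "\<forall>x\<in>states S. 1 \<le> c * v x"
    and v_drift: "q_apply_le (states S) Q v (\<lambda>x. - c * v x + b * indicator (states_upto S K) x)"
    and v_pos: "\<forall>x\<in>states S - states_upto S 0. 0 < v x"
    and v_mono: "levelwise_nondecreasing S v"
    and bs: "b\<^sub>s > 0"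
    and vs_nonneg: "\<forall>x\<in>states S. 0 \<le> v\<^sub>s x"
    and fs_ge: "\<forall>x\<in>states S. 1 \<le> f\<^sub>s x"
    and vs_mono: "levelwise_nondecreasing S v\<^sub>s"
    and vs_drift: "q_apply_le (states S) Q v\<^sub>s (\<lambda>x. - f\<^sub>s x + b\<^sub>s * indicator (states_upto S K\<^sub>s) x)"
    and a_pos: "\<forall>i\<le>S 1. 0 < a i"
    and V: "\<forall>x\<ge>0. 1 \<le> V x" "mono_on {0..} V" "log_subadditive V"
    and T: "\<forall>x\<ge>0. 1 \<le> T x" "mono_on {0..} T" "log_subadditive T"
    and v_eq: "\<forall>k\<ge>1. \<forall>i\<le>S 1. v (k, i) = V (real k) * a i"
    and T_lim: "filterlim T at_top at_top"
    and sup0_finite: "sup0 S V T f\<^sub>s < \<infinity>"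
    and sup1_finite: "sup1 S Q V T a < \<infinity>"
    and \<beta>: "\<beta> > 0"
    and N: "K \<le> N"
    and Phi_K: "\<forall>x\<in>states_upto S K. \<forall>y\<in>states_upto S K.
          0 < Phi_trunc S Q \<beta> N x y \<and> Phi_trunc S Q \<beta> N x y \<le> Phi M X \<beta> x y"
    and r0: "r\<^sub>0 > 0" "sup0 S V T f\<^sub>s \<le> ennreal r\<^sub>0"
    and r1: "r\<^sub>1 > 0" "sup1 S Q V T a \<le> ennreal r\<^sub>1"
  defines "E \<equiv> \<lambda>n. E_bound S Q (\<pi>n n) v b c \<beta> (phi_bar S Q \<beta> K N) n"
    and "E\<^sub>p \<equiv> \<lambda>n. E_bound_plus S Q (\<pi>n n) v b c \<beta> (phi_bar S Q \<beta> K N) n"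
  shows "\<forall>n\<ge>1.
     (\<forall>g. (\<forall>x\<in>states S. 0 \<le> g x \<and> g x \<le> c * v x) \<longrightarrow>
        nn_pairing (states S) (\<lambda>x. \<bar>\<pi> x - \<pi>n n x\<bar>) g
          \<le> (nn_pairing (states S) \<pi> g + 1) / 2 * E n) \<and>
     (SUP g\<in>{g. \<forall>x\<in>states S. 1 \<le> g x \<and> g x \<le> c * v x}.
        nn_pairing (states S) (\<lambda>x. \<bar>\<pi> x - \<pi>n n x\<bar>) g / nn_pairing (states S) \<pi> g) \<le> E n \<and>
     E n \<le> E\<^sub>p n \<and>
     E\<^sub>p n \<le> ennreal (4 * r\<^sub>0 * r\<^sub>1 * b\<^sub>s / T (real n) *
        (1 + b / (Min (a ` {..S 1}) * V (real (n + 1)))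
             * (1 / c + 2 / (\<beta> * phi_bar S Q \<beta> K N))))"
proof (intro allI impI)
  fix n :: nat assume n: "1 \<le> n"
  let ?A = "states S" and ?F = "states_upto S" and ?\<phi> = "phi_bar S Q \<beta> K N"
  let ?P = "min_resolvent ?F Q \<beta>"
  note exh = states_upto_incseq finite_states_upto UN_states_upto
  note Q = conservative

  have pi_nonneg: "0 \<le> \<pi> x" if "x \<in> ?A" for x
    using stationary that unfolding stationary_distribution_def by blast
  have pi_total: "nsum ?A (\<lambda>x. ennreal (\<pi> x)) = 1"
    using has_sum_imp_nsum[of ?A \<pi> 1] pi_nonneg stationary
    unfolding stationary_distribution_def by simp
  have pi_Q: "((\<lambda>x. \<pi> x * Q x y) has_sum 0) ?A" if "y \<in> ?A" for y
    using stationary that unfolding stationary_distribution_def by blast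

  obtain y0 where y0: "y0 \<in> ?F N" "\<And>x. x \<in> ?F K \<Longrightarrow> ?\<phi> \<le> Phi_trunc S Q \<beta> N x y0"
    and \<phi>: "0 < ?\<phi>" "?\<phi> \<le> 1"
  proof (rule phi_bar_attained[OF Q \<beta> N])
    show "\<forall>x\<in>?F K. \<forall>y\<in>?F K. 0 < Phi_trunc S Q \<beta> N x y" using Phi_K by blast
  qed blast

  \<comment> \<open>The passage from the process to its generator: no mass escapes to infinity in finite time.\<close>
  have honest: "nsum ?A (?P x) = 1" if x: "x \<in> ?A" for x
  proof (rule min_resolvent_row_sum[OF exh Q \<beta> x])
    show "(\<lambda>N. \<Sum>y\<in>?F N. finite_resolvent (?F N) Q \<beta> x y) \<longlonglongrightarrow> 1"
    proof (rule finite_resolvent_row_sum_tendsto_1[OF _ _ \<beta>])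
      show "sub_q_matrix (?F N) Q" for N
        by (rule conservative_imp_sub_q_matrix[OF Q finite_states_upto states_upto_subset])
      show "\<forall>\<^sub>F N in sequentially. x \<in> ?F N"
        by (rule exhaustion_eventually[OF exh x])
      show "(\<lambda>N. \<Sum>y\<in>?F N. mat_exp (?F N) Q t x y) \<longlonglongrightarrow> 1" if "0 \<le> t" for t
        by (rule mat_exp_row_sum_tendsto_1[OF chain generator exh Q x that])
    qed
  qed

  have kernel: "drift_kernel ?A ?P (\<lambda>x. ennreal (\<pi> x)) v b c \<beta> ?\<phi> (?F K) y0"
  proof
    show "countable ?A" by simp
    show "nsum ?A (?P x) = 1" if "x \<in> ?A" for x by (rule honest[OF that])
    show "nsum ?A (\<lambda>x. ennreal (\<pi> x)) = 1" by (rule pi_total)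
    show "nsum ?A (\<lambda>x. ennreal (\<pi> x) * ?P x y) = ennreal (\<pi> y)" if "y \<in> ?A" for y
      by (rule min_resolvent_invariant[OF exh Q \<beta> pi_nonneg pi_Q pi_total honest that])
    show "0 \<le> v x" "1 \<le> c * v x" if "x \<in> ?A" for x using v_nonneg v_ge that by blast+
    show "0 < b" "0 < c" "0 < \<beta>" "0 < ?\<phi>" by (fact bc \<beta> \<phi>)+
    show "ennreal (\<beta> + c) * kapply ?A ?P (\<lambda>y. ennreal (v y)) x
        \<le> ennreal (\<beta> * v x) + ennreal b * kapply ?A ?P (indicator (?F K)) x" if x: "x \<in> ?A" for x
      by (rule min_resolvent_drift[OF exh Q \<beta> _ v_drift _ _ x]) (use v_nonneg bc in auto)
    show "y0 \<in> ?A" using y0(1) states_upto_subset by blast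
    show "ennreal ?\<phi> \<le> ?P x y0" if "x \<in> ?A \<inter> ?F K" for x
    proof -
      have x: "x \<in> ?F K" "x \<in> ?F N" using that states_upto_mono[OF N] by auto
      have "ennreal ?\<phi> \<le> ennreal (finite_resolvent (?F N) Q \<beta> x y0)"
        using y0(2)[OF x(1)] unfolding Phi_trunc_eq by (rule ennreal_leI)
      also have "\<dots> = truncated_resolvent ?F Q \<beta> N x y0"
        using x(2) y0(1) by (simp add: truncated_resolvent_def)
      also have "\<dots> \<le> ?P x y0" by (rule truncated_resolvent_le[OF exh Q \<beta>])
      finally show ?thesis .
    qed
  qed
  interpret D: drift_kernel ?A ?P "\<lambda>x. ennreal (\<pi> x)" v b c \<beta> ?\<phi> "?F K" y0 by (rule kernel)

  have stat: "stationary_distribution ?A (LC_truncation n Q) (\<pi>n n)"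
    using stationary_trunc n by blast
  have supp: "\<pi>n n x = 0" if "x \<in> ?A - ?F n" for x
    by (rule truncation_stationary_support[OF chain generator Q _ stat that])
       (use ergodic in \<open>simp add: ergodic_chain_def\<close>)
  have pn: "0 \<le> \<pi>n n x" if "x \<in> ?A" for x
    using stat that unfolding stationary_distribution_def by blast

  have error: thesis
    if g: "\<And>x. x \<in> ?A \<Longrightarrow> 0 \<le> g x" "\<And>x. x \<in> ?A \<Longrightarrow> g x \<le> c * v x"
      and *: "\<And>G. 0 \<le> G \<Longrightarrow> nn_pairing ?A \<pi> g = ennreal G \<Longrightarrow>
        nn_pairing ?A (\<lambda>x. \<bar>\<pi> x - \<pi>n n x\<bar>) g \<le> ennreal ((G + 1) / 2) * E n \<Longrightarrow> thesis" for g thesis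
    using truncation_error_bound[OF kernel min_resolvent_backward[OF exh Q \<beta>] Q phases n \<phi>(2) pi_nonneg
        stat supp g] * unfolding E_def by blast

  have 1: "nn_pairing ?A (\<lambda>x. \<bar>\<pi> x - \<pi>n n x\<bar>) g \<le> (nn_pairing ?A \<pi> g + 1) / 2 * E n"
    if "\<forall>x\<in>?A. 0 \<le> g x \<and> g x \<le> c * v x" for g
  proof (rule error)
    fix G assume G: "0 \<le> G" "nn_pairing ?A \<pi> g = ennreal G"
      "nn_pairing ?A (\<lambda>x. \<bar>\<pi> x - \<pi>n n x\<bar>) g \<le> ennreal ((G + 1) / 2) * E n"
    have "(ennreal G + 1) / 2 = ennreal ((G + 1) / 2)"
      using G(1) by (simp add: ennreal_divide_numeral[symmetric])
    with G(2,3) show ?thesis by simp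
  qed (use that in auto)

  have 2: "nn_pairing ?A (\<lambda>x. \<bar>\<pi> x - \<pi>n n x\<bar>) g / nn_pairing ?A \<pi> g \<le> E n"
    if g: "\<forall>x\<in>?A. 1 \<le> g x \<and> g x \<le> c * v x" for g
  proof (rule error)
    fix G assume G: "0 \<le> G" "nn_pairing ?A \<pi> g = ennreal G"
      "nn_pairing ?A (\<lambda>x. \<bar>\<pi> x - \<pi>n n x\<bar>) g \<le> ennreal ((G + 1) / 2) * E n"
    have "1 \<le> nn_pairing ?A \<pi> g"
      unfolding nn_pairing_eq pi_total[symmetric]
    proof (rule nsum_mono)
      fix x assume x: "x \<in> ?A"
      then show "ennreal (\<pi> x) \<le> ennreal (\<pi> x * g x)"
        using mult_left_mono[OF _ pi_nonneg[OF x], of 1 "g x"] g by (intro ennreal_leI) auto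
    qed
    then have G1: "1 \<le> G" using G(1,2) by simp
    have "nn_pairing ?A (\<lambda>x. \<bar>\<pi> x - \<pi>n n x\<bar>) g \<le> ennreal G * E n"
      using G1 by (intro order.trans[OF G(3)] mult_right_mono ennreal_leI) auto
    then have "nn_pairing ?A (\<lambda>x. \<bar>\<pi> x - \<pi>n n x\<bar>) g / ennreal G \<le> (E n * ennreal G) / ennreal G"
      by (intro divide_right_mono_ennreal) (simp add: mult.commute)
    also have "\<dots> = E n" using G1 by (intro ennreal_mult_divide_eq) auto
    finally show ?thesis by (simp add: G(2))
  next
    show "0 \<le> g x" if "x \<in> ?A" for x using g that by (meson order.trans zero_le_one)
    show "g x \<le> c * v x" if "x \<in> ?A" for x using g that by blast
  qed

  have 3: "E n \<le> E\<^sub>p n"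
    unfolding E_def E\<^sub>p_def by (rule E_bound_le_E_bound_plus[OF phases n Q v_mono])

  have mean: "(\<Sum>x\<in>?F n. \<pi>n n x * f\<^sub>s x) \<le> b\<^sub>s"
    by (rule truncation_mean_drift_le[OF phases n Q stat supp vs_mono vs_drift]) (use bs in auto)
  have 4: "E\<^sub>p n \<le> ennreal (4 * r\<^sub>0 * r\<^sub>1 * b\<^sub>s / T (real n) *
      (1 + b / (Min (a ` {..S 1}) * V (real (n + 1))) * (1 / c + 2 / (\<beta> * ?\<phi>))))"
    unfolding E\<^sub>p_def
    by (rule E_bound_plus_le[OF phases n Q pn mean fs_ge a_pos V T(1,3) v_eq r0 r1 bc \<beta> \<phi>(1)])

  show "(\<forall>g. (\<forall>x\<in>?A. 0 \<le> g x \<and> g x \<le> c * v x) \<longrightarrow>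
        nn_pairing ?A (\<lambda>x. \<bar>\<pi> x - \<pi>n n x\<bar>) g \<le> (nn_pairing ?A \<pi> g + 1) / 2 * E n) \<and>
     (SUP g\<in>{g. \<forall>x\<in>?A. 1 \<le> g x \<and> g x \<le> c * v x}.
        nn_pairing ?A (\<lambda>x. \<bar>\<pi> x - \<pi>n n x\<bar>) g / nn_pairing ?A \<pi> g) \<le> E n \<and>
     E n \<le> E\<^sub>p n \<and>
     E\<^sub>p n \<le> ennreal (4 * r\<^sub>0 * r\<^sub>1 * b\<^sub>s / T (real n) *
        (1 + b / (Min (a ` {..S 1}) * V (real (n + 1))) * (1 / c + 2 / (\<beta> * ?\<phi>))))"
  proof (intro conjI allI impI SUP_least)
  qed (use 1 2 3 4 in auto)
qed

end
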